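(* Let $\Omega\subset\mathbb{R}^{n+1}$ be a $2$-sided chord-arc domain, and equip $\partial\Omega$ with the Euclidean distance. Then: (1) if $n=1$, then $\partial\Omega$ is quasiconvex; (2) if $n>1$, then $\partial\Omega$ is annularly quasiconvex.
   Context: Let $n\ge1$; $B(x,r)$ denotes the open ball. A closed set $E\subset\mathbb{R}^{n+1}$ is $n$-ADR if there is $D\ge1$ with $D^{-1}r^n\le\mathcal{H}^n(B(x,r)\cap E)\le Dr^n$ for all $x\in E$, $r\in(0,\operatorname{diam}(E))$ ($\operatorname{diam}(E)$ may be infinite). An open set $\Theta\subset\mathbb{R}^{n+1}$ is a chord-arc domain if $\partial\Theta$ is $n$-ADR and $\Theta$ is NTA, i.e.: (i) Harnack chain condition: there is $C\ge1$ and, for every $\Lambda\ge1$, a number $C(\Lambda)$, such that for every $\rho>0$, $\Lambda\ge1$ and $X,X'\in\Theta$ with $\operatorname{dist}(X,\partial\Theta),\operatorname{dist}(X',\partial\Theta)\ge\rho$ and $|X-X'|<\Lambda\rho$ there are open balls $B_1,\dots,B_N\subset\Theta$, $N\le C(\Lambda)$, with $X\in B_1$, $X'\in B_N$, $B_k\cap B_{k+1}\neq\emptyset$ and $C^{-1}\operatorname{diam}(B_k)\le\operatorname{dist}(B_k,\partial\Theta)\le C\operatorname{diam}(B_k)$; (ii) interior and exterior corkscrew conditions: there is $c\in(0,1)$ such that for every $x\in\partial\Theta$ and $0<r<\operatorname{diam}(\partial\Theta)$ there are points $X,X'$ with $B(X,cr)\subset B(x,r)\cap\Theta$ and $B(X',cr)\subset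 B(x,r)\setminus\Theta$. $\Omega$ is a $2$-sided chord-arc domain if both $\Omega$ and the interior of $\mathbb{R}^{n+1}\setminus\Omega$ are chord-arc domains. A metric space $(X,d)$ is quasiconvex if there is $C\ge1$ such that any $x,y\in X$ are joined by a path $\gamma$ in $X$ of length $\ell(\gamma)\le C\,d(x,y)$. It is annularly quasiconvex if there is $C\ge1$ such that whenever $z\in X$, $r<\frac1C\operatorname{diam}(X)$ and $x,y\in B(z,2r)\setminus B(z,r)$, the points $x$ and $y$ can be joined by a path $\gamma$ in $B(z,Cr)\setminus B(z,r/C)$ with $\ell(\gamma)\le C\,d(x,y)$. *)

theory Defs
  imports "HOL-Analysis.Analysis"
begin

text \<open>
  The library's \<^const>\<open>diameter\<close> is real-valued and carries no information for unbounded sets;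
  wherever a set may be unbounded we use the extended diameter.
\<close>

definition ediameter :: "'a::metric_space set \<Rightarrow> ennreal" where
  "ediameter S = (SUP (x, y)\<in>S \<times> S. ennreal (dist x y))"

text \<open>
  Hausdorff measure of integer dimension \<open>n\<close>, without normalising constant.  Multiplying it by a
  positive constant depending only on \<open>n\<close> does not affect Ahlfors--David regularity.  The definition
  is meant for \<open>n \<ge> 1\<close>: for \<open>n = 0\<close> the empty set would contribute \<open>0 ^ 0 = 1\<close>.
\<close>

definition hausdorff_premeasure :: "nat \<Rightarrow> real \<Rightarrow> 'a::metric_space set \<Rightarrow> ennreal" where
  "hausdorff_premeasure n \<delta> E =
     (INF U\<in>{U :: nat \<Rightarrow> 'a set. E \<subseteq> (\<Union>i. U i) \<and> (\<forall>i. ediameter (U i) \<le> ennreal \<delta>)}.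
        \<Sum>i. ediameter (U i) ^ n)"

definition hausdorff_measure :: "nat \<Rightarrow> 'a::metric_space set \<Rightarrow> ennreal" where
  "hausdorff_measure n E = (SUP \<delta>\<in>{0<..}. hausdorff_premeasure n \<delta> E)"

definition ADR :: "nat \<Rightarrow> 'a::metric_space set \<Rightarrow> bool" where
  "ADR n E \<longleftrightarrow> closed E \<and>
     (\<exists>D\<ge>1. \<forall>x\<in>E. \<forall>r>0. ennreal r < ediameter E \<longrightarrow>
        ennreal (r ^ n / D) \<le> hausdorff_measure n (ball x r \<inter> E) \<and>
        hausdorff_measure n (ball x r \<inter> E) \<le> ennreal (D * r ^ n))"

text \<open>
  The chain \<open>B\<^sub>1, \<dots>, B\<^sub>N\<close> is given by centres \<open>b k\<close> and radii \<open>s k\<close>.  Since \<^const>\<open>infdist\<close> to the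
  empty set is \<open>0\<close>, the condition is vacuous when \<open>\<Theta>\<close> has empty boundary, that is, for the empty
  set and the whole space.
\<close>

definition harnack_chain_condition :: "'a::metric_space set \<Rightarrow> bool" where
  "harnack_chain_condition \<Theta> \<longleftrightarrow>
     (\<exists>C\<ge>1. \<forall>\<Lambda>\<ge>1. \<exists>M::nat. \<forall>\<rho>>0. \<forall>X\<in>\<Theta>. \<forall>X'\<in>\<Theta>.
        \<rho> \<le> infdist X (frontier \<Theta>) \<and> \<rho> \<le> infdist X' (frontier \<Theta>) \<and> dist X X' < \<Lambda> * \<rho> \<longrightarrow>
        (\<exists>(N::nat) (b :: nat \<Rightarrow> 'a) (s :: nat \<Rightarrow> real).
           1 \<le> N \<and> N \<le> M \<and>
           X \<in> ball (b 1) (s 1) \<and> X' \<in> ball (b N) (s N) \<and>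
           (\<forall>k\<in>{1..<N}. ball (b k) (s k) \<inter> ball (b (Suc k)) (s (Suc k)) \<noteq> {}) \<and>
           (\<forall>k\<in>{1..N}.
              0 < s k \<and> ball (b k) (s k) \<subseteq> \<Theta> \<and>
              diameter (ball (b k) (s k)) / C \<le> setdist (ball (b k) (s k)) (frontier \<Theta>) \<and>
              setdist (ball (b k) (s k)) (frontier \<Theta>) \<le> C * diameter (ball (b k) (s k)))))"

definition corkscrew_condition :: "'a::metric_space set \<Rightarrow> bool" where
  "corkscrew_condition \<Theta> \<longleftrightarrow>
     (\<exists>c. 0 < c \<and> c < 1 \<and>
        (\<forall>x\<in>frontier \<Theta>. \<forall>r>0. ennreal r < ediameter (frontier \<Theta>) \<longrightarrow>
           (\<exists>X X'. ball X (c * r) \<subseteq> ball x r \<inter> \<Theta> \<and> ball X' (c * r) \<subseteq> ball x r - \<Theta>)))"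

definition NTA :: "'a::metric_space set \<Rightarrow> bool" where
  "NTA \<Theta> \<longleftrightarrow> harnack_chain_condition \<Theta> \<and> corkscrew_condition \<Theta>"

definition chord_arc_domain :: "nat \<Rightarrow> 'a::metric_space set \<Rightarrow> bool" where
  "chord_arc_domain n \<Theta> \<longleftrightarrow> open \<Theta> \<and> ADR n (frontier \<Theta>) \<and> NTA \<Theta>"

definition two_sided_chord_arc_domain :: "nat \<Rightarrow> 'a::metric_space set \<Rightarrow> bool" where
  "two_sided_chord_arc_domain n \<Omega> \<longleftrightarrow>
     chord_arc_domain n \<Omega> \<and> chord_arc_domain n (interior (- \<Omega>))"

definition path_length :: "(real \<Rightarrow> 'a::metric_space) \<Rightarrow> ennreal" where
  "path_length g =
     (SUP (m, t)\<in>{(m :: nat, t :: nat \<Rightarrow> real). mono t \<and> range t \<subseteq> {0..1}}.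
        \<Sum>i<m. ennreal (dist (g (t i)) (g (t (Suc i)))))"

text \<open>
  The remaining notions are stated for a subset \<open>S\<close> of a metric space, regarded as a metric space
  with the restricted distance; its balls are the sets \<open>ball z r \<inter> S\<close>.
\<close>

definition quasiconvex :: "'a::metric_space set \<Rightarrow> bool" where
  "quasiconvex S \<longleftrightarrow>
     (\<exists>C\<ge>1. \<forall>x\<in>S. \<forall>y\<in>S.
        \<exists>\<gamma>. path \<gamma> \<and> path_image \<gamma> \<subseteq> S \<and> pathstart \<gamma> = x \<and> pathfinish \<gamma> = y \<and>
            path_length \<gamma> \<le> ennreal (C * dist x y))"

definition annularly_quasiconvex :: "'a::metric_space set \<Rightarrow> bool" where
  "annularly_quasiconvex S \<longleftrightarrow>
     (\<exists>C\<ge>1. \<forall>z\<in>S. \<forall>r>0. ennreal r < ennreal (1 / C) * ediameter S \<longrightarrow>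
        (\<forall>x\<in>S \<inter> (ball z (2 * r) - ball z r). \<forall>y\<in>S \<inter> (ball z (2 * r) - ball z r).
           \<exists>\<gamma>. path \<gamma> \<and> path_image \<gamma> \<subseteq> S \<inter> (ball z (C * r) - ball z (r / C)) \<and>
               pathstart \<gamma> = x \<and> pathfinish \<gamma> = y \<and>
               path_length \<gamma> \<le> ennreal (C * dist x y)))"

end

theory Submission
  imports Defs
begin

text \<open>
  Write \<open>E\<close> for the common boundary and let \<open>x\<close>, \<open>y\<close> in \<open>E\<close> have distance \<open>2 * r\<close>.  Corkscrew points at
  dyadic scales, joined by Harnack chains on either side of \<open>E\<close>, give a closed discrete loop of step
  \<open>e = r / 2 ^ N\<close> which crosses \<open>E\<close> only near \<open>x\<close> and near \<open>y\<close> and has only \<open>O(\<mu> / e)\<close> vertices within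
  \<open>\<mu>\<close> of \<open>E\<close>.  Take the cone over the loop from an apex chosen at random in \<open>ball x r\<close>, triangulated at
  scale \<open>e\<close>.  By Ahlfors regularity the expected number of its vertices close to \<open>E\<close> is \<open>O(r / e)\<close>, and by
  Sperner's argument the triangles with vertices on both sides of \<open>E\<close> link the crossing near \<open>x\<close> to
  the one near \<open>y\<close>.  This produces a chain in \<open>E\<close> of \<open>O(r / e)\<close> steps of size \<open>O(e)\<close>, and in the limit a path
  of length \<open>O(r)\<close>.  For \<open>n > 1\<close> the cone has codimension \<open>n - 1 > 0\<close>, so with probability at least one half
  it also misses a small ball about the centre of the annulus.
\<close>

subsection \<open>Packing in Ahlfors regular sets\<close>

text \<open>A cone triangulated at scale \<open>e\<close> may have of the order of
  \<open>(r / e)^2\<close> triangles, whereas a chain of bounded total length may use only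
  \<open>O(r / e)\<close> of them. Bounding the number of split triangles is therefore the heart of
  the matter, and a fixed apex cannot give the bound, since the cone may run along \<open>E\<close>
  over a large part of its area. The corkscrew construction serves this bound: it makes the loop
  leave \<open>E\<close> at a rate proportional to the distance from \<open>x\<close> or
  \<open>y\<close>, so that few vertices lie near \<open>E\<close> at any scale. The same property
  keeps the loop away from the centre of an annulus containing \<open>x\<close> and
  \<open>y\<close>. Taking \<open>r\<close> to be half of the distance keeps every corkscrew radius
  \<open>2 ^ j * e\<close>, at most \<open>r\<close>, below the diameter of \<open>E\<close>. The
  cone avoids a ball only of radius proportional to \<open>dist x y\<close>. For the annular
  statement this suffices when \<open>dist x y\<close> is comparable with the annulus; closer pairs
  use quasiconvexity, which is proved for every \<open>n\<close> at least 1.\<close>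

lemma dist_le_ediameter:
  assumes "a \<in> S" "b \<in> S"
  shows "ennreal (dist a b) \<le> ediameter S"
  unfolding ediameter_def using assms by (intro SUP_upper2[of "(a, b)"]) auto

lemma ediameter_empty [simp]: "ediameter {} = 0"
  by (simp add: ediameter_def bot_ennreal)

lemma hausdorff_premeasure_mono:
  "A \<subseteq> B \<Longrightarrow> hausdorff_premeasure n \<delta> A \<le> hausdorff_premeasure n \<delta> B"
  unfolding hausdorff_premeasure_def by (intro INF_superset_mono) auto

lemma hausdorff_premeasure_antimono:
  "\<delta> \<le> \<delta>' \<Longrightarrow> hausdorff_premeasure n \<delta>' A \<le> hausdorff_premeasure n \<delta> A"
  unfolding hausdorff_premeasure_def
  by (intro INF_superset_mono) (auto intro: order_trans ennreal_leI)

lemma hausdorff_premeasure_le_measure: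
  "\<delta> > 0 \<Longrightarrow> hausdorff_premeasure n \<delta> A \<le> hausdorff_measure n A"
  unfolding hausdorff_measure_def by (intro SUP_upper) auto

lemma hausdorff_measure_mono:
  "A \<subseteq> B \<Longrightarrow> hausdorff_measure n A \<le> hausdorff_measure n B"
  unfolding hausdorff_measure_def by (intro SUP_mono) (auto intro: hausdorff_premeasure_mono)

text \<open>A set of diameter at most \<delta> cannot meet both \<open>A\<close> and
  \<open>B\<close>, so a cover of the union splits into a cover of each, with no set used twice.
  Discarded sets become empty and cost \<open>0 ^ n = 0\<close>, which is where
  \<open>1 \<le> n\<close> enters.\<close>

lemma hausdorff_premeasure_separated_Un:
  fixes A B :: "'a::metric_space set"
  assumes n: "1 \<le> n" and \<delta>: "0 \<le> \<delta>"
    and sep: "\<And>a b. a \<in> A \<Longrightarrow> b \<in> B \<Longrightarrow> \<delta> < dist a b"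
  shows "hausdorff_premeasure n \<delta> A + hausdorff_premeasure n \<delta> B \<le> hausdorff_premeasure n \<delta> (A \<union> B)"
proof -
  have "hausdorff_premeasure n \<delta> A + hausdorff_premeasure n \<delta> B \<le> (\<Sum>i. ediameter (U i) ^ n)"
    if U: "A \<union> B \<subseteq> (\<Union>i. U i)" "\<forall>i. ediameter (U i) \<le> ennreal \<delta>" for U :: "nat \<Rightarrow> 'a set"
  proof -
    define UA where "UA i = (if U i \<inter> A \<noteq> {} then U i else {})" for i
    define UB where "UB i = (if U i \<inter> A \<noteq> {} then {} else U i)" for i
    have disj: "U i \<inter> A = {}" if "b \<in> B" "b \<in> U i" for b i
    proof (rule ccontr)
      assume "U i \<inter> A \<noteq> {}"
      then obtain a where a: "a \<in> U i" "a \<in> A" by auto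
      have "ennreal (dist a b) \<le> ennreal \<delta>"
        using dist_le_ediameter[OF a(1) that(2)] U(2) order_trans by blast
      then show False using sep[OF a(2) that(1)] \<delta> by (simp add: ennreal_le_iff)
    qed
    have "hausdorff_premeasure n \<delta> A \<le> (\<Sum>i. ediameter (UA i) ^ n)"
      unfolding hausdorff_premeasure_def using U
    proof (intro INF_lower, clarsimp, intro conjI)
      show "A \<subseteq> (\<Union>i. UA i)"
      proof
        fix a assume a: "a \<in> A"
        then obtain i where "a \<in> U i" using U(1) by blast
        with a show "a \<in> (\<Union>i. UA i)" by (auto simp: UA_def intro!: exI[of _ i])
      qed
      show "\<forall>i. ediameter (UA i) \<le> ennreal \<delta>" using U(2) by (auto simp: UA_def)
    qed
    moreover have "hausdorff_premeasure n \<delta> B \<le> (\<Sum>i. ediameter (UB i) ^ n)"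
      unfolding hausdorff_premeasure_def
    proof (intro INF_lower, clarsimp, intro conjI)
      show "B \<subseteq> (\<Union>i. UB i)"
      proof
        fix b assume b: "b \<in> B"
        then obtain i where i: "b \<in> U i" using U(1) by blast
        with disj[OF b i] show "b \<in> (\<Union>i. UB i)" by (auto simp: UB_def)
      qed
      show "\<forall>i. ediameter (UB i) \<le> ennreal \<delta>" using U(2) by (auto simp: UB_def)
    qed
    moreover have "(\<Sum>i. ediameter (UA i) ^ n) + (\<Sum>i. ediameter (UB i) ^ n)
        = (\<Sum>i. ediameter (UA i) ^ n + ediameter (UB i) ^ n)"
      by (intro suminf_add) auto
    moreover have "ediameter (UA i) ^ n + ediameter (UB i) ^ n = ediameter (U i) ^ n" for i
      using n by (auto simp: UA_def UB_def)
    ultimately show ?thesis by (metis (no_types, lifting) add_mono suminf_cong)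
  qed
  then show ?thesis
    unfolding hausdorff_premeasure_def[of n \<delta> "A \<union> B"] by (intro INF_greatest) auto
qed

lemma hausdorff_premeasure_separated_UN:
  fixes A :: "'i \<Rightarrow> 'a::metric_space set"
  assumes n: "1 \<le> n" and \<delta>: "0 \<le> \<delta>" and "finite I"
    and sep: "\<And>i j a b. i \<in> I \<Longrightarrow> j \<in> I \<Longrightarrow> i \<noteq> j \<Longrightarrow> a \<in> A i \<Longrightarrow> b \<in> A j \<Longrightarrow> \<delta> < dist a b"
  shows "(\<Sum>i\<in>I. hausdorff_premeasure n \<delta> (A i)) \<le> hausdorff_premeasure n \<delta> (\<Union>i\<in>I. A i)"
  using \<open>finite I\<close> sep
proof (induction I rule: finite_induct)
  case (insert i I)
  have "(\<Sum>i\<in>insert i I. hausdorff_premeasure n \<delta> (A i))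
      \<le> hausdorff_premeasure n \<delta> (A i) + hausdorff_premeasure n \<delta> (\<Union>i\<in>I. A i)"
    using insert by (auto intro!: add_left_mono)
  also have "\<dots> \<le> hausdorff_premeasure n \<delta> (A i \<union> (\<Union>i\<in>I. A i))"
    using insert by (intro hausdorff_premeasure_separated_Un[OF n \<delta>]) blast
  finally show ?case by simp
qed auto

text \<open>The factor \<open>1/2\<close> lets one common gauge \<open>\<delta>\<close> serve all the pieces.\<close>

lemma hausdorff_measure_separated_UN:
  fixes A :: "'i \<Rightarrow> 'a::metric_space set"
  assumes n: "1 \<le> n" and \<delta>: "0 < \<delta>" and I: "finite I" and c: "0 < c"
    and low: "\<And>i. i \<in> I \<Longrightarrow> ennreal c \<le> hausdorff_measure n (A i)"
    and sep: "\<And>i j a b. i \<in> I \<Longrightarrow> j \<in> I \<Longrightarrow> i \<noteq> j \<Longrightarrow> a \<in> A i \<Longrightarrow> b \<in> A j \<Longrightarrow> \<delta> < dist a b"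
  shows "ennreal (real (card I) * (c / 2)) \<le> hausdorff_measure n (\<Union>i\<in>I. A i)"
proof -
  have "\<exists>d>0. ennreal (c / 2) \<le> hausdorff_premeasure n d (A i)" if "i \<in> I" for i
  proof -
    have "ennreal (c / 2) < hausdorff_measure n (A i)"
      by (rule less_le_trans[of _ "ennreal c"]) (use low[OF that] c in \<open>auto simp: ennreal_less_iff\<close>)
    then obtain d where "d > 0" "ennreal (c / 2) < hausdorff_premeasure n d (A i)"
      unfolding hausdorff_measure_def less_SUP_iff by auto
    then show ?thesis by (intro exI[of _ d]) auto
  qed
  then obtain d where d: "\<And>i. i \<in> I \<Longrightarrow> d i > 0 \<and> ennreal (c / 2) \<le> hausdorff_premeasure n (d i) (A i)"
    by metis
  \<comment> \<open>Including \<delta> keeps the sets separated at scale \<open>e\<close>, and makes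
    the minimum meaningful also when \<open>I\<close> is empty.\<close>
  define e where "e = Min (insert \<delta> (d ` I))"
  have e: "0 < e" "e \<le> \<delta>" "\<And>i. i \<in> I \<Longrightarrow> e \<le> d i"
    using d \<delta> I by (auto simp: e_def)
  have "ennreal (real (card I) * (c / 2)) = (\<Sum>i\<in>I. ennreal (c / 2))"
    using c by (subst sum_ennreal) (auto)
  also have "\<dots> \<le> (\<Sum>i\<in>I. hausdorff_premeasure n e (A i))"
    using d e by (intro sum_mono) (meson hausdorff_premeasure_antimono order_trans)
  also have "\<dots> \<le> hausdorff_premeasure n e (\<Union>i\<in>I. A i)"
    using sep e by (intro hausdorff_premeasure_separated_UN n I) (auto intro: le_less_trans)
  also have "\<dots> \<le> hausdorff_measure n (\<Union>i\<in>I. A i)"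
    by (rule hausdorff_premeasure_le_measure[OF e(1)])
  finally show ?thesis .
qed

section \<open>Cardinality of separated subsets of a regular set\<close>

definition separated :: "real \<Rightarrow> 'a::metric_space set \<Rightarrow> bool" where
  "separated e F \<longleftrightarrow> (\<forall>a\<in>F. \<forall>b\<in>F. a \<noteq> b \<longrightarrow> e \<le> dist a b)"

text \<open>The balls of radius \<open>e / 4\<close> about the points of \<open>F\<close> are
  \<open>e / 2\<close> apart, so half the sum of their lower measure bounds
  \<open>(e / 4) ^ n / D\<close> is at most the measure of \<open>ball w (2 * \<rho>)\<close>. The
  quotient of the radii \<open>2 * \<rho>\<close> and \<open>e / 4\<close> explains the 8; upper
  regularity at radius \<open>2 * \<rho>\<close> explains the restriction by the diameter.\<close>

lemma ADR_packing_small: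
  assumes "1 \<le> n" "ADR n E"
  obtains C where "C \<ge> 1" "\<And>w \<rho> e F. w \<in> E \<Longrightarrow> 0 < e \<Longrightarrow> e \<le> \<rho> \<Longrightarrow> ennreal (2 * \<rho>) < ediameter E \<Longrightarrow>
    finite F \<Longrightarrow> F \<subseteq> E \<inter> ball w \<rho> \<Longrightarrow> separated e F \<Longrightarrow> real (card F) \<le> C * (\<rho> / e) ^ n"
proof -
  obtain D where D: "D \<ge> 1" and H: "\<And>x r. x \<in> E \<Longrightarrow> r > 0 \<Longrightarrow> ennreal r < ediameter E \<Longrightarrow>
        ennreal (r ^ n / D) \<le> hausdorff_measure n (ball x r \<inter> E) \<and>
        hausdorff_measure n (ball x r \<inter> E) \<le> ennreal (D * r ^ n)"
    using assms(2) unfolding ADR_def by metis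
  show ?thesis
  proof (rule that[of "2 * D\<^sup>2 * 8 ^ n"])
    have "1 * 1 \<le> D\<^sup>2 * 8 ^ n" using D by (intro mult_mono) auto
    then show "1 \<le> 2 * D\<^sup>2 * 8 ^ n" by linarith
    fix w \<rho> e F
    assume w: "w \<in> E" and e: "0 < e" "e \<le> \<rho>" and \<rho>: "ennreal (2 * \<rho>) < ediameter E"
      and F: "finite F" "F \<subseteq> E \<inter> ball w \<rho>" "separated e F"
    have small: "ennreal (e / 4) < ediameter E"
      using e by (intro le_less_trans[OF _ \<rho>] ennreal_leI) auto
    have "ennreal (real (card F) * ((e / 4) ^ n / D / 2)) \<le> hausdorff_measure n (\<Union>f\<in>F. ball f (e / 4) \<inter> E)"
    proof (rule hausdorff_measure_separated_UN[OF assms(1) _ F(1)])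
      show "0 < e / 2" "0 < (e / 4) ^ n / D" using e D by auto
      show "ennreal ((e / 4) ^ n / D) \<le> hausdorff_measure n (ball f (e / 4) \<inter> E)" if "f \<in> F" for f
        using H[of f "e / 4"] that F e small by auto
      fix i j a b
      assume *: "i \<in> F" "j \<in> F" "i \<noteq> j" "a \<in> ball i (e / 4) \<inter> E" "b \<in> ball j (e / 4) \<inter> E"
      then have "e \<le> dist i j" using F(3) by (auto simp: separated_def)
      also have "\<dots> \<le> dist i a + dist a b + dist b j"
        by (metis add.commute add_left_mono dist_commute dist_triangle dist_triangle_le order_trans)
      finally show "e / 2 < dist a b" using * by (auto simp: dist_commute)
    qed
    also have "\<dots> \<le> hausdorff_measure n (ball w (2 * \<rho>) \<inter> E)"
    proof (intro hausdorff_measure_mono subsetI)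
      fix b assume "b \<in> (\<Union>f\<in>F. ball f (e / 4) \<inter> E)"
      then obtain f where f: "f \<in> F" "dist f b < e / 4" "b \<in> E" by auto
      moreover have "dist w f < \<rho>" using f F by auto
      ultimately show "b \<in> ball w (2 * \<rho>) \<inter> E" using dist_triangle[of w b f] e by auto
    qed
    also have "\<dots> \<le> ennreal (D * (2 * \<rho>) ^ n)" using H[OF w _ \<rho>] e by auto
    finally have "real (card F) * ((e / 4) ^ n / D / 2) \<le> D * (2 * \<rho>) ^ n"
      using D e by (subst (asm) ennreal_le_iff) auto
    then have "real (card F) * (e / 4) ^ n \<le> 2 * D\<^sup>2 * (2 * \<rho>) ^ n"
      using D by (simp add: field_simps power2_eq_square)
    then have "real (card F) \<le> 2 * D\<^sup>2 * (2 * \<rho>) ^ n / (e / 4) ^ n"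
      using e by (simp add: field_simps)
    also have "\<dots> = 2 * D\<^sup>2 * 8 ^ n * (\<rho> / e) ^ n"
    proof -
      have "(8::real) ^ n = 2 ^ n * 4 ^ n" by (simp flip: power_mult_distrib)
      then show ?thesis by (simp add: power_divide power_mult_distrib)
    qed
    finally show "real (card F) \<le> 2 * D\<^sup>2 * 8 ^ n * (\<rho> / e) ^ n" .
  qed
qed

lemma ediameter_eq_diameter:
  fixes E :: "'a::metric_space set"
  assumes "bounded E" "E \<noteq> {}"
  shows "ediameter E = ennreal (diameter E)"
proof (rule antisym)
  show "ediameter E \<le> ennreal (diameter E)"
    unfolding ediameter_def
  proof (rule SUP_least)
    fix p assume "p \<in> E \<times> E"
    then show "(case p of (x, y) \<Rightarrow> ennreal (dist x y)) \<le> ennreal (diameter E)"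
      using diameter_bounded_bound[OF assms(1), of "fst p" "snd p"] by (auto intro: ennreal_leI)
  qed
  show "ennreal (diameter E) \<le> ediameter E"
  proof (cases "ediameter E")
    case (real d)
    have "diameter E \<le> d"
      unfolding diameter_def using assms(2) dist_le_ediameter[of _ E] real
      by (auto intro!: cSUP_least simp: ennreal_le_iff)
    then show ?thesis using real by (simp add: ennreal_leI)
  qed simp
qed

lemma ediameter_unbounded:
  fixes E :: "'a::metric_space set"
  assumes "\<not> bounded E"
  shows "ediameter E = top"
proof (cases "ediameter E")
  case (real d)
  have "E \<noteq> {}" using assms by auto
  then obtain a where a: "a \<in> E" by auto
  have "dist a b \<le> d" if "b \<in> E" for b
    using dist_le_ediameter[OF a that] real by (simp add: ennreal_le_iff)
  then show ?thesis using assms by (auto simp: bounded_def)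
qed

text \<open>Removes from the previous bound the restriction on the radius and the requirement that
  the centre lie in \<open>E\<close>. Radii beyond the restriction occur only for bounded, hence
  compact, \<open>E\<close>; there finitely many balls of radius proportional to the diameter reduce
  the matter to small radii, and their number goes into the constant, which may depend on
  \<open>E\<close>.\<close>

lemma ADR_packing:
  fixes E :: "'a::heine_borel set"
  assumes n: "1 \<le> n" and E: "ADR n E"
  obtains C where "C \<ge> 1" "\<And>q \<rho> e F. 0 < e \<Longrightarrow> e \<le> \<rho> \<Longrightarrow>
    finite F \<Longrightarrow> F \<subseteq> E \<inter> ball q \<rho> \<Longrightarrow> separated e F \<Longrightarrow> real (card F) \<le> C * (\<rho> / e) ^ n"
proof -
  obtain C where C: "C \<ge> 1" and pack: "\<And>w \<rho> e F. w \<in> E \<Longrightarrow> 0 < e \<Longrightarrow> e \<le> \<rho> \<Longrightarrow> ennreal (2 * \<rho>) < ediameter E \<Longrightarrow>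
    finite F \<Longrightarrow> F \<subseteq> E \<inter> ball w \<rho> \<Longrightarrow> separated e F \<Longrightarrow> real (card F) \<le> C * (\<rho> / e) ^ n"
    using ADR_packing_small[OF assms] by metis
  obtain K where K: "K \<ge> 1" and packK: "\<And>w \<rho> e F. w \<in> E \<Longrightarrow> 0 < e \<Longrightarrow> e \<le> \<rho> \<Longrightarrow>
    finite F \<Longrightarrow> F \<subseteq> E \<inter> ball w \<rho> \<Longrightarrow> separated e F \<Longrightarrow> real (card F) \<le> K * (\<rho> / e) ^ n"
  proof (cases "bounded E")
    case False
    then show ?thesis using that[OF C] pack ediameter_unbounded[OF False] by auto
  next
    case bdd: True
    show ?thesis
    proof (cases "diameter E > 0")
      case False
      have "real (card F) \<le> 1 * (\<rho> / e) ^ n"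
        if "0 < e" "e \<le> \<rho>" "finite F" "F \<subseteq> E \<inter> ball w \<rho>" "separated e F" for w \<rho> e F
      proof -
        have "a = b" if "a \<in> F" "b \<in> F" for a b
        proof -
          have "dist a b \<le> diameter E" using that \<open>F \<subseteq> _\<close> by (intro diameter_bounded_bound[OF bdd]) auto
          then have "dist a b \<le> 0" using False by linarith
          then show ?thesis by simp
        qed
        then have "card F \<le> 1" using card_le_Suc0_iff_eq[OF \<open>finite F\<close>] by auto
        moreover have "1 \<le> (\<rho> / e) ^ n" using that by (intro one_le_power) auto
        ultimately show ?thesis by linarith
      qed
      then show ?thesis by (intro that[of 1]) auto
    next
      case True
      define d where "d = diameter E"
      have d: "d > 0" "E \<noteq> {}" "ediameter E = ennreal d"
      proof -
        show "d > 0" using True by (simp add: d_def)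
        show "E \<noteq> {}" using True by auto
        from ediameter_eq_diameter[OF bdd this] show "ediameter E = ennreal d" by (simp add: d_def)
      qed
      have "compact E" using E bdd by (simp add: ADR_def compact_eq_bounded_closed)
      moreover have "E \<subseteq> (\<Union>g\<in>E. ball g (d / 32))" using d(1) by force
      ultimately obtain G where G: "G \<subseteq> E" "finite G" "E \<subseteq> (\<Union>g\<in>G. ball g (d / 32))"
        using compactE_image[of E E "\<lambda>g. ball g (d / 32)"] by (metis open_ball)
      show ?thesis
      proof (rule that[of "C * (1 + real (card G))"])
        have "1 * 1 \<le> C * (1 + real (card G))" using C by (intro mult_mono) auto
        then show "1 \<le> C * (1 + real (card G))" by simp
        fix w \<rho> e F
        assume w: "w \<in> E" and e: "0 < e" "e \<le> \<rho>" and F: "finite F" "F \<subseteq> E \<inter> ball w \<rho>" "separated e F"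
        have ge1: "1 \<le> (\<rho> / e) ^ n" using e by (intro one_le_power) auto
        show "real (card F) \<le> C * (1 + real (card G)) * (\<rho> / e) ^ n"
        proof (cases "2 * \<rho> < d")
          case True
          have "real (card F) \<le> C * (\<rho> / e) ^ n"
            using pack[OF w e _ F] True d e by (simp add: ennreal_less_iff)
          also have "\<dots> \<le> C * (1 + real (card G)) * (\<rho> / e) ^ n"
            using C e by (intro mult_right_mono) auto
          finally show ?thesis .
        next
          case False
          have piece: "real (card (F \<inter> ball g (d / 32))) \<le> C * (\<rho> / e) ^ n" if g: "g \<in> G" for g
          \<comment> \<open>Points of \<open>ball g (d / 32)\<close> are less than
            \<open>d / 16\<close> apart, so a coarser separation leaves at most one of them.
            Otherwise the radius \<open>d / 16\<close> is small enough for \<open>pack\<close> and,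
            as \<open>d \<le> 2 * \<rho>\<close>, it is at most \<rho>.\<close>
          proof (cases "e \<le> d / 16")
            case True
            have sub: "F \<inter> ball g (d / 32) \<subseteq> E \<inter> ball g (d / 16)" using F d by auto
            have "real (card (F \<inter> ball g (d / 32))) \<le> C * (d / 16 / e) ^ n"
              using g G F d e True sub
              by (intro pack[of g]) (auto simp: separated_def ennreal_less_iff)
            also have "\<dots> \<le> C * (\<rho> / e) ^ n"
              using C e d False by (intro mult_left_mono power_mono divide_right_mono) auto
            finally show ?thesis .
          next
            case False
            have "a = b" if "a \<in> F \<inter> ball g (d / 32)" "b \<in> F \<inter> ball g (d / 32)" for a b
            proof (rule ccontr)
              assume "a \<noteq> b"
              then have "e \<le> dist a b" using that F(3) by (auto simp: separated_def)
              moreover have "dist a b \<le> dist g a + dist g b" by (rule dist_triangle3)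
              ultimately show False using that False by auto
            qed
            then have "card (F \<inter> ball g (d / 32)) \<le> Suc 0"
              using F(1) by (subst card_le_Suc0_iff_eq) blast+
            moreover have "1 * 1 \<le> C * (\<rho> / e) ^ n" using C ge1 by (intro mult_mono) auto
            ultimately show ?thesis by linarith
          qed
          have "F = (\<Union>g\<in>G. F \<inter> ball g (d / 32))" using F(2) G(3) by auto
          then have "card F \<le> (\<Sum>g\<in>G. card (F \<inter> ball g (d / 32)))"
            using card_UN_le[OF G(2), of "\<lambda>g. F \<inter> ball g (d / 32)"] by simp
          then have "real (card F) \<le> (\<Sum>g\<in>G. real (card (F \<inter> ball g (d / 32))))"
            by (metis of_nat_le_iff of_nat_sum)
          also have "\<dots> \<le> real (card G) * (C * (\<rho> / e) ^ n)"
            using piece by (intro sum_bounded_above) auto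
          also have "\<dots> \<le> C * (1 + real (card G)) * (\<rho> / e) ^ n"
            using C e by (auto simp: algebra_simps)
          finally show ?thesis .
        qed
      qed
    qed
  qed
  show ?thesis
  proof (rule that[of "K * 2 ^ n"])
    have "1 * 1 \<le> K * 2 ^ n" using K by (intro mult_mono) auto
    then show "1 \<le> K * 2 ^ n" by simp
    fix q \<rho> e F
    assume e: "0 < e" "e \<le> \<rho>" and F: "finite F" "F \<subseteq> E \<inter> ball q \<rho>" "separated e F"
    show "real (card F) \<le> K * 2 ^ n * (\<rho> / e) ^ n"
    proof (cases "F = {}")
      case True then show ?thesis using K e by auto
    next
      case False
      then obtain w where w: "w \<in> F" by auto
      \<comment> \<open>Recentring at a point of \<open>F\<close> doubles the radius and costs the
        factor \<open>2 ^ n\<close>.\<close>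
      have "F \<subseteq> E \<inter> ball w (2 * \<rho>)"
      proof
        fix f assume f: "f \<in> F"
        have "dist w f \<le> dist q w + dist q f" by (rule dist_triangle3)
        moreover have "f \<in> E \<inter> ball q \<rho>" "w \<in> ball q \<rho>" using F(2) f w by blast+
        ultimately show "f \<in> E \<inter> ball w (2 * \<rho>)" by auto
      qed
      then have "real (card F) \<le> K * (2 * \<rho> / e) ^ n"
        using w F e by (intro packK[of w]) auto
      then show ?thesis by (simp add: power_mult_distrib power_divide)
    qed
  qed
qed

text \<open>A separated set of greatest cardinality is a net, as a point missed by its balls could
  be added to it. The packing bound both provides the maximum and bounds its cardinality.\<close>

lemma ADR_cover:
  fixes E :: "'a::heine_borel set"
  assumes "1 \<le> n" "ADR n E"
  obtains C where "C \<ge> 1" "\<And>q \<rho> e. 0 < e \<Longrightarrow> e \<le> \<rho> \<Longrightarrow>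
    \<exists>F. finite F \<and> real (card F) \<le> C * (\<rho> / e) ^ n \<and> E \<inter> ball q \<rho> \<subseteq> (\<Union>f\<in>F. ball f e)"
proof -
  obtain C where C: "C \<ge> 1" and pack: "\<And>q \<rho> e F. 0 < e \<Longrightarrow> e \<le> \<rho> \<Longrightarrow>
    finite F \<Longrightarrow> F \<subseteq> E \<inter> ball q \<rho> \<Longrightarrow> separated e F \<Longrightarrow> real (card F) \<le> C * (\<rho> / e) ^ n"
    using ADR_packing[OF assms] by metis
  show ?thesis
  proof (rule that[OF C])
    fix q :: 'a and \<rho> e :: real
    assume e: "0 < e" "e \<le> \<rho>"
    define P where "P F \<longleftrightarrow> finite F \<and> F \<subseteq> E \<inter> ball q \<rho> \<and> separated e F" for F
    have "P {}" by (auto simp: P_def separated_def)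
    moreover have "\<forall>F. P F \<longrightarrow> card F < nat \<lceil>C * (\<rho> / e) ^ n\<rceil> + 1"
    proof (intro allI impI)
      fix F assume "P F"
      then have "real (card F) \<le> C * (\<rho> / e) ^ n" using pack[OF e] by (auto simp: P_def)
      then show "card F < nat \<lceil>C * (\<rho> / e) ^ n\<rceil> + 1" by linarith
    qed
    ultimately obtain F where F: "P F" and max: "\<And>G. P G \<Longrightarrow> card G \<le> card F"
      using ex_has_greatest_nat[of P "{}" card] by blast
    have "E \<inter> ball q \<rho> \<subseteq> (\<Union>f\<in>F. ball f e)"
    proof (rule ccontr)
      assume "\<not> ?thesis"
      then obtain a where a: "a \<in> E \<inter> ball q \<rho>" "\<And>f. f \<in> F \<Longrightarrow> e \<le> dist f a" by force
      then have "P (insert a F)" using F by (auto simp: P_def separated_def dist_commute)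
      moreover have "a \<notin> F" using a(2) e by force
      ultimately show False using max[of "insert a F"] F by (auto simp: P_def)
    qed
    then show "\<exists>F. finite F \<and> real (card F) \<le> C * (\<rho> / e) ^ n \<and> E \<inter> ball q \<rho> \<subseteq> (\<Union>f\<in>F. ball f e)"
      using F pack[OF e] by (auto simp: P_def)
  qed
qed

subsection \<open>Loops around the boundary\<close>

text \<open>Only vertices have to lie in the domain; an edge may leave it. The number of vertices
  takes the place of length, and it can be counted separately near the boundary.\<close>

definition discrete_path :: "'a::metric_space set \<Rightarrow> real \<Rightarrow> 'a list \<Rightarrow> bool" where
  "discrete_path \<Theta> e vs \<longleftrightarrow> vs \<noteq> [] \<and> successively (\<lambda>a b. dist a b \<le> e) vs \<and> set vs \<subseteq> \<Theta>"

lemma discrete_path_singleton [simp]: "discrete_path \<Theta> e [a] \<longleftrightarrow> a \<in> \<Theta>"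
  by (auto simp: discrete_path_def)

lemma discrete_path_append:
  assumes "discrete_path \<Theta> e vs" "discrete_path \<Theta> e ws" "dist (last vs) (hd ws) \<le> e"
  shows "discrete_path \<Theta> e (vs @ ws)"
  using assms by (auto simp: discrete_path_def successively_append_iff)

lemma discrete_path_rev:
  assumes "discrete_path \<Theta> e vs"
  shows "discrete_path \<Theta> e (rev vs)"
  using assms by (auto simp: discrete_path_def dist_commute)

lemma discrete_path_mono:
  assumes "discrete_path \<Theta> e vs" "\<Theta> \<subseteq> \<Theta>'" "e \<le> e'"
  shows "discrete_path \<Theta>' e' vs"
  using assms by (auto simp: discrete_path_def intro: successively_mono)

lemma discrete_path_dist_hd:
  assumes "discrete_path \<Theta> e vs" "v \<in> set vs" "0 \<le> e"
  shows "dist (hd vs) v \<le> real (length vs) * e"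
  using assms
proof (induction vs)
  case (Cons a vs)
  show ?case
  proof (cases "v = a \<or> vs = []")
    case False
    then have "discrete_path \<Theta> e vs" "dist a (hd vs) \<le> e" "v \<in> set vs"
      using Cons.prems by (auto simp: discrete_path_def successively_Cons)
    moreover from this have "dist (hd vs) v \<le> real (length vs) * e"
      using Cons.IH Cons.prems(3) by blast
    moreover have "dist a v \<le> dist a (hd vs) + dist (hd vs) v" by (rule dist_triangle)
    ultimately show ?thesis by (simp add: algebra_simps)
  qed (use Cons.prems in auto)
qed (auto simp: discrete_path_def)

section \<open>Discrete paths along Harnack chains\<close>

lemma discrete_path_ball:
  fixes c :: "'a::real_normed_vector"
  assumes e: "0 < e" and ab: "a \<in> ball c s" "b \<in> ball c s"
  obtains vs where "discrete_path (ball c s) e vs" "hd vs = a" "last vs = b"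
    "real (length vs) \<le> 2 + 2 * s / e"
proof -
  have s: "0 < s" using ab(1) by (metis ball_eq_empty empty_iff not_le)
  define K where "K = nat \<lceil>2 * s / e\<rceil>"
  have pos: "0 < 2 * s / e" using s e by simp
  have K: "0 < K" "2 * s / e \<le> real K" "real K \<le> 2 * s / e + 1"
    using pos unfolding K_def by linarith+
  define p where "p j = a + (real j / real K) *\<^sub>R (b - a)" for j
  define vs where "vs = map p [0..<Suc K]"
  have "dist a b \<le> dist c a + dist c b" by (rule dist_triangle3)
  then have "norm (b - a) \<le> 2 * s" using ab by (simp add: dist_norm norm_minus_commute)
  also have "\<dots> \<le> real K * e" using K(2) e by (simp add: field_simps)
  finally have ba: "norm (b - a) \<le> real K * e" .
  have "dist (p j) (p (Suc j)) \<le> e" for j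
  proof -
    have "p (Suc j) - p j = (real (Suc j) / real K - real j / real K) *\<^sub>R (b - a)"
      by (simp add: p_def scaleR_left_diff_distrib)
    also have "real (Suc j) / real K - real j / real K = 1 / real K"
      by (simp add: add_divide_distrib)
    finally have "p (Suc j) - p j = (1 / real K) *\<^sub>R (b - a)" .
    then have "dist (p j) (p (Suc j)) = norm (b - a) / real K"
      by (simp add: dist_norm norm_minus_commute[of "p j"])
    also have "\<dots> \<le> e" using ba K(1) by (simp add: field_simps)
    finally show ?thesis .
  qed
  moreover have "p j \<in> ball c s" if "j \<le> K" for j
  proof -
    have "p j = (1 - real j / real K) *\<^sub>R a + (real j / real K) *\<^sub>R b"
      by (simp add: p_def algebra_simps)
    moreover have "(1 - real j / real K) *\<^sub>R a + (real j / real K) *\<^sub>R b \<in> ball c s"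
      using ab that K(1) by (intro convexD[OF convex_ball]) auto
    ultimately show ?thesis by simp
  qed
  ultimately have "discrete_path (ball c s) e vs"
    unfolding discrete_path_def vs_def by (auto simp: successively_map successively_conv_nth simp del: upt_Suc)
  moreover have "hd vs = a" "last vs = b"
    using K(1) by (auto simp: vs_def p_def hd_map last_map)
  moreover have "real (length vs) \<le> 2 + 2 * s / e" using K(3) by (simp add: vs_def)
  ultimately show ?thesis by (rule that)
qed

text \<open>The function \<open>h\<close> stands for the distance to the boundary, of which only
  this matters: on each ball it is comparable with the radius. Two of its values in one ball differ
  by a factor of at most \<open>2 * C\<^sup>2\<close>, a loss compounded over \<open>N\<close>
  balls. Each radius is bounded by a value of \<open>h\<close> already reached, and this bounds the
  number of steps along the chord.\<close>

lemma discrete_path_harnack_chain: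
  fixes \<Theta> :: "'a::real_normed_vector set" and b :: "nat \<Rightarrow> 'a"
  assumes C: "1 \<le> C" and e: "0 < e"
    and ball: "\<And>k. k \<in> {1..N} \<Longrightarrow> ball (b k) (s k) \<subseteq> \<Theta>"
    and h: "\<And>k u. k \<in> {1..N} \<Longrightarrow> u \<in> ball (b k) (s k) \<Longrightarrow> 2 * s k / C \<le> h u \<and> h u \<le> 4 * C * s k"
    and meet: "\<And>k. k \<in> {1..<N} \<Longrightarrow> ball (b k) (s k) \<inter> ball (b (Suc k)) (s (Suc k)) \<noteq> {}"
    and N: "1 \<le> N" and X: "X \<in> ball (b 1) (s 1)" and Y: "Y \<in> ball (b N) (s N)"
  shows "\<exists>vs. discrete_path \<Theta> e vs \<and> hd vs = X \<and> last vs = Y \<and>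
    (\<forall>v\<in>set vs. h X / (2 * C\<^sup>2) ^ N \<le> h v) \<and> h Y \<le> (2 * C\<^sup>2) ^ N * h X \<and>
    real (length vs) \<le> 1 + real N * (2 + C * (2 * C\<^sup>2) ^ N * h X / e)"
proof -
  define B where "B = 2 * C\<^sup>2"
  have B: "B \<ge> 1" using one_le_power[OF C, of 2] unfolding B_def by linarith
  have hX: "0 \<le> h X"
  proof -
    have "X \<in> ball (b 1) (s 1)" by (rule X)
    then have "0 < s 1" by (metis ball_eq_empty empty_iff not_le)
    then show ?thesis using h[of 1 X] X N C by (smt (verit) atLeastAtMost_iff divide_nonneg_nonneg order_refl)
  qed
  \<comment> \<open>The state after \<open>k\<close> balls, stopping at \<open>w\<close>. The upper
    bound on \<open>h w\<close> controls the radius of the next ball, hence the number of steps in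
    it.\<close>
  define Z where "Z k w vs \<longleftrightarrow> discrete_path \<Theta> e vs \<and> hd vs = X \<and> last vs = w \<and>
    (\<forall>v\<in>set vs. h X / B ^ k \<le> h v) \<and> h w \<le> B ^ k * h X \<and>
    real (length vs) \<le> 1 + real k * (2 + C * B ^ k * h X / e)" for k w vs
  have extend: "\<exists>vs'. Z (Suc k) u vs'"
    if k: "k < N" and Z: "Z k w vs" and wu: "w \<in> ball (b (Suc k)) (s (Suc k))" "u \<in> ball (b (Suc k)) (s (Suc k))"
    for k w u vs
  proof -
    obtain ws where ws: "discrete_path (ball (b (Suc k)) (s (Suc k))) e ws" "hd ws = w" "last ws = u"
      "real (length ws) \<le> 2 + 2 * s (Suc k) / e"
      using discrete_path_ball[OF e wu] by metis
    have K: "Suc k \<in> {1..N}" using k by auto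
    have w: "w \<in> set vs" using Z by (auto simp: Z_def discrete_path_def)
    have hw: "h X / B ^ k \<le> h w" "h w \<le> B ^ k * h X" using Z w by (auto simp: Z_def)
    have comp: "h u' \<le> B * h u''" if "u' \<in> ball (b (Suc k)) (s (Suc k))" "u'' \<in> ball (b (Suc k)) (s (Suc k))" for u' u''
    proof -
      have "s (Suc k) \<le> C / 2 * h u''" using h[OF K that(2)] C by (simp add: field_simps)
      then have "4 * C * s (Suc k) \<le> 4 * C * (C / 2 * h u'')" using C by (intro mult_left_mono) auto
      then show ?thesis using h[OF K that(1)] by (simp add: B_def power2_eq_square)
    qed
    have low: "h X / B ^ Suc k \<le> h v" if "v \<in> ball (b (Suc k)) (s (Suc k))" for v
    proof -
      have "h X / B ^ k \<le> B * h v" using comp[OF wu(1) that] hw(1) by linarith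
      then show ?thesis using B by (simp add: field_simps)
    qed
    have "h X / B ^ Suc k \<le> h X / B ^ k"
      using B hX by (intro divide_left_mono) (auto simp: mult_le_cancel_right1)
    then have low': "h X / B ^ Suc k \<le> h v" if "v \<in> set vs" for v using Z that by (force simp: Z_def)
    have up: "h u \<le> B ^ Suc k * h X"
    proof -
      have "h u \<le> B * h w" by (rule comp[OF wu(2,1)])
      also have "\<dots> \<le> B * (B ^ k * h X)" using hw(2) B by (intro mult_left_mono) auto
      finally show ?thesis by (simp add: mult.assoc)
    qed
    have Bk: "B ^ k \<le> B ^ Suc k" using B by (intro power_increasing) auto
    have "2 * s (Suc k) \<le> C * h w" using h[OF K wu(1)] C by (simp add: field_simps)
    also have "\<dots> \<le> C * (B ^ k * h X)" using hw(2) C by (intro mult_left_mono) auto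
    also have "\<dots> \<le> C * (B ^ Suc k * h X)" using Bk C hX by (intro mult_left_mono mult_right_mono) auto
    finally have s2: "2 * s (Suc k) / e \<le> C * B ^ Suc k * h X / e"
      using e by (simp add: divide_right_mono mult.assoc)
    have "C * B ^ k * h X / e \<le> C * B ^ Suc k * h X / e"
      using Bk C hX e by (intro divide_right_mono mult_right_mono mult_left_mono) auto
    then have "real k * (2 + C * B ^ k * h X / e) \<le> real k * (2 + C * B ^ Suc k * h X / e)"
      by (intro mult_left_mono add_left_mono) auto
    moreover have "real (length vs) \<le> 1 + real k * (2 + C * B ^ k * h X / e)" using Z by (simp add: Z_def)
    moreover have "1 + real (Suc k) * (2 + C * B ^ Suc k * h X / e)
        = 1 + real k * (2 + C * B ^ Suc k * h X / e) + (2 + C * B ^ Suc k * h X / e)"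
      by (simp only: of_nat_Suc distrib_right mult_1)
    ultimately have "real (length (vs @ ws)) \<le> 1 + real (Suc k) * (2 + C * B ^ Suc k * h X / e)"
      using ws(4) s2 unfolding length_append of_nat_add by linarith
    moreover have "discrete_path \<Theta> e (vs @ ws)"
      using Z ws ball[OF K] e by (intro discrete_path_append discrete_path_mono[OF ws(1)]) (auto simp: Z_def)
    ultimately have "Z (Suc k) u (vs @ ws)"
      using Z ws low low' up unfolding Z_def by (auto simp: discrete_path_def)
    then show ?thesis by blast
  qed
  have "\<exists>vs. Z k w vs" if "1 \<le> k" "k \<le> N" "w \<in> ball (b k) (s k)" for k w
    using that
  proof (induction k arbitrary: w rule: dec_induct)
    case base
    have "Z 0 X [X]" using ball[of 1] N X by (auto simp: Z_def)
    from extend[OF _ this] show ?case using N X base by auto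
  next
    case (step k)
    then obtain u where u: "u \<in> ball (b k) (s k)" "u \<in> ball (b (Suc k)) (s (Suc k))" using meet[of k] by auto
    then obtain vs where "Z k u vs" using step by auto
    from extend[OF _ this] show ?case using u step by auto
  qed
  then show ?thesis using N Y unfolding Z_def B_def by blast
qed

text \<open>The Harnack chain condition bounds the number of balls. Their sizes follow from the size
  of the first, which is why the distance of \<open>X\<close> from the boundary is also bounded
  above; the number of steps is then \<open>O(\<rho> / e)\<close>.\<close>

lemma harnack_discrete_path:
  fixes \<Theta> :: "'a::euclidean_space set"
  assumes harnack: "harnack_chain_condition \<Theta>" and ne: "frontier \<Theta> \<noteq> {}" and A: "1 \<le> A"
  obtains L where "1 \<le> L" "\<And>\<rho> e X Y. 0 < e \<Longrightarrow> e \<le> \<rho> \<Longrightarrow> X \<in> \<Theta> \<Longrightarrow> Y \<in> \<Theta> \<Longrightarrow>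
    \<rho> \<le> infdist X (frontier \<Theta>) \<Longrightarrow> infdist X (frontier \<Theta>) \<le> A * \<rho> \<Longrightarrow> \<rho> \<le> infdist Y (frontier \<Theta>) \<Longrightarrow>
    dist X Y < A * \<rho> \<Longrightarrow>
    \<exists>vs. discrete_path \<Theta> e vs \<and> hd vs = X \<and> last vs = Y \<and>
      (\<forall>v\<in>set vs. \<rho> / L \<le> infdist v (frontier \<Theta>)) \<and> real (length vs) \<le> L * \<rho> / e"
proof -
  define E where "E = frontier \<Theta>"
  obtain C where C: "1 \<le> C" and "\<forall>\<Lambda>\<ge>1. \<exists>M::nat. \<forall>\<rho>>0. \<forall>X\<in>\<Theta>. \<forall>X'\<in>\<Theta>.
        \<rho> \<le> infdist X E \<and> \<rho> \<le> infdist X' E \<and> dist X X' < \<Lambda> * \<rho> \<longrightarrow>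
        (\<exists>(N::nat) (b :: nat \<Rightarrow> 'a) (s :: nat \<Rightarrow> real).
           1 \<le> N \<and> N \<le> M \<and>
           X \<in> ball (b 1) (s 1) \<and> X' \<in> ball (b N) (s N) \<and>
           (\<forall>k\<in>{1..<N}. ball (b k) (s k) \<inter> ball (b (Suc k)) (s (Suc k)) \<noteq> {}) \<and>
           (\<forall>k\<in>{1..N}.
              0 < s k \<and> ball (b k) (s k) \<subseteq> \<Theta> \<and>
              diameter (ball (b k) (s k)) / C \<le> setdist (ball (b k) (s k)) E \<and>
              setdist (ball (b k) (s k)) E \<le> C * diameter (ball (b k) (s k))))"
    using harnack unfolding harnack_chain_condition_def E_def by blast
  then obtain M :: nat where M: "\<And>\<rho> X X'. \<rho> > 0 \<Longrightarrow> X \<in> \<Theta> \<Longrightarrow> X' \<in> \<Theta> \<Longrightarrow>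
        \<rho> \<le> infdist X E \<Longrightarrow> \<rho> \<le> infdist X' E \<Longrightarrow> dist X X' < A * \<rho> \<Longrightarrow>
        (\<exists>(N::nat) (b :: nat \<Rightarrow> 'a) (s :: nat \<Rightarrow> real).
           1 \<le> N \<and> N \<le> M \<and>
           X \<in> ball (b 1) (s 1) \<and> X' \<in> ball (b N) (s N) \<and>
           (\<forall>k\<in>{1..<N}. ball (b k) (s k) \<inter> ball (b (Suc k)) (s (Suc k)) \<noteq> {}) \<and>
           (\<forall>k\<in>{1..N}.
              0 < s k \<and> ball (b k) (s k) \<subseteq> \<Theta> \<and>
              diameter (ball (b k) (s k)) / C \<le> setdist (ball (b k) (s k)) E \<and>
              setdist (ball (b k) (s k)) E \<le> C * diameter (ball (b k) (s k))))"
    using A by metis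
  define B where "B = 2 * C\<^sup>2"
  have B: "B \<ge> 1" using one_le_power[OF C, of 2] unfolding B_def by linarith
  define L where "L = B ^ M + 1 + real M * (2 + C * B ^ M * A)"
  have BM: "1 \<le> B ^ M" using B by (rule one_le_power)
  have nn: "0 \<le> real M * (2 + C * B ^ M * A)" using C A BM by auto
  show ?thesis
  proof (rule that[of L])
    show "1 \<le> L" using BM nn by (simp add: L_def)
    fix \<rho> e X Y
    assume e: "0 < e" "e \<le> \<rho>" and XY: "X \<in> \<Theta>" "Y \<in> \<Theta>"
      and dX: "\<rho> \<le> infdist X (frontier \<Theta>)" "infdist X (frontier \<Theta>) \<le> A * \<rho>" 
      and dY: "\<rho> \<le> infdist Y (frontier \<Theta>)" and dXY: "dist X Y < A * \<rho>"
    obtain N b s where N: "1 \<le> N" "N \<le> M" and X: "X \<in> ball (b 1) (s 1)" and Y: "Y \<in> ball (b N) (s N)"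
      and meet: "\<And>k. k \<in> {1..<N} \<Longrightarrow> ball (b k) (s k) \<inter> ball (b (Suc k)) (s (Suc k)) \<noteq> {}"
      and sub: "\<And>k. k \<in> {1..N} \<Longrightarrow> 0 < s k \<and> ball (b k) (s k) \<subseteq> \<Theta> \<and>
              diameter (ball (b k) (s k)) / C \<le> setdist (ball (b k) (s k)) E \<and>
              setdist (ball (b k) (s k)) E \<le> C * diameter (ball (b k) (s k))"
      using M[of \<rho> X Y] e XY dX dY dXY unfolding E_def[symmetric] by (auto simp: E_def)
    \<comment> \<open>The distance from \<open>u\<close> to \<open>E\<close> lies between the
      distance from the ball and that distance plus the diameter \<open>2 * s k\<close>. As
      \<open>C\<close> is at least 1, the upper bound \<open>2 * C * s k + 2 * s k\<close> is at
      most \<open>4 * C * s k\<close>.\<close>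
    have h: "2 * s k / C \<le> infdist u E \<and> infdist u E \<le> 4 * C * s k"
      if k: "k \<in> {1..N}" and u: "u \<in> ball (b k) (s k)" for k u
    proof -
      have sk: "0 < s k" and d: "2 * s k / C \<le> setdist (ball (b k) (s k)) E" "setdist (ball (b k) (s k)) E \<le> C * (2 * s k)"
        using sub[OF k] by auto
      have "setdist (ball (b k) (s k)) E \<le> setdist {u} E"
        using u by (intro setdist_subset_left) auto
      moreover have "infdist u E - 2 * s k \<le> setdist (ball (b k) (s k)) E"
      proof (rule le_setdistI)
        show "ball (b k) (s k) \<noteq> {}" using u by blast
        show "E \<noteq> {}" using ne by (simp add: E_def)
        fix w z assume w: "w \<in> ball (b k) (s k)" and z: "z \<in> E"
        have "infdist u E \<le> dist u z" by (rule infdist_le[OF z])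
        moreover have "dist u z \<le> dist u w + dist w z" by (rule dist_triangle)
        moreover have "dist u w \<le> dist (b k) u + dist (b k) w" by (rule dist_triangle3)
        ultimately show "infdist u E - 2 * s k \<le> dist w z" using u w by auto
      qed
      moreover have "2 * s k \<le> 2 * C * s k" using sk C by simp
      ultimately show ?thesis using d by (auto simp: infdist_eq_setdist)
    qed
    obtain vs where vs: "discrete_path \<Theta> e vs" "hd vs = X" "last vs = Y"
      "\<And>v. v \<in> set vs \<Longrightarrow> infdist X E / B ^ N \<le> infdist v E" 
      "real (length vs) \<le> 1 + real N * (2 + C * B ^ N * infdist X E / e)"
    proof -
      have "\<exists>vs. discrete_path \<Theta> e vs \<and> hd vs = X \<and> last vs = Y \<and>
        (\<forall>v\<in>set vs. infdist X E / (2 * C\<^sup>2) ^ N \<le> infdist v E) \<and> infdist Y E \<le> (2 * C\<^sup>2) ^ N * infdist X E \<and>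
        real (length vs) \<le> 1 + real N * (2 + C * (2 * C\<^sup>2) ^ N * infdist X E / e)"
        by (rule discrete_path_harnack_chain[where h = "\<lambda>u. infdist u E", OF C e(1) _ h meet N(1) X Y])
          (use sub in auto)
      then show ?thesis using that unfolding B_def by metis
    qed
    have BN: "1 \<le> B ^ N" "B ^ N \<le> B ^ M" using B N by (auto intro: power_increasing one_le_power)
    have "\<rho> / L \<le> infdist v E" if "v \<in> set vs" for v
    proof -
      have "\<rho> / L \<le> infdist X E / B ^ N"
        using e dX BN nn by (intro frac_le) (auto simp: E_def L_def)
      then show ?thesis using vs(4)[OF that] by linarith
    qed
    moreover have "real (length vs) \<le> L * \<rho> / e"
    proof -
      have er: "1 \<le> \<rho> / e" using e by simp
      have "2 + C * B ^ N * infdist X E / e \<le> (2 + C * B ^ M * A) * (\<rho> / e)"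
      proof -
        have "(2 + C * B ^ M * A) * (\<rho> / e) = 2 * (\<rho> / e) + C * B ^ M * (A * \<rho>) / e"
          by (simp add: algebra_simps)
        moreover have "C * B ^ N * infdist X E / e \<le> C * B ^ M * (A * \<rho>) / e"
          using dX e BN BM C by (intro divide_right_mono mult_mono) (auto simp: E_def infdist_nonneg)
        ultimately show ?thesis using er by linarith
      qed
      then have "real N * (2 + C * B ^ N * infdist X E / e) \<le> real M * ((2 + C * B ^ M * A) * (\<rho> / e))"
        using N e C BN infdist_nonneg[of X E] by (intro mult_mono) auto
      then have "real (length vs) \<le> (1 + real M * (2 + C * B ^ M * A)) * (\<rho> / e)"
        using vs(5) er by (simp add: algebra_simps)
      also have "\<dots> \<le> L * (\<rho> / e)" using BM e by (intro mult_right_mono) (auto simp: L_def)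
      finally show ?thesis by simp
    qed
    ultimately show "\<exists>vs. discrete_path \<Theta> e vs \<and> hd vs = X \<and> last vs = Y \<and>
      (\<forall>v\<in>set vs. \<rho> / L \<le> infdist v (frontier \<Theta>)) \<and> real (length vs) \<le> L * \<rho> / e"
      using vs by (auto simp: E_def)
  qed
qed

section \<open>Corkscrew points and discrete paths ending at the boundary\<close>

definition corkscrew_point :: "'a::metric_space set \<Rightarrow> real \<Rightarrow> 'a \<Rightarrow> real \<Rightarrow> 'a \<Rightarrow> bool" where
  "corkscrew_point \<Theta> c x r X \<longleftrightarrow> X \<in> \<Theta> \<and> dist x X < r \<and> c * r \<le> infdist X (frontier \<Theta>)"

lemma corkscrew_point_exists:
  fixes \<Theta> :: "'a::metric_space set"
  assumes "open \<Theta>" "corkscrew_condition \<Theta>"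
  obtains c where "0 < c" "c < 1"
    "\<And>x r. x \<in> frontier \<Theta> \<Longrightarrow> 0 < r \<Longrightarrow> ennreal r < ediameter (frontier \<Theta>) \<Longrightarrow> \<exists>X. corkscrew_point \<Theta> c x r X"
proof -
  obtain c where c: "0 < c" "c < 1" and cork: "\<And>x r. x \<in> frontier \<Theta> \<Longrightarrow> r > 0 \<Longrightarrow> ennreal r < ediameter (frontier \<Theta>) \<Longrightarrow>
           (\<exists>X. ball X (c * r) \<subseteq> ball x r \<inter> \<Theta>)"
    using assms(2) unfolding corkscrew_condition_def by metis
  show ?thesis
  proof (rule that[OF c])
    fix x r assume x: "x \<in> frontier \<Theta>" and r: "0 < r" "ennreal r < ediameter (frontier \<Theta>)"
    obtain X where X: "ball X (c * r) \<subseteq> ball x r \<inter> \<Theta>" using cork[OF x r] by auto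
    have "X \<in> ball X (c * r)" using c r by simp
    then have "X \<in> ball x r \<inter> \<Theta>" using X by blast
    then have "X \<in> \<Theta>" "dist x X < r" by auto
    moreover have "c * r \<le> infdist X (frontier \<Theta>)"
    proof -
      have "c * r \<le> dist X z" if "z \<in> frontier \<Theta>" for z
      proof (rule ccontr)
        assume "\<not> c * r \<le> dist X z"
        then have "z \<in> ball X (c * r)" by simp
        then have "z \<in> \<Theta>" using X by blast
        then show False using that frontier_disjoint_eq[of \<Theta>] assms(1) by blast
      qed
      then show ?thesis using x by (subst infdist_notempty) (auto intro!: cINF_greatest)
    qed
    ultimately show "\<exists>X. corkscrew_point \<Theta> c x r X" 
      by (auto simp: corkscrew_point_def)
  qed
qed

text \<open>Repeated vertices count each time, because later every index of the loop carries its own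
  ray of the cone.\<close>

definition near_count :: "'a::metric_space set \<Rightarrow> real \<Rightarrow> 'a list \<Rightarrow> nat" where
  "near_count E \<mu> vs = length (filter (\<lambda>v. infdist v E \<le> \<mu>) vs)"

lemma near_count_append [simp]: "near_count E \<mu> (vs @ ws) = near_count E \<mu> vs + near_count E \<mu> ws"
  by (simp add: near_count_def)

lemma near_count_rev [simp]: "near_count E \<mu> (rev vs) = near_count E \<mu> vs"
  by (simp add: near_count_def rev_filter[symmetric])

lemma near_count_le_length: "near_count E \<mu> vs \<le> length vs"
  by (simp add: near_count_def)

text \<open>For \<open>\<mu> < \<delta>\<close> nothing is counted; otherwise the whole length, at
  most \<open>K * \<delta>\<close>, is already small enough.\<close>

lemma near_count_le:
  assumes far: "\<And>v. v \<in> set vs \<Longrightarrow> \<delta> \<le> infdist v E" and len: "real (length vs) \<le> K * \<delta>" and K: "0 \<le> K" and \<mu>: "0 \<le> \<mu>"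
  shows "real (near_count E \<mu> vs) \<le> K * \<mu>"
proof (cases "\<mu> < \<delta>")
  case True
  then have "near_count E \<mu> vs = 0" using far by (force simp: near_count_def filter_empty_conv)
  then show ?thesis using K \<mu> by simp
next
  case False
  then have "K * \<delta> \<le> K * \<mu>" using K by (intro mult_left_mono) auto
  then show ?thesis using len near_count_le_length[of E \<mu> vs] by linarith
qed

text \<open>Corkscrew points of consecutive scales are joined by Harnack chains. The piece at scale
  \<open>2 ^ j * e\<close> has \<open>O(2 ^ j)\<close> vertices, all at distance at least a fixed
  multiple of \<open>2 ^ j * e\<close> from the boundary. A neighbourhood of width \<mu> therefore
  sees only pieces with \<open>2 ^ j * e = O(\<mu>)\<close>, whose sizes form a geometric series. In
  each piece the distance to \<open>x\<close> is at most, and the distance to the boundary at least,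
  a multiple of the scale, which gives the cigar bound.\<close>

lemma corkscrew_cigar:
  fixes \<Theta> :: "'a::euclidean_space set"
  assumes harnack: "harnack_chain_condition \<Theta>" and ne: "frontier \<Theta> \<noteq> {}" and c: "0 < c" "c < 1"
  obtains K where "1 \<le> K" "\<And>x e X J. x \<in> frontier \<Theta> \<Longrightarrow> 0 < e \<Longrightarrow>
     (\<And>j. j \<le> J \<Longrightarrow> corkscrew_point \<Theta> c x (2 ^ j * e) (X j)) \<Longrightarrow>
     \<exists>vs. discrete_path \<Theta> e vs \<and> hd vs = X 0 \<and> last vs = X J \<and>
       (\<forall>\<mu>\<ge>0. real (near_count (frontier \<Theta>) \<mu> vs) \<le> K * \<mu> / e) \<and>
       (\<forall>v\<in>set vs. dist x v \<le> K * infdist v (frontier \<Theta>) \<and> dist x v \<le> K * (2 ^ J * e))"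
proof -
  define E where "E = frontier \<Theta>"
  \<comment> \<open>Consecutive corkscrew points are less than \<open>r + 2 * r\<close> apart, while
    their boundary distance is only known to be at least \<open>c * r\<close>.\<close>
  have "1 \<le> 3 / c" using c by simp
  then obtain L where L: "1 \<le> L" and conn: "\<And>\<rho> e X Y. 0 < e \<Longrightarrow> e \<le> \<rho> \<Longrightarrow> X \<in> \<Theta> \<Longrightarrow> Y \<in> \<Theta> \<Longrightarrow>
    \<rho> \<le> infdist X E \<Longrightarrow> infdist X E \<le> 3 / c * \<rho> \<Longrightarrow> \<rho> \<le> infdist Y E \<Longrightarrow> dist X Y < 3 / c * \<rho> \<Longrightarrow>
    \<exists>vs. discrete_path \<Theta> e vs \<and> hd vs = X \<and> last vs = Y \<and>
      (\<forall>v\<in>set vs. \<rho> / L \<le> infdist v E) \<and> real (length vs) \<le> L * \<rho> / e"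
    using harnack_discrete_path[OF harnack ne, of "3 / c"] unfolding E_def by metis
  define K where "K = (1 + L) * 2 * L / c"
  have "L * 1 \<le> L * L" using L by (intro mult_left_mono) auto
  then have L2: "1 \<le> (1 + L) * 2 * L" "2 * L * L \<le> (1 + L) * 2 * L" "(1 + L) * L \<le> (1 + L) * 2 * L"
    using L unfolding distrib_right by linarith+
  have K2: "K \<ge> 2 * L * L / c" "K \<ge> (1 + L) * L / c" and K1: "K \<ge> 1 / c"
    unfolding K_def using c L2 by (auto intro!: divide_right_mono)
  have "(1 + L) * 1 \<le> (1 + L) * (L / c)" using L c by (intro mult_left_mono) (auto simp: field_simps)
  then have KL: "1 + L \<le> K" using K2 by simp
  show ?thesis
  proof (rule that[of K])
    show "1 \<le> K" using KL L by simp
    fix x :: 'a and e :: real and X :: "nat \<Rightarrow> 'a" and J :: nat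
    assume x: "x \<in> frontier \<Theta>" and e: "0 < e"
    assume cork: "\<And>j. j \<le> J \<Longrightarrow> corkscrew_point \<Theta> c x (2 ^ j * e) (X j)"
    have cork': "X j \<in> \<Theta>" "dist x (X j) < 2 ^ j * e" "c * (2 ^ j * e) \<le> infdist (X j) E" "infdist (X j) E \<le> 2 ^ j * e" if "j \<le> J" for j
      using cork[OF that] infdist_le[OF x, of "X j"] by (auto simp: corkscrew_point_def E_def dist_commute)
    \<comment> \<open>The bound \<open>L * 2 ^ J\<close> on the total length is added for the
      induction: together with a new piece of at most \<open>L * 2 ^ J\<close> vertices it makes
      \<open>L * 2 ^ Suc J\<close>.\<close>
    have "\<exists>vs. discrete_path \<Theta> e vs \<and> hd vs = X 0 \<and> last vs = X J \<and> real (length vs) \<le> L * 2 ^ J \<and>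
       (\<forall>\<mu>\<ge>0. real (near_count E \<mu> vs) \<le> K * \<mu> / e) \<and>
       (\<forall>v\<in>set vs. dist x v \<le> K * infdist v E \<and> dist x v \<le> K * (2 ^ J * e))"
      using cork'
    proof (induction J)
      case 0
      have X0: "X 0 \<in> \<Theta>" "dist x (X 0) < e" "c * e \<le> infdist (X 0) E" using 0[of 0] by auto
      have "real (near_count E \<mu> [X 0]) \<le> K / e * \<mu>" if "\<mu> \<ge> 0" for \<mu>
        using X0 c e KL L K1 that by (intro near_count_le[of _ "c * e"]) (auto simp: field_simps)
      moreover have "dist x (X 0) \<le> K * infdist (X 0) E"
      proof -
        have "1 / c * (c * e) \<le> K * infdist (X 0) E"
          using X0 c e K1 KL L by (intro mult_mono) auto
        then show ?thesis using X0 c by simp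
      qed
      moreover have "1 * e \<le> K * e" using KL L e by (intro mult_right_mono) auto
      ultimately show ?case using X0 L by (intro exI[of _ "[X 0]"]) auto
    next
      case (Suc J)
      obtain vs where vs: "discrete_path \<Theta> e vs" "hd vs = X 0" "last vs = X J" "real (length vs) \<le> L * 2 ^ J"
       "\<And>\<mu>. \<mu> \<ge> 0 \<Longrightarrow> real (near_count E \<mu> vs) \<le> K * \<mu> / e"
       "\<And>v. v \<in> set vs \<Longrightarrow> dist x v \<le> K * infdist v E \<and> dist x v \<le> K * (2 ^ J * e)"
      proof -
        have "\<exists>vs. discrete_path \<Theta> e vs \<and> hd vs = X 0 \<and> last vs = X J \<and> real (length vs) \<le> L * 2 ^ J \<and>
          (\<forall>\<mu>\<ge>0. real (near_count E \<mu> vs) \<le> K * \<mu> / e) \<and>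
          (\<forall>v\<in>set vs. dist x v \<le> K * infdist v E \<and> dist x v \<le> K * (2 ^ J * e))"
          by (rule Suc.IH) (auto intro: Suc.prems)
        then show ?thesis using that by blast
      qed
      define r where "r = 2 ^ J * e"
      have r: "0 < r" "e \<le> r" using e by (auto simp: r_def)
      have X: "X J \<in> \<Theta>" "dist x (X J) < r" "c * r \<le> infdist (X J) E" "infdist (X J) E \<le> r"
        and X': "X (Suc J) \<in> \<Theta>" "dist x (X (Suc J)) < 2 * r" "c * (2 * r) \<le> infdist (X (Suc J)) E"
        using Suc.prems[of J] Suc.prems[of "Suc J"] by (auto simp: r_def mult.assoc)
      have "dist (X J) (X (Suc J)) \<le> dist x (X J) + dist x (X (Suc J))" by (rule dist_triangle3)
      moreover have "c * r \<le> c * (2 * r)" using c r by simp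
      then have "c * r \<le> infdist (X (Suc J)) E" using X'(3) by linarith
      \<comment> \<open>The step is \<open>c * e\<close> instead of \<open>e\<close>, because
        \<open>conn\<close> asks for a step not exceeding \<open>\<rho> = c * r\<close>; the
        quotient of the two is still \<open>2 ^ J\<close>.\<close>
      ultimately obtain ws where ws: "discrete_path \<Theta> (c * e) ws" "hd ws = X J" "last ws = X (Suc J)"
          "\<And>v. v \<in> set ws \<Longrightarrow> c * r / L \<le> infdist v E" "real (length ws) \<le> L * (c * r) / (c * e)"
        using conn[of "c * e" "c * r" "X J" "X (Suc J)"] X X' c e r by auto
      have len: "real (length ws) \<le> L * 2 ^ J" using ws(5) c e by (simp add: r_def)
      have ce: "c * e \<le> e" using c e by simp
      have ws': "discrete_path \<Theta> e ws" using discrete_path_mono[OF ws(1) order_refl ce] .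
      have path: "discrete_path \<Theta> e (vs @ ws)"
        using vs ws ws' e by (intro discrete_path_append) auto
      have wsd: "dist x v \<le> (1 + L) * r" if "v \<in> set ws" for v
      proof -
        have "dist (X J) v \<le> real (length ws) * e" using discrete_path_dist_hd[OF ws' that] ws(2) e by simp
        also have "\<dots> \<le> L * 2 ^ J * e" using len e by (intro mult_right_mono) auto
        also have "\<dots> = L * r" by (simp add: r_def)
        finally have "dist (X J) v \<le> L * r" .
        then show ?thesis using X(2) dist_triangle[of x v "X J"] by (simp add: algebra_simps)
      qed
      have wsd2: "dist x v \<le> K * infdist v E" if "v \<in> set ws" for v
      proof -
        have "(1 + L) * r = ((1 + L) * L / c) * (c * r / L)" using L c by simp
        also have "\<dots> \<le> K * infdist v E"
          using ws(4)[OF that] K2 L c r KL by (intro mult_mono) auto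
        finally show ?thesis using wsd[OF that] by simp
      qed
      have wsd3: "dist x v \<le> K * (2 ^ Suc J * e)" if "v \<in> set ws" for v
      proof -
        have "(1 + L) * r \<le> K * (2 * r)" using KL r L by (intro mult_mono) auto
        also have "K * (2 * r) = K * (2 ^ Suc J * e)" by (simp add: r_def)
        finally show ?thesis using wsd[OF that] by linarith
      qed
      have vsd3: "dist x v \<le> K * (2 ^ Suc J * e)" if "v \<in> set vs" for v
      proof -
        have "K * (2 ^ J * e) \<le> K * (2 ^ Suc J * e)" using KL L e by (intro mult_left_mono) auto
        then show ?thesis using vs(6)[OF that] by linarith
      qed
      have cnt: "real (near_count E \<mu> (vs @ ws)) \<le> K * \<mu> / e" if \<mu>: "\<mu> \<ge> 0" for \<mu>
      \<comment> \<open>Either the new piece is too far from \<open>E\<close> to be counted and the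
        bound for \<open>vs\<close> suffices, or \<mu> is so large that even the total length
        satisfies the bound.\<close>
      proof (cases "\<mu> < c * r / L")
        case True
        then have "near_count E \<mu> ws = 0" using ws(4) by (force simp: near_count_def filter_empty_conv)
        then show ?thesis using vs(5)[OF \<mu>] by simp
      next
        case False
        have "real (near_count E \<mu> (vs @ ws)) \<le> real (length (vs @ ws))"
          using near_count_le_length by (intro of_nat_mono)
        also have "\<dots> \<le> 2 * L * 2 ^ J" using vs(4) len by simp
        also have "\<dots> = (2 * L * L / c) * (c * r / L) / e" using L c e by (simp add: r_def)
        also have "\<dots> \<le> K * \<mu> / e"
          using False K2 \<mu> c L e r KL by (intro divide_right_mono mult_mono) auto
        finally show ?thesis .
      qed
      show ?case
        using path vs ws vsd3 wsd2 wsd3 cnt len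
        by (intro exI[of _ "vs @ ws"]) (auto simp: discrete_path_def)
    qed
    then show "\<exists>vs. discrete_path \<Theta> e vs \<and> hd vs = X 0 \<and> last vs = X J \<and>
       (\<forall>\<mu>\<ge>0. real (near_count (frontier \<Theta>) \<mu> vs) \<le> K * \<mu> / e) \<and>
       (\<forall>v\<in>set vs. dist x v \<le> K * infdist v (frontier \<Theta>) \<and> dist x v \<le> K * (2 ^ J * e))"
      unfolding E_def by blast
  qed
qed

text \<open>A cigar from \<open>x\<close> up to scale \<open>r\<close>, a Harnack chain between the
  two top corkscrew points, and a reversed cigar down to \<open>y\<close>. The middle piece has
  \<open>O(r / e)\<close> vertices, at distance at least a multiple of \<open>r\<close> from the
  boundary, so it obeys the same count.\<close>

lemma one_sided_discrete_path:
  fixes \<Theta> :: "'a::euclidean_space set"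
  assumes op: "open \<Theta>" and nta: "NTA \<Theta>" and ne: "frontier \<Theta> \<noteq> {}"
  obtains K where "1 \<le> K" "\<And>x y r e N. x \<in> frontier \<Theta> \<Longrightarrow> y \<in> frontier \<Theta> \<Longrightarrow> 0 < r \<Longrightarrow> dist x y = 2 * r \<Longrightarrow>
     e = r / 2 ^ N \<Longrightarrow>
     \<exists>vs. discrete_path \<Theta> e vs \<and> dist x (hd vs) \<le> e \<and> dist y (last vs) \<le> e \<and>
       (\<forall>\<mu>\<ge>0. real (near_count (frontier \<Theta>) \<mu> vs) \<le> K * \<mu> / e) \<and>
       (\<forall>v\<in>set vs. min (dist x v) (dist y v) \<le> K * infdist v (frontier \<Theta>) \<and> dist x v \<le> K * r)"
proof -
  define E where "E = frontier \<Theta>"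
  obtain c where c: "0 < c" "c < 1" and cork: 
    "\<And>x r. x \<in> frontier \<Theta> \<Longrightarrow> 0 < r \<Longrightarrow> ennreal r < ediameter (frontier \<Theta>) \<Longrightarrow> \<exists>X. corkscrew_point \<Theta> c x r X"
    using corkscrew_point_exists[OF op] nta unfolding NTA_def by metis
  have harnack: "harnack_chain_condition \<Theta>" using nta by (simp add: NTA_def)
  obtain K where K: "1 \<le> K" and cigar: "\<And>x e X J. x \<in> frontier \<Theta> \<Longrightarrow> 0 < e \<Longrightarrow>
     (\<And>j. j \<le> J \<Longrightarrow> corkscrew_point \<Theta> c x (2 ^ j * e) (X j)) \<Longrightarrow>
     \<exists>vs. discrete_path \<Theta> e vs \<and> hd vs = X 0 \<and> last vs = X J \<and>
       (\<forall>\<mu>\<ge>0. real (near_count (frontier \<Theta>) \<mu> vs) \<le> K * \<mu> / e) \<and>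
       (\<forall>v\<in>set vs. dist x v \<le> K * infdist v (frontier \<Theta>) \<and> dist x v \<le> K * (2 ^ J * e))"
    using corkscrew_cigar[OF harnack ne c] by blast
  \<comment> \<open>The top corkscrew points are less than \<open>r + 2 * r + r\<close>
    apart.\<close>
  have "1 \<le> 4 / c" using c by simp
  then obtain L where L: "1 \<le> L" and conn: "\<And>\<rho> e X Y. 0 < e \<Longrightarrow> e \<le> \<rho> \<Longrightarrow> X \<in> \<Theta> \<Longrightarrow> Y \<in> \<Theta> \<Longrightarrow>
    \<rho> \<le> infdist X E \<Longrightarrow> infdist X E \<le> 4 / c * \<rho> \<Longrightarrow> \<rho> \<le> infdist Y E \<Longrightarrow> dist X Y < 4 / c * \<rho> \<Longrightarrow>
    \<exists>vs. discrete_path \<Theta> e vs \<and> hd vs = X \<and> last vs = Y \<and>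
      (\<forall>v\<in>set vs. \<rho> / L \<le> infdist v E) \<and> real (length vs) \<le> L * \<rho> / e"
    using harnack_discrete_path[OF harnack ne, of "4 / c"] unfolding E_def by metis
  define K' where "K' = 2 * K + (1 + L) * L / c + 2"
  have LL: "0 \<le> (1 + L) * L / c" "L * L / c \<le> (1 + L) * L / c"
    using L c by (auto intro!: divide_right_mono)
  have "(1 + L) * 1 \<le> (1 + L) * (L / c)" using L c by (intro mult_left_mono) (auto simp: field_simps)
  then have LLc: "1 + L \<le> (1 + L) * L / c" by simp
  show ?thesis
  proof (rule that[of K'])
    show "1 \<le> K'" using K LL by (simp add: K'_def)
    fix x y :: 'a and r e :: real and N :: nat
    assume x: "x \<in> frontier \<Theta>" and y: "y \<in> frontier \<Theta>" and r: "0 < r" "dist x y = 2 * r" and e: "e = r / 2 ^ N"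
    have e0: "0 < e" and re: "r = 2 ^ N * e" using r e by auto
    have er: "e \<le> r" using r by (simp add: e field_simps)
    have ex: "\<exists>X. corkscrew_point \<Theta> c z (2 ^ j * e) X" if "j \<le> N" "z \<in> frontier \<Theta>" for j z
    proof (rule cork[OF that(2)])
      have "2 ^ j * e \<le> 2 ^ N * e" using that e0 by (intro mult_right_mono power_increasing) auto
      then have "2 ^ j * e < dist x y" using re r by simp
      then have "ennreal (2 ^ j * e) < ennreal (dist x y)" using e0 by (simp add: ennreal_less_iff)
      also have "\<dots> \<le> ediameter (frontier \<Theta>)"
        by (rule dist_le_ediameter[OF x y])
      finally show "ennreal (2 ^ j * e) < ediameter (frontier \<Theta>)" .
    qed (use e0 in auto)
    obtain X where X: "\<And>j. j \<le> N \<Longrightarrow> corkscrew_point \<Theta> c x (2 ^ j * e) (X j)" using ex[OF _ x] by metis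
    obtain Y where Y: "\<And>j. j \<le> N \<Longrightarrow> corkscrew_point \<Theta> c y (2 ^ j * e) (Y j)" using ex[OF _ y] by metis
    obtain us where us: "discrete_path \<Theta> e us" "hd us = X 0" "last us = X N"
       "\<And>\<mu>. \<mu> \<ge> 0 \<Longrightarrow> real (near_count E \<mu> us) \<le> K * \<mu> / e"
       "\<And>v. v \<in> set us \<Longrightarrow> dist x v \<le> K * infdist v E \<and> dist x v \<le> K * r"
      using cigar[OF x e0 X] unfolding E_def re by blast
    obtain ws where ws: "discrete_path \<Theta> e ws" "hd ws = Y 0" "last ws = Y N"
       "\<And>\<mu>. \<mu> \<ge> 0 \<Longrightarrow> real (near_count E \<mu> ws) \<le> K * \<mu> / e"
       "\<And>v. v \<in> set ws \<Longrightarrow> dist y v \<le> K * infdist v E \<and> dist y v \<le> K * r"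
      using cigar[OF y e0 Y] unfolding E_def re by blast
    have XN: "X N \<in> \<Theta>" "dist x (X N) < r" "c * r \<le> infdist (X N) E"
      and YN: "Y N \<in> \<Theta>" "dist y (Y N) < r" "c * r \<le> infdist (Y N) E"
      and XY0: "dist x (X 0) < e" "dist y (Y 0) < e"
      using X[of N] Y[of N] X[of 0] Y[of 0] by (auto simp: corkscrew_point_def E_def re)
    have XNr: "infdist (X N) E \<le> r" using infdist_le[OF x, of "X N"] XN(2) by (simp add: E_def dist_commute)
    have "dist (X N) (Y N) \<le> dist x (X N) + (dist x y + dist y (Y N))"
      using dist_triangle3[of "X N" "Y N" x] dist_triangle[of x "Y N" y] by linarith
    then have "dist (X N) (Y N) < 4 * r" using XN YN r by linarith
    then obtain zs where zs: "discrete_path \<Theta> (c * e) zs" "hd zs = X N" "last zs = Y N"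
          "\<And>v. v \<in> set zs \<Longrightarrow> c * r / L \<le> infdist v E" "real (length zs) \<le> L * (c * r) / (c * e)"
      using conn[of "c * e" "c * r" "X N" "Y N"] XN XNr YN c e0 er r by auto
    have len: "real (length zs) \<le> L * 2 ^ N" using zs(5) c e0 by (simp add: re)
    have ce: "c * e \<le> e" using c e0 by simp
    have zs': "discrete_path \<Theta> e zs" using discrete_path_mono[OF zs(1) order_refl ce] .
    define vs where "vs = us @ zs @ rev ws"
    have ne': "us \<noteq> []" "zs \<noteq> []" "ws \<noteq> []" using us zs ws by (auto simp: discrete_path_def)
    have path: "discrete_path \<Theta> e vs"
      unfolding vs_def using us zs ws zs' ne' e0
      by (intro discrete_path_append discrete_path_rev) (auto simp: hd_rev)
    have ends: "hd vs = X 0" "last vs = Y 0" using us ws ne' by (auto simp: vs_def last_rev)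
    have zcnt: "real (near_count E \<mu> zs) \<le> (L * L / (c * e)) * \<mu>" if "\<mu> \<ge> 0" for \<mu>
      using zs(4) len that L c e0 by (intro near_count_le[of _ "c * r / L"]) (auto simp: re field_simps)
    have cnt: "real (near_count E \<mu> vs) \<le> K' * \<mu> / e" if "\<mu> \<ge> 0" for \<mu>
    proof -
      have "real (near_count E \<mu> vs) \<le> K * \<mu> / e + (L * L / c) * \<mu> / e + K * \<mu> / e"
        using us(4)[OF that] ws(4)[OF that] zcnt[OF that] by (simp add: vs_def)
      also have "\<dots> = (2 * K + L * L / c) * (\<mu> / e)" by (simp add: algebra_simps add_divide_distrib)
      also have "\<dots> \<le> K' * (\<mu> / e)" using LL that e0 by (intro mult_right_mono) (auto simp: K'_def)
      finally show ?thesis by simp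
    qed
    have K'K: "K \<le> K'" "(1 + L) * L / c \<le> K'" "1 + L \<le> K'" "2 + K \<le> K'" using K LL LLc by (auto simp: K'_def)
    have zd: "dist x v \<le> (1 + L) * r" if "v \<in> set zs" for v
    proof -
      have "dist (X N) v \<le> real (length zs) * e" using discrete_path_dist_hd[OF zs' that] zs(2) e0 by simp
      also have "\<dots> \<le> L * 2 ^ N * e" using len e0 by (intro mult_right_mono) auto
      also have "\<dots> = L * r" by (simp add: re)
      finally have "dist (X N) v \<le> L * r" .
      then show ?thesis using XN(2) dist_triangle[of x v "X N"] by (simp add: algebra_simps)
    qed
    have "min (dist x v) (dist y v) \<le> K' * infdist v E \<and> dist x v \<le> K' * r" if v: "v \<in> set vs" for v
    proof -
      have mono: "K * infdist v E \<le> K' * infdist v E" "K * r \<le> K' * r" "(1 + L) * r \<le> K' * r" "(2 + K) * r \<le> K' * r"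
        using K'K r by (auto intro!: mult_right_mono simp: infdist_nonneg)
      consider "v \<in> set us" | "v \<in> set zs" | "v \<in> set ws" using v by (auto simp: vs_def)
      then show ?thesis
      proof cases
        case 1 then show ?thesis using us(5)[of v] mono by auto
      next
        case 2
        have "(1 + L) * r = ((1 + L) * L / c) * (c * r / L)" using L c by simp
        also have "\<dots> \<le> K' * infdist v E"
          using zs(4)[OF 2] K'K L c r K by (intro mult_mono) auto
        finally show ?thesis using zd[OF 2] mono by auto
      next
        case 3
        then have "dist x v \<le> 2 * r + K * r" using ws(5)[of v] dist_triangle[of x v y] r by auto
        then show ?thesis using ws(5)[OF 3] mono by (auto simp: algebra_simps)
      qed
    qed
    then show "\<exists>vs. discrete_path \<Theta> e vs \<and> dist x (hd vs) \<le> e \<and> dist y (last vs) \<le> e \<and>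
       (\<forall>\<mu>\<ge>0. real (near_count (frontier \<Theta>) \<mu> vs) \<le> K' * \<mu> / e) \<and>
       (\<forall>v\<in>set vs. min (dist x v) (dist y v) \<le> K' * infdist v (frontier \<Theta>) \<and> dist x v \<le> K' * r)"
      using path ends XY0 cnt unfolding E_def by (intro exI[of _ vs]) auto
  qed
qed

section \<open>The loop through both complementary domains\<close>

lemma frontier_interior_Compl:
  fixes \<Omega> :: "'a::metric_space set"
  assumes cork: "corkscrew_condition \<Omega>" and xy: "x \<in> frontier \<Omega>" "y \<in> frontier \<Omega>" "x \<noteq> y"
  shows "frontier (interior (- \<Omega>)) = frontier \<Omega>"
proof
  have "frontier (interior (- \<Omega>)) \<subseteq> frontier (- \<Omega>)"
    by (auto simp: frontier_def dest: subsetD[OF closure_mono[OF interior_subset]])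
  then show "frontier (interior (- \<Omega>)) \<subseteq> frontier \<Omega>" by (simp add: frontier_complement)
  obtain c where c: "0 < c" and cork: "\<And>x r. x \<in> frontier \<Omega> \<Longrightarrow> r > 0 \<Longrightarrow> ennreal r < ediameter (frontier \<Omega>) \<Longrightarrow>
           (\<exists>X'. ball X' (c * r) \<subseteq> ball x r - \<Omega>)"
    using cork unfolding corkscrew_condition_def by metis
  have diam: "ennreal (dist x y) \<le> ediameter (frontier \<Omega>)"
    by (rule dist_le_ediameter[OF xy(1,2)])
  \<comment> \<open>Exterior corkscrew balls of small radius put interior points of the complement
    arbitrarily near \<open>z\<close>; this excludes slits, which would belong to the frontier of
    \<Omega> only. Two distinct frontier points make the diameter positive, so that small radii are
    admissible.\<close>
  show "frontier \<Omega> \<subseteq> frontier (interior (- \<Omega>))"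
  proof
    fix z assume z: "z \<in> frontier \<Omega>"
    have "\<exists>w\<in>interior (- \<Omega>). dist w z < d" if "d > 0" for d
    proof -
      define r where "r = min d (dist x y / 2)"
      have r: "0 < r" "r \<le> d" "r < dist x y" using that zero_less_dist_iff[of x y] xy by (auto simp: r_def min_less_iff_disj)
      have "ennreal r < ediameter (frontier \<Omega>)"
        by (rule less_le_trans[OF _ diam]) (use r in \<open>simp add: ennreal_less_iff\<close>)
      then obtain X' where X': "ball X' (c * r) \<subseteq> ball z r - \<Omega>" using cork[OF z r(1)] by auto
      have X'b: "X' \<in> ball X' (c * r)" using c r by auto
      moreover have "ball X' (c * r) \<subseteq> interior (- \<Omega>)" using X' by (intro interior_maximal) auto
      moreover have "dist z X' < r" using X' X'b by (meson Diff_iff mem_ball subsetD)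
      ultimately show ?thesis using r by (intro bexI[of _ X']) (auto simp: dist_commute)
    qed
    then have "z \<in> closure (interior (- \<Omega>))" by (simp add: closure_approachable)
    moreover have "z \<notin> interior (interior (- \<Omega>))" using z by (auto simp: frontier_def interior_complement)
    ultimately show "z \<in> frontier (interior (- \<Omega>))" by (simp add: frontier_def)
  qed
qed

text \<open>The discrete paths in the two domains, one of them reversed, are closed up at
  \<open>x\<close> and \<open>y\<close>. Their ends lie within \<open>e\<close> of these points,
  hence the edge length \<open>2 * e\<close>; the edges leaving the indices \<open>a\<close> and
  \<open>M - 1\<close> are the only ones that change sides.\<close>

lemma two_sided_loop:
  fixes \<Omega> :: "'a::euclidean_space set"
  assumes dom: "two_sided_chord_arc_domain n \<Omega>"
  obtains K where "1 \<le> K" "\<And>x y r e N. x \<in> frontier \<Omega> \<Longrightarrow> y \<in> frontier \<Omega> \<Longrightarrow> 0 < r \<Longrightarrow> dist x y = 2 * r \<Longrightarrow>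
     e = r / 2 ^ N \<Longrightarrow>
     \<exists>v M a. Suc a < M \<and> v M = v 0 \<and> (\<forall>i<M. dist (v i) (v (Suc i)) \<le> 2 * e) \<and>
       (\<forall>i\<le>a. v i \<in> \<Omega>) \<and> (\<forall>i. a < i \<longrightarrow> i < M \<longrightarrow> v i \<notin> \<Omega>) \<and> dist x (v 0) \<le> e \<and> dist y (v a) \<le> e \<and>
       (\<forall>\<mu>\<ge>0. real (card {i. i < M \<and> infdist (v i) (frontier \<Omega>) \<le> \<mu>}) \<le> K * \<mu> / e) \<and>
       (\<forall>i<M. min (dist x (v i)) (dist y (v i)) \<le> K * infdist (v i) (frontier \<Omega>) \<and> dist x (v i) \<le> K * r)"
proof (cases "\<exists>x\<in>frontier \<Omega>. \<exists>y\<in>frontier \<Omega>. x \<noteq> y")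
  \<comment> \<open>Without two distinct boundary points the claim is vacuous. The case is set apart
    because the equality of the two frontiers rests on such points.\<close>
  case False
  then have "\<not> (0 < r \<and> dist x y = 2 * r)" if "x \<in> frontier \<Omega>" "y \<in> frontier \<Omega>" for x y r
    using that by force
  then show ?thesis using that[of 1] by fastforce
next
  case True
  define \<Omega>' where "\<Omega>' = interior (- \<Omega>)"
  have dom': "open \<Omega>" "NTA \<Omega>" "open \<Omega>'" "NTA \<Omega>'" "corkscrew_condition \<Omega>"
    using dom by (auto simp: two_sided_chord_arc_domain_def chord_arc_domain_def NTA_def \<Omega>'_def)
  have fr: "frontier \<Omega>' = frontier \<Omega>" using True frontier_interior_Compl[OF dom'(5)] unfolding \<Omega>'_def by blast
  have ne: "frontier \<Omega> \<noteq> {}" "frontier \<Omega>' \<noteq> {}" using True fr by auto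
  obtain K1 where K1: "1 \<le> K1" and path1: "\<And>x y r e N. x \<in> frontier \<Omega> \<Longrightarrow> y \<in> frontier \<Omega> \<Longrightarrow> 0 < r \<Longrightarrow> dist x y = 2 * r \<Longrightarrow>
     e = r / 2 ^ N \<Longrightarrow>
     \<exists>vs. discrete_path \<Omega> e vs \<and> dist x (hd vs) \<le> e \<and> dist y (last vs) \<le> e \<and>
       (\<forall>\<mu>\<ge>0. real (near_count (frontier \<Omega>) \<mu> vs) \<le> K1 * \<mu> / e) \<and>
       (\<forall>v\<in>set vs. min (dist x v) (dist y v) \<le> K1 * infdist v (frontier \<Omega>) \<and> dist x v \<le> K1 * r)"
    using one_sided_discrete_path[OF dom'(1,2) ne(1)] by blast
  obtain K2 where K2: "1 \<le> K2" and path2: "\<And>x y r e N. x \<in> frontier \<Omega> \<Longrightarrow> y \<in> frontier \<Omega> \<Longrightarrow> 0 < r \<Longrightarrow> dist x y = 2 * r \<Longrightarrow>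
     e = r / 2 ^ N \<Longrightarrow>
     \<exists>vs. discrete_path \<Omega>' e vs \<and> dist x (hd vs) \<le> e \<and> dist y (last vs) \<le> e \<and>
       (\<forall>\<mu>\<ge>0. real (near_count (frontier \<Omega>) \<mu> vs) \<le> K2 * \<mu> / e) \<and>
       (\<forall>v\<in>set vs. min (dist x v) (dist y v) \<le> K2 * infdist v (frontier \<Omega>) \<and> dist x v \<le> K2 * r)"
    using one_sided_discrete_path[OF dom'(3,4) ne(2)] unfolding fr by blast
  show ?thesis
  proof (rule that[of "K1 + K2"])
    show "1 \<le> K1 + K2" using K1 K2 by simp
    fix x y :: 'a and r e :: real and N :: nat
    assume *: "x \<in> frontier \<Omega>" "y \<in> frontier \<Omega>" "0 < r" "dist x y = 2 * r" "e = r / 2 ^ N"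
    have e0: "0 < e" using * by simp
    obtain us where us: "discrete_path \<Omega> e us" "dist x (hd us) \<le> e" "dist y (last us) \<le> e"
       "\<And>\<mu>. \<mu> \<ge> 0 \<Longrightarrow> real (near_count (frontier \<Omega>) \<mu> us) \<le> K1 * \<mu> / e"
       "\<And>v. v \<in> set us \<Longrightarrow> min (dist x v) (dist y v) \<le> K1 * infdist v (frontier \<Omega>) \<and> dist x v \<le> K1 * r"
      using path1[OF *] by blast
    obtain ws where ws: "discrete_path \<Omega>' e ws" "dist x (hd ws) \<le> e" "dist y (last ws) \<le> e"
       "\<And>\<mu>. \<mu> \<ge> 0 \<Longrightarrow> real (near_count (frontier \<Omega>) \<mu> ws) \<le> K2 * \<mu> / e"
       "\<And>v. v \<in> set ws \<Longrightarrow> min (dist x v) (dist y v) \<le> K2 * infdist v (frontier \<Omega>) \<and> dist x v \<le> K2 * r"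
      using path2[OF *] by blast
    define vs where "vs = us @ rev ws"
    define M where "M = length vs"
    \<comment> \<open>From index \<open>M\<close> on, the value is the first vertex, which closes
      the loop.\<close>
    define v where "v i = (if i < M then vs ! i else vs ! 0)" for i
    define a where "a = length us - 1"
    have ne': "us \<noteq> []" "ws \<noteq> []" using us ws by (auto simp: discrete_path_def)
    have M: "M = length us + length ws" by (simp add: M_def vs_def)
    have aM: "Suc a < M" "Suc a = length us" using ne' by (auto simp: a_def M Suc_diff_le simp flip: length_greater_0_conv)
    have p: "discrete_path UNIV (2 * e) us" "discrete_path UNIV (2 * e) (rev ws)"
      using discrete_path_mono[OF us(1), of UNIV "2 * e"] discrete_path_mono[OF ws(1), of UNIV "2 * e"] e0
      by (auto intro: discrete_path_rev)
    have "dist (last us) (hd (rev ws)) \<le> 2 * e"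
      using us(3) ws(3) ne' dist_triangle3[of "last us" "last ws" y] by (simp add: hd_rev)
    then have P: "discrete_path UNIV (2 * e) vs" unfolding vs_def using p by (intro discrete_path_append) auto
    have hd: "vs ! 0 = hd us" and lst: "vs ! (M - 1) = hd ws"
      using ne' by (auto simp: vs_def hd_conv_nth nth_append M rev_nth Suc_le_eq simp flip: length_greater_0_conv)
    have "dist (v i) (v (Suc i)) \<le> 2 * e" if "i < M" for i
    proof (cases "Suc i < M")
      case True
      then show ?thesis using P by (auto simp: discrete_path_def successively_conv_nth v_def M_def)
    next
      case False
      then have "i = M - 1" using that by simp
      then show ?thesis using that False lst hd us(2) ws(2) dist_triangle3[of "hd ws" "hd us" x] by (simp add: v_def)
    qed
    moreover have "v i \<in> \<Omega>" if "i \<le> a" for i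
    proof -
      have "i < length us" using that aM by simp
      then show ?thesis using us(1) by (auto simp: v_def M vs_def nth_append discrete_path_def)
    qed
    moreover have "v i \<notin> \<Omega>" if "a < i" "i < M" for i
    proof -
      have "v i = rev ws ! (i - length us)" "i - length us < length (rev ws)"
        using that aM M by (auto simp: v_def vs_def nth_append)
      then have "v i \<in> set ws" by (metis nth_mem set_rev)
      then show ?thesis using ws(1) interior_subset[of "- \<Omega>"] by (auto simp: discrete_path_def \<Omega>'_def)
    qed
    moreover have "v 0 = hd us" using hd by (simp add: v_def)
    moreover have "v a = last us"
      using aM ne' by (auto simp: v_def vs_def nth_append last_conv_nth a_def)
    moreover have "real (card {i. i < M \<and> infdist (v i) (frontier \<Omega>) \<le> \<mu>}) \<le> (K1 + K2) * \<mu> / e" if "\<mu> \<ge> 0" for \<mu>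
    proof -
      have "{i. i < M \<and> infdist (v i) (frontier \<Omega>) \<le> \<mu>} = {i. i < length vs \<and> infdist (vs ! i) (frontier \<Omega>) \<le> \<mu>}"
        by (auto simp: v_def M_def)
      then have "card {i. i < M \<and> infdist (v i) (frontier \<Omega>) \<le> \<mu>} = near_count (frontier \<Omega>) \<mu> vs"
        by (simp add: near_count_def length_filter_conv_card)
      then show ?thesis using us(4)[OF that] ws(4)[OF that] by (simp add: vs_def algebra_simps add_divide_distrib)
    qed
    moreover have "min (dist x (v i)) (dist y (v i)) \<le> (K1 + K2) * infdist (v i) (frontier \<Omega>) \<and> dist x (v i) \<le> (K1 + K2) * r"
      if "i < M" for i
    proof -
      have "v i \<in> set vs" using that by (simp add: v_def M_def)
      then have "v i \<in> set us \<or> v i \<in> set ws" by (auto simp: vs_def)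
      moreover have "K1 * infdist (v i) (frontier \<Omega>) \<le> (K1 + K2) * infdist (v i) (frontier \<Omega>)" "K1 * r \<le> (K1 + K2) * r"
        "K2 * infdist (v i) (frontier \<Omega>) \<le> (K1 + K2) * infdist (v i) (frontier \<Omega>)" "K2 * r \<le> (K1 + K2) * r"
        using K1 K2 *(3) by (auto intro!: mult_right_mono simp: infdist_nonneg)
      ultimately show ?thesis using us(5)[of "v i"] ws(5)[of "v i"] by auto
    qed
    ultimately show "\<exists>v M a. Suc a < M \<and> v M = v 0 \<and> (\<forall>i<M. dist (v i) (v (Suc i)) \<le> 2 * e) \<and>
       (\<forall>i\<le>a. v i \<in> \<Omega>) \<and> (\<forall>i. a < i \<longrightarrow> i < M \<longrightarrow> v i \<notin> \<Omega>) \<and> dist x (v 0) \<le> e \<and> dist y (v a) \<le> e \<and>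
       (\<forall>\<mu>\<ge>0. real (card {i. i < M \<and> infdist (v i) (frontier \<Omega>) \<le> \<mu>}) \<le> (K1 + K2) * \<mu> / e) \<and>
       (\<forall>i<M. min (dist x (v i)) (dist y (v i)) \<le> (K1 + K2) * infdist (v i) (frontier \<Omega>) \<and> dist x (v i) \<le> (K1 + K2) * r)"
      using aM us ws by (intro exI[of _ v] exI[of _ M] exI[of _ a]) (auto simp: v_def)
  qed
qed

subsection \<open>Crossings in a triangulated cylinder\<close>

text \<open>Summed over all triangles of the cylinder, diagonals and interior edges count twice; the
  seam cancels because column \<open>M\<close> equals column 0, and modulo 2 only the two boundary
  circles remain. The induction adds one row of cells at a time.\<close>

lemma grid_parity:
  fixes P :: "nat \<Rightarrow> nat \<Rightarrow> 'a" and w :: "'a \<Rightarrow> 'a \<Rightarrow> nat"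
  assumes per: "\<And>k. P M k = P 0 k"
    and lower: "\<And>i k. i < M \<Longrightarrow> k < m \<Longrightarrow>
      even (w (P i k) (P (Suc i) k) + w (P (Suc i) k) (P (Suc i) (Suc k)) + w (P i k) (P (Suc i) (Suc k)))"
    and upper: "\<And>i k. i < M \<Longrightarrow> k < m \<Longrightarrow>
      even (w (P i k) (P i (Suc k)) + w (P i (Suc k)) (P (Suc i) (Suc k)) + w (P i k) (P (Suc i) (Suc k)))"
  shows "even ((\<Sum>i<M. w (P i 0) (P (Suc i) 0)) + (\<Sum>i<M. w (P i m) (P (Suc i) m)))"
  using lower upper
proof (induction m)
  case (Suc m)
  define h where "h k i = w (P i k) (P (Suc i) k)" for i k
  define v where "v i = w (P i m) (P i (Suc m))" for i
  have "even (h m i + v (Suc i) + (v i + h (Suc m) i))" if "i < M" for i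
    using Suc.prems(1)[of i m] Suc.prems(2)[of i m] that unfolding h_def v_def by auto
  then have "even (\<Sum>i<M. h m i + v (Suc i) + (v i + h (Suc m) i))"
    by (intro dvd_sum) auto
  moreover have "(\<Sum>i<M. v (Suc i)) = (\<Sum>i<M. v i)"
  proof -
    have "(\<Sum>i<M. v (Suc i)) + v 0 = (\<Sum>i<M. v i) + v M"
      using sum.lessThan_Suc_shift[of v M] sum.lessThan_Suc[of v M] by simp
    then show ?thesis using per by (simp add: v_def)
  qed
  ultimately have "even ((\<Sum>i<M. h m i) + (\<Sum>i<M. h (Suc m) i))"
    by (simp add: sum.distrib) blast
  moreover have "even ((\<Sum>i<M. h 0 i) + (\<Sum>i<M. h m i))"
    using Suc.IH Suc.prems unfolding h_def by auto
  ultimately show ?case unfolding h_def by auto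
qed auto

text \<open>
  Sperner's argument: each triangle has an even number of edges with one end in \<open>G\<close> and one outside,
  so the edges reachable from one boundary crossing through such triangles contain an even number
  of boundary crossings, and hence the other one as well.  Edges are oriented from \<open>G\<close> outwards.
\<close>

definition grid_triangles :: "(nat \<Rightarrow> nat \<Rightarrow> 'a) \<Rightarrow> nat \<Rightarrow> nat \<Rightarrow> 'a set set" where
  "grid_triangles P M m =
     (\<Union>i\<in>{..<M}. \<Union>k\<in>{..<m}. {{P i k, P (Suc i) k, P (Suc i) (Suc k)}, {P i k, P i (Suc k), P (Suc i) (Suc k)}})"

definition crossing_step :: "'a set \<Rightarrow> 'a set set \<Rightarrow> (('a \<times> 'a) \<times> ('a \<times> 'a)) set" where
  "crossing_step G T = {((a, b), (a', b')). a \<in> G \<and> b \<notin> G \<and> a' \<in> G \<and> b' \<notin> G \<and> (\<exists>t\<in>T. {a, b, a', b'} \<subseteq> t)}"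

lemma grid_crossing_connected:
  fixes P :: "nat \<Rightarrow> nat \<Rightarrow> 'a"
  assumes per: "\<And>k. P M k = P 0 k" and top: "\<And>i. i \<le> M \<Longrightarrow> P i m = p"
    and a: "a < M" "i0 < M" "a \<noteq> i0"
    and mono: "\<And>i. i < M \<Longrightarrow> i \<noteq> a \<Longrightarrow> i \<noteq> i0 \<Longrightarrow> (P i 0 \<in> G \<longleftrightarrow> P (Suc i) 0 \<in> G)"
    and ea: "P a 0 \<in> G" "P (Suc a) 0 \<notin> G" and e0: "P i0 0 \<notin> G" "P (Suc i0) 0 \<in> G"
  shows "((P (Suc i0) 0, P i0 0), (P a 0, P (Suc a) 0)) \<in> (crossing_step G (grid_triangles P M m))\<^sup>*"
proof -
  define R where "R = crossing_step G (grid_triangles P M m)"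
  define S where "S = R\<^sup>* `` {(P (Suc i0) 0, P i0 0)}"
  \<comment> \<open>The indicator of the reachable crossing edges, made symmetric so that the parity
    count is free of orientations.\<close>
  define w where "w A B = (if A \<in> G \<and> B \<notin> G \<and> (A, B) \<in> S \<or> B \<in> G \<and> A \<notin> G \<and> (B, A) \<in> S then 1 else 0::nat)" for A B
  have step: "(y \<in> S) = (x \<in> S)" if "(x, y) \<in> R" for x y
  proof -
    have "(y, x) \<in> R" using that by (force simp: R_def crossing_step_def)
    with that show ?thesis unfolding S_def by (auto intro: rtrancl_into_rtrancl)
  qed
  have comm: "w A B = w B A" for A B by (auto simp: w_def)
  have same: "w A B = 0" if "A \<in> G \<longleftrightarrow> B \<in> G" for A B using that by (auto simp: w_def)
  \<comment> \<open>If \<open>X\<close> is alone on its side of the triangle, both edges at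
    \<open>X\<close> cross and are related by \<open>R\<close>, so they are reachable together or
    not at all.\<close>
  have odd_one_out: "w X Y = w X Z"
    if t: "t \<in> grid_triangles P M m" "{X, Y, Z} \<subseteq> t" and c: "(X \<in> G) \<noteq> (Y \<in> G)" "(X \<in> G) \<noteq> (Z \<in> G)" for X Y Z t
  proof (cases "X \<in> G")
    case True
    then have "((X, Y), (X, Z)) \<in> R" using t c by (auto simp: R_def crossing_step_def)
    from step[OF this] show ?thesis using True c by (simp add: w_def)
  next
    case False
    then have "((Y, X), (Z, X)) \<in> R" using t c by (auto simp: R_def crossing_step_def)
    from step[OF this] show ?thesis using False c by (simp add: w_def)
  qed
  have tri: "even (w A B + w B C + w A C)" if t: "{A, B, C} \<in> grid_triangles P M m" for A B C
  proof -
    consider "(A \<in> G) = (B \<in> G)" "(B \<in> G) = (C \<in> G)" | "(A \<in> G) \<noteq> (B \<in> G)" "(A \<in> G) \<noteq> (C \<in> G)"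
      | "(B \<in> G) \<noteq> (A \<in> G)" "(B \<in> G) \<noteq> (C \<in> G)" | "(C \<in> G) \<noteq> (A \<in> G)" "(C \<in> G) \<noteq> (B \<in> G)"
      by blast
    then show ?thesis
    proof cases
      case 1 then show ?thesis using same[of A B] same[of B C] same[of A C] by simp
    next
      case 2 then show ?thesis using odd_one_out[OF t, of A B C] same[of B C] by simp
    next
      case 3 then show ?thesis using odd_one_out[OF t, of B A C] same[of A C] comm[of A B] by simp
    next
      case 4 then show ?thesis using odd_one_out[OF t, of C A B] same[of A B] comm[of A C] comm[of B C] by simp
    qed
  qed
  have "even ((\<Sum>i<M. w (P i 0) (P (Suc i) 0)) + (\<Sum>i<M. w (P i m) (P (Suc i) m)))"
  proof (rule grid_parity[where P = P, OF per])
    fix i k assume "i < M" "k < m"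
    then have "{P i k, P (Suc i) k, P (Suc i) (Suc k)} \<in> grid_triangles P M m"
        "{P i k, P i (Suc k), P (Suc i) (Suc k)} \<in> grid_triangles P M m"
      by (auto simp: grid_triangles_def)
    from this[THEN tri]
    show "even (w (P i k) (P (Suc i) k) + w (P (Suc i) k) (P (Suc i) (Suc k)) + w (P i k) (P (Suc i) (Suc k)))"
      "even (w (P i k) (P i (Suc k)) + w (P i (Suc k)) (P (Suc i) (Suc k)) + w (P i k) (P (Suc i) (Suc k)))"
      by auto
  qed
  \<comment> \<open>The top row is collapsed to the apex, so its edges are degenerate and cannot
    cross.\<close>
  moreover have "(\<Sum>i<M. w (P i m) (P (Suc i) m)) = 0"
    using top by (intro sum.neutral) (auto simp: w_def)
  moreover have "(\<Sum>i<M. w (P i 0) (P (Suc i) 0)) = (\<Sum>i\<in>{a, i0}. w (P i 0) (P (Suc i) 0))"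
    using a mono by (intro sum.mono_neutral_right) (auto simp: w_def)
  ultimately have "even (w (P a 0) (P (Suc a) 0) + w (P i0 0) (P (Suc i0) 0))"
    using a by simp
  moreover have "w (P i0 0) (P (Suc i0) 0) = 1"
    using e0 by (auto simp: w_def S_def)
  ultimately have "w (P a 0) (P (Suc a) 0) \<noteq> 0" by (metis add_0 odd_one)
  then have "(P a 0, P (Suc a) 0) \<in> S" using ea by (auto simp: w_def split: if_splits)
  then show ?thesis by (simp add: S_def R_def)
qed

text \<open>Reachability in a finite relation needs at most as many steps as the relation has pairs;
  this is how its cardinality will bound the length of the chain. Each of the two triangles of a
  cell in \<open>B\<close> admits at most \<open>3 ^ 4 = 81\<close> quadruples of vertices, whence
  162.\<close>

lemma card_crossing_step_le:
  assumes B: "finite B"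
    and bad: "\<And>i k. i < M \<Longrightarrow> k < m \<Longrightarrow> (i, k) \<notin> B \<Longrightarrow>
       {P i k, P (Suc i) k, P (Suc i) (Suc k)} \<subseteq> G \<or> {P i k, P (Suc i) k, P (Suc i) (Suc k)} \<inter> G = {}"
    and bad': "\<And>i k. i < M \<Longrightarrow> k < m \<Longrightarrow> (i, k) \<notin> B \<Longrightarrow>
       {P i k, P i (Suc k), P (Suc i) (Suc k)} \<subseteq> G \<or> {P i k, P i (Suc k), P (Suc i) (Suc k)} \<inter> G = {}"
  shows "finite (crossing_step G (grid_triangles P M m))"
    and "card (crossing_step G (grid_triangles P M m)) \<le> 162 * card B"
proof -
  define L where "L = (\<lambda>(i, k). {P i k, P (Suc i) k, P (Suc i) (Suc k)})"
  define U where "U = (\<lambda>(i, k). {P i k, P i (Suc k), P (Suc i) (Suc k)})"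
  define Q where "Q t = (t \<times> t) \<times> (t \<times> t)" for t :: "'a set"
  have sub: "crossing_step G (grid_triangles P M m) \<subseteq> (\<Union>b\<in>B. Q (L b) \<union> Q (U b))"
  proof
    fix z assume "z \<in> crossing_step G (grid_triangles P M m)"
    then obtain a b a' b' t where z: "z = ((a, b), (a', b'))" "a \<in> G" "b \<notin> G" "t \<in> grid_triangles P M m"
      "{a, b, a', b'} \<subseteq> t" by (auto simp: crossing_step_def)
    then obtain i k where ik: "i < M" "k < m" "t = L (i, k) \<or> t = U (i, k)"
      by (auto simp: grid_triangles_def L_def U_def)
    have "(i, k) \<in> B"
      using bad[OF ik(1,2)] bad'[OF ik(1,2)] z ik(3) unfolding L_def U_def by blast
    then show "z \<in> (\<Union>b\<in>B. Q (L b) \<union> Q (U b))"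
      using z ik(3) unfolding Q_def by blast
  qed
  have card3: "finite (Q t) \<and> card (Q t) \<le> 81" if "finite t" "card t \<le> 3" for t
  proof -
    have "card t * card t \<le> 3 * 3" using that by (intro mult_mono) auto
    then have "(card t * card t) * (card t * card t) \<le> 9 * 9" by (intro mult_mono) auto
    then show ?thesis using that by (simp add: Q_def card_cartesian_product)
  qed
  have c: "card {x, y, z} \<le> 3" for x y z :: 'a
    by (intro order_trans[OF card_insert_le_m1]) (auto simp: card_insert_if)
  have LU: "finite (Q (L b))" "card (Q (L b)) \<le> 81" "finite (Q (U b))" "card (Q (U b)) \<le> 81" for b
    using card3[of "L b"] card3[of "U b"] c by (auto simp: L_def U_def split: prod.splits)
  have fin: "finite (\<Union>b\<in>B. Q (L b) \<union> Q (U b))" using B LU by auto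
  then show "finite (crossing_step G (grid_triangles P M m))" using sub finite_subset by blast
  have "card (\<Union>b\<in>B. Q (L b) \<union> Q (U b)) \<le> (\<Sum>b\<in>B. card (Q (L b) \<union> Q (U b)))"
    using B by (rule card_UN_le)
  also have "\<dots> \<le> (\<Sum>b\<in>B. 162)"
  proof (rule sum_mono)
    fix b show "card (Q (L b) \<union> Q (U b)) \<le> 162"
      using card_Un_le[of "Q (L b)" "Q (U b)"] LU(2)[of b] LU(4)[of b] by linarith
  qed
  finally show "card (crossing_step G (grid_triangles P M m)) \<le> 162 * card B"
    using card_mono[OF fin sub] by simp
qed

subsection \<open>Limits of chains\<close>

lemma path_length_le_Lipschitz:
  fixes g :: "real \<Rightarrow> 'a::metric_space"
  assumes L: "0 \<le> L" and lip: "\<And>s t. s \<in> {0..1} \<Longrightarrow> t \<in> {0..1} \<Longrightarrow> dist (g s) (g t) \<le> L * \<bar>s - t\<bar>"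
  shows "path_length g \<le> ennreal L"
proof -
  have "(\<Sum>i<m. ennreal (dist (g (t i)) (g (t (Suc i))))) \<le> ennreal L"
    if t: "mono t" "range t \<subseteq> {0..1}" for m and t :: "nat \<Rightarrow> real"
  proof -
    have "(\<Sum>i<m. ennreal (dist (g (t i)) (g (t (Suc i))))) = ennreal (\<Sum>i<m. dist (g (t i)) (g (t (Suc i))))"
      by (simp add: sum_ennreal)
    also have "\<dots> \<le> ennreal (\<Sum>i<m. L * (t (Suc i) - t i))"
    proof (intro ennreal_leI sum_mono)
      fix i
      have "dist (g (t i)) (g (t (Suc i))) \<le> L * \<bar>t i - t (Suc i)\<bar>" 
        using t(2) rangeI[of t i] rangeI[of t "Suc i"] by (intro lip) blast+
      then show "dist (g (t i)) (g (t (Suc i))) \<le> L * (t (Suc i) - t i)"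
        using monoD[OF t(1), of i "Suc i"] by simp
    qed
    also have "(\<Sum>i<m. L * (t (Suc i) - t i)) = L * (t m - t 0)"
      by (simp add: sum_distrib_left[symmetric] sum_lessThan_telescope)
    also have "\<dots> \<le> L * 1"
    proof (intro mult_left_mono L)
      have "t m \<in> {0..1}" "t 0 \<in> {0..1}" using t(2) by blast+
      then show "t m - t 0 \<le> 1" by auto
    qed
    finally show ?thesis by (auto intro: ennreal_leI)
  qed
  then show ?thesis unfolding path_length_def by (intro SUP_least) auto
qed

lemma dist_chain_le:
  fixes u :: "nat \<Rightarrow> 'a::metric_space"
  assumes "\<And>i. i < l \<Longrightarrow> dist (u i) (u (Suc i)) \<le> e" "i \<le> j" "j \<le> l"
  shows "dist (u i) (u j) \<le> real (j - i) * e"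
  using assms(2,3)
proof (induction j rule: dec_induct)
  case (step j)
  have "dist (u i) (u (Suc j)) \<le> dist (u i) (u j) + dist (u j) (u (Suc j))" by (rule dist_triangle)
  also have "\<dots> \<le> real (j - i) * e + e" using step assms(1)[of j] by (intro add_mono) auto
  also have "\<dots> = real (Suc j - i) * e" using step by (simp add: Suc_diff_le algebra_simps)
  finally show ?case .
qed auto

text \<open>The chains are turned into step functions on the unit interval; Tychonoff's theorem provides
  a cluster point for pointwise convergence, and no equicontinuity is needed.\<close>

lemma chains_to_path:
  fixes S :: "'a::heine_borel set" and u :: "nat \<Rightarrow> nat \<Rightarrow> 'a" and e :: "nat \<Rightarrow> real"
  assumes S: "closed S" and e: "e \<longlonglongrightarrow> 0" "\<And>N. 0 \<le> e N" and L: "0 \<le> L"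
    and step: "\<And>N i. i < l N \<Longrightarrow> dist (u N i) (u N (Suc i)) \<le> e N"
    and len: "\<And>N. real (l N) * e N \<le> L"
    and inS: "\<And>N i. i \<le> l N \<Longrightarrow> u N i \<in> S"
    and start: "(\<lambda>N. u N 0) \<longlonglongrightarrow> x" and finish: "(\<lambda>N. u N (l N)) \<longlonglongrightarrow> y"
  obtains g where "path g" "path_image g \<subseteq> S" "pathstart g = x" "pathfinish g = y"
    "path_length g \<le> ennreal L"
proof -
  \<comment> \<open>Off the unit interval the value is the constant \<open>x\<close>, so that
    \<open>f N\<close> is defined on all reals with values in one compact ball.\<close>
  define f where "f N t = (if t \<in> {0..1} then u N (nat \<lfloor>t * real (l N)\<rfloor>) else x)" for N and t :: real
  have idx: "nat \<lfloor>t * real (l N)\<rfloor> \<le> l N" if "t \<in> {0..1}" for t N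
  proof -
    have "t * real (l N) \<le> 1 * real (l N)" using that by (intro mult_right_mono) auto
    then show ?thesis by (simp add: nat_le_iff floor_le_iff)
  qed
  have fS: "f N t \<in> S" if "t \<in> {0..1}" for N t using inS[OF idx[OF that]] that by (simp add: f_def)
  \<comment> \<open>Rounding down to chain indices costs at most one extra step, hence the error
    \<open>e N\<close>, which vanishes in the limit.\<close>
  have flip: "dist (f N s) (f N t) \<le> L * \<bar>s - t\<bar> + e N" if st: "s \<in> {0..1}" "t \<in> {0..1}" for N s t
  proof -
    have *: "dist (f N s) (f N t) \<le> L * (t - s) + e N" if "s \<le> t" "s \<in> {0..1}" "t \<in> {0..1}" for s t
    proof -
      let ?i = "nat \<lfloor>s * real (l N)\<rfloor>" and ?j = "nat \<lfloor>t * real (l N)\<rfloor>"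
      have le: "?i \<le> ?j" using that by (intro nat_mono floor_mono mult_right_mono) auto
      have "dist (u N ?i) (u N ?j) \<le> real (?j - ?i) * e N"
        using step idx[OF that(3)] le by (intro dist_chain_le[of "l N"]) auto
      also have "\<dots> \<le> ((t - s) * real (l N) + 1) * e N"
      proof (intro mult_right_mono e(2))
        have "0 \<le> s * real (l N)" "0 \<le> t * real (l N)" using that by auto
        then have "real ?i \<ge> s * real (l N) - 1" "real ?j \<le> t * real (l N)" by linarith+
        then show "real (?j - ?i) \<le> (t - s) * real (l N) + 1"
          using le by (simp add: of_nat_diff algebra_simps)
      qed
      also have "\<dots> = (t - s) * (real (l N) * e N) + e N" by (simp add: algebra_simps)
      also have "\<dots> \<le> (t - s) * L + e N" using that len by (intro add_right_mono mult_left_mono) auto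
      finally show ?thesis using that by (simp add: f_def mult.commute)
    qed
    show ?thesis
    proof (cases "s \<le> t")
      case True then show ?thesis using *[OF True st] by simp
    next
      case False
      then show ?thesis using *[of t s] st by (simp add: dist_commute)
    qed
  qed
  have f0: "f N 0 = u N 0" and f1: "f N 1 = u N (l N)" for N by (auto simp: f_def)
  obtain b where b: "\<And>N. dist x (u N 0) \<le> b"
    using convergent_imp_bounded[OF start] by (auto simp: bounded_any_center[of _ x])
  obtain b' where b': "\<And>N. e N \<le> b'"
  proof -
    obtain c where "\<And>N. \<bar>e N\<bar> \<le> c"
      using convergent_imp_bounded[OF e(1)] by (auto simp: bounded_iff)
    then show ?thesis using that abs_le_D1 by blast
  qed
  define K where "K = PiE (UNIV :: real set) (\<lambda>_. cball x (b + L + b'))"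
  have "compact K" 
    using compactin_PiE[of "\<lambda>_::real. euclidean :: 'a topology" UNIV "\<lambda>_. cball x (b + L + b')"]
    by (simp add: K_def euclidean_product_topology)
  have fK: "f N \<in> K" for N
    unfolding K_def
  proof
    fix t :: real
    have "0 \<le> b" "0 \<le> b'" using b[of 0] b'[of 0] e(2)[of 0] zero_le_dist[of x "u 0 0"] by linarith+
    then have "x \<in> cball x (b + L + b')" using L by simp
    moreover have "f N t \<in> cball x (b + L + b')" if t: "t \<in> {0..1}"
    proof -
      have "dist x (f N t) \<le> dist x (f N 0) + dist (f N 0) (f N t)" by (rule dist_triangle)
      also have "\<dots> \<le> b + (L * \<bar>0 - t\<bar> + e N)" using b f0 flip[of 0 t N] t by (intro add_mono) auto
      also have "\<dots> \<le> b + (L * 1 + b')" using t L b' by (intro add_mono mult_left_mono) auto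
      finally show ?thesis by simp
    qed
    ultimately show "f N t \<in> cball x (b + L + b')" by (cases "t \<in> {0..1}") (auto simp: f_def)
  qed auto
  have "\<exists>g\<in>K. inf (nhds g) (filtermap f sequentially) \<noteq> bot"
    using \<open>compact K\<close> unfolding compact_filter
    by (auto simp: filtermap_bot_iff eventually_filtermap fK)
  then obtain g where g: "inf (nhds g) (filtermap f sequentially) \<noteq> bot" by auto
  have cluster: "\<exists>N\<ge>N0. f N \<in> U" if "open U" "g \<in> U" for U N0
  proof (rule ccontr)
    assume "\<not> ?thesis"
    then have "eventually (\<lambda>h. h \<notin> U) (filtermap f sequentially)"
      by (auto simp: eventually_filtermap eventually_sequentially)
    moreover have "eventually (\<lambda>h. h \<in> U) (nhds g)" using that by (rule eventually_nhds_in_open)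
    ultimately have "eventually (\<lambda>h. False) (inf (nhds g) (filtermap f sequentially))"
      unfolding eventually_inf by (metis (mono_tags, lifting))
    then show False using g by (simp add: trivial_limit_def)
  qed
  \<comment> \<open>A neighbourhood in the product topology controls any two coordinates
    simultaneously, which is all that a Lipschitz estimate requires.\<close>
  have close: "\<exists>N\<ge>N0. dist (f N s) (g s) < d \<and> dist (f N t) (g t) < d" if "d > 0" for d N0 s t
  proof -
    let ?U = "(\<lambda>h. h s) -` ball (g s) d \<inter> (\<lambda>h. h t) -` ball (g t) d"
    have "open ?U" by (intro open_Int open_vimage open_ball continuous_on_product_coordinates)
    then show ?thesis using cluster[of ?U N0] that by (auto simp: dist_commute)
  qed
  have evN: "\<exists>N0. \<forall>N\<ge>N0. e N < d" if "d > 0" for d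
    using order_tendstoD(2)[OF e(1) that] by (auto simp: eventually_sequentially)
  have glip: "dist (g s) (g t) \<le> L * \<bar>s - t\<bar>" if "s \<in> {0..1}" "t \<in> {0..1}" for s t
  proof (rule field_le_epsilon)
    fix d :: real assume "d > 0"
    then obtain N0 where N0: "\<And>N. N \<ge> N0 \<Longrightarrow> e N < d / 3" using evN[of "d / 3"] by auto
    obtain N where N: "N \<ge> N0" "dist (f N s) (g s) < d / 3" "dist (f N t) (g t) < d / 3"
      using close[of "d / 3"] \<open>d > 0\<close> by fastforce
    have "dist (g s) (g t) \<le> dist (f N s) (g s) + dist (f N s) (f N t) + dist (f N t) (g t)"
      by (metis add.commute add_mono dist_commute dist_triangle dist_triangle_le add_left_mono)
    then show "dist (g s) (g t) \<le> L * \<bar>s - t\<bar> + d" using N N0[OF N(1)] flip[OF that, of N] by linarith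
  qed
  have gS: "g t \<in> S" if "t \<in> {0..1}" for t
  proof -
    have "\<exists>z\<in>S. dist z (g t) < d" if "d > 0" for d
      using close[OF that, of 0 t t] fS[OF \<open>t \<in> {0..1}\<close>] by blast
    then have "g t \<in> closure S" by (simp add: closure_approachable)
    then show ?thesis using S by simp
  qed
  \<comment> \<open>Where the functions converge, the cluster point takes the limit as its value; at
    0 and 1 this fixes the ends of the path.\<close>
  have lim: "g t = z" if "(\<lambda>N. f N t) \<longlonglongrightarrow> z" for t z
  proof (rule ccontr)
    assume "g t \<noteq> z"
    then have d: "dist (g t) z / 2 > 0" by simp
    obtain N0 where N0: "\<And>N. N \<ge> N0 \<Longrightarrow> dist (f N t) z < dist (g t) z / 2"
      using tendstoD[OF \<open>(\<lambda>N. f N t) \<longlonglongrightarrow> z\<close> d] by (auto simp: eventually_sequentially)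
    obtain N where N: "N \<ge> N0" "dist (f N t) (g t) < dist (g t) z / 2" using close[OF d] by blast
    show False using N0[OF N(1)] N(2) dist_triangle3[of "g t" z "f N t"] by linarith
  qed
  have "continuous_on {0..1} g"
    using glip L by (intro lipschitz_on_continuous_on[of L] lipschitz_onI) (auto simp: dist_real_def)
  then show ?thesis
    using gS lim[of 0 x] lim[of 1 y] start finish path_length_le_Lipschitz[OF L glip]
    by (intro that[of g]) (auto simp: path_def path_image_def pathstart_def pathfinish_def f0 f1)
qed

subsection \<open>Random cones\<close>

text \<open>The vertices \<open>v i\<close> of the loop are the points with \<open>k = 0\<close>; \<open>k = m\<close> gives the apex \<open>p\<close>.\<close>

definition cone_point :: "(nat \<Rightarrow> 'a::real_vector) \<Rightarrow> nat \<Rightarrow> 'a \<Rightarrow> nat \<Rightarrow> nat \<Rightarrow> 'a" where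
  "cone_point v m p i k = v i + (real k / real m) *\<^sub>R (p - v i)"

section \<open>Frontier points beside split triangles\<close>

lemma segment_meets_frontier:
  fixes a b :: "'a::euclidean_space"
  assumes "a \<in> S" "b \<notin> S"
  obtains q where "q \<in> frontier S" "dist a q \<le> dist a b"
proof -
  have "closed_segment a b \<inter> frontier S \<noteq> {}"
    using assms by (intro connected_Int_frontier connected_segment) auto
  then obtain q where q: "q \<in> closed_segment a b" "q \<in> frontier S" by auto
  then show ?thesis using that[of q] dist_in_closed_segment[OF q(1)] by (simp add: dist_commute)
qed

lemma infdist_frontier_le:
  fixes a b :: "'a::euclidean_space"
  assumes "(a \<in> S) \<noteq> (b \<in> S)"
  shows "infdist a (frontier S) \<le> dist a b"
proof (cases "a \<in> S")
  case True
  then obtain q where "q \<in> frontier S" "dist a q \<le> dist a b"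
    using assms segment_meets_frontier[of a S b] by blast
  then show ?thesis using infdist_le[of q "frontier S" a] by simp
next
  case False
  then obtain q where "q \<in> frontier (- S)" "dist a q \<le> dist a b"
    using assms segment_meets_frontier[of a "- S" b] by blast
  then show ?thesis using infdist_le[of q "frontier S" a] by (simp add: frontier_complement)
qed

text \<open>The chain of crossing edges is turned into frontier points, one on each edge.
  Consecutive edges share a triangle, so two displacements and one side of a triangle give
  \<open>3 * \<delta>\<close>. A cell is counted through its corner \<open>P i k\<close>, which
  belongs to both of its triangles.\<close>

lemma grid_frontier_chain:
  fixes P :: "nat \<Rightarrow> nat \<Rightarrow> 'a::euclidean_space" and \<Omega> :: "'a set"
  assumes m: "0 < m" and per: "\<And>k. P M k = P 0 k" and top: "\<And>i. i \<le> M \<Longrightarrow> P i m = p"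
    and h: "\<And>i k. i < M \<Longrightarrow> k \<le> m \<Longrightarrow> dist (P i k) (P (Suc i) k) \<le> \<delta>"
    and vert: "\<And>i k. i \<le> M \<Longrightarrow> k < m \<Longrightarrow> dist (P i k) (P i (Suc k)) \<le> \<delta>"
    and diag: "\<And>i k. i < M \<Longrightarrow> k < m \<Longrightarrow> dist (P i k) (P (Suc i) (Suc k)) \<le> \<delta>"
    and a: "Suc a < M" and inside: "\<And>i. i \<le> a \<Longrightarrow> P i 0 \<in> \<Omega>"
    and outside: "\<And>i. a < i \<Longrightarrow> i < M \<Longrightarrow> P i 0 \<notin> \<Omega>"
  obtains l u where
    "l \<le> 162 * card {(i, k). i < M \<and> k \<le> m \<and> infdist (P i k) (frontier \<Omega>) \<le> \<delta>}"
    "\<And>i. i \<le> l \<Longrightarrow> u i \<in> frontier \<Omega> \<and> (\<exists>j\<le>M. \<exists>k\<le>m. dist (u i) (P j k) \<le> \<delta>)"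
    "\<And>i. i < l \<Longrightarrow> dist (u i) (u (Suc i)) \<le> 3 * \<delta>"
    "dist (u 0) (P 0 0) \<le> \<delta>" "dist (u l) (P a 0) \<le> \<delta>"
proof -
  define B where "B = {(i, k). i < M \<and> k \<le> m \<and> infdist (P i k) (frontier \<Omega>) \<le> \<delta>}"
  define T where "T = grid_triangles P M m"
  define R where "R = crossing_step \<Omega> T"
  have finB: "finite B"
    by (rule finite_subset[of _ "{..<M} \<times> {..m}"]) (auto simp: B_def)
  have h0: "0 \<le> \<delta>" using h[of 0 0] a zero_le_dist[of "P 0 0" "P (Suc 0) 0"] by linarith
  \<comment> \<open>A corner farther than \<delta> from the frontier lies on the same side as all
    points within \<delta> of it, so neither triangle of its cell is split.\<close>
  have notB: "b \<in> \<Omega> \<longleftrightarrow> P i k \<in> \<Omega>" if "(i, k) \<notin> B" "i < M" "k < m" "dist (P i k) b \<le> \<delta>" for i k b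
    using infdist_frontier_le[of "P i k" \<Omega> b] that by (auto simp: B_def)
  have tri: "dist g g' \<le> \<delta> \<and> (\<exists>j\<le>M. \<exists>k\<le>m. g = P j k)" if t: "t \<in> T" "g \<in> t" "g' \<in> t" for t g g'
  proof -
    obtain i k where ik: "i < M" "k < m"
      "t = {P i k, P (Suc i) k, P (Suc i) (Suc k)} \<or> t = {P i k, P i (Suc k), P (Suc i) (Suc k)}"
      using t(1) by (auto simp: T_def grid_triangles_def)
    have d: "dist (P i k) (P (Suc i) k) \<le> \<delta>" "dist (P i (Suc k)) (P (Suc i) (Suc k)) \<le> \<delta>"
      "dist (P i k) (P i (Suc k)) \<le> \<delta>" "dist (P (Suc i) k) (P (Suc i) (Suc k)) \<le> \<delta>" "dist (P i k) (P (Suc i) (Suc k)) \<le> \<delta>"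
      using h[of i k] h[of i "Suc k"] vert[of i k] vert[of "Suc i" k] diag[of i k] ik by auto
    have "dist g g' \<le> \<delta>" using ik(3) t d h0 by (auto simp: dist_commute)
    moreover have "\<exists>j\<le>M. \<exists>k\<le>m. g = P j k"
    proof -
      have "g = P i k \<or> g = P (Suc i) k \<or> g = P i (Suc k) \<or> g = P (Suc i) (Suc k)" using ik(3) t by auto
      moreover have "i \<le> M" "Suc i \<le> M" "k \<le> m" "Suc k \<le> m" using ik by auto
      ultimately show ?thesis by blast
    qed
    ultimately show ?thesis by blast
  qed
  have cardR: "finite R" "card R \<le> 162 * card B"
    unfolding R_def T_def
    using card_crossing_step_le[OF finB, of M m P \<Omega>] notB h vert diag by (auto 4 3)
  \<comment> \<open>The closing edge, which returns from outside to the first vertex; besides edge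
    \<open>a\<close> it is the only crossing edge of the bottom row.\<close>
  define i0 where "i0 = M - 1"
  have i0: "i0 < M" "Suc i0 = M" "a < i0" using a by (auto simp: i0_def)
  have pM: "P M 0 = P 0 0" by (rule per)
  have "((P (Suc i0) 0, P i0 0), (P a 0, P (Suc a) 0)) \<in> R\<^sup>*"
    unfolding R_def T_def
  proof (rule grid_crossing_connected[where P = P and p = p])
    show "P i 0 \<in> \<Omega> \<longleftrightarrow> P (Suc i) 0 \<in> \<Omega>" if "i < M" "i \<noteq> a" "i \<noteq> i0" for i
    proof (cases "i < a")
      case True then show ?thesis using inside[of i] inside[of "Suc i"] by auto
    next
      case False
      then show ?thesis using that outside[of i] outside[of "Suc i"] i0 by auto
    qed
  qed (use a i0 inside outside pM per top in auto)
  then obtain l where l: "l \<le> card R" "((P M 0, P i0 0), (P a 0, P (Suc a) 0)) \<in> R ^^ l"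
    using rtrancl_finite_eq_relpow[OF cardR(1)] i0 by auto
  then obtain f where f: "f 0 = (P M 0, P i0 0)" "f l = (P a 0, P (Suc a) 0)" "\<And>i. i < l \<Longrightarrow> (f i, f (Suc i)) \<in> R"
    unfolding relpow_fun_conv by blast
  have good: "fst (f i) \<in> \<Omega> \<and> snd (f i) \<notin> \<Omega> \<and> dist (fst (f i)) (snd (f i)) \<le> \<delta> \<and> (\<exists>j\<le>M. \<exists>k\<le>m. fst (f i) = P j k)"
    if "i \<le> l" for i
  proof (cases i)
    case 0
    have "dist (P M 0) (P i0 0) \<le> \<delta>" using h[of i0 0] i0 by (simp add: dist_commute)
    then show ?thesis using 0 f(1) i0 inside[of 0] outside[of i0] pM by auto
  next
    case (Suc j)
    then have "(f j, f i) \<in> R" using f(3)[of j] that by simp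
    then obtain t where t: "t \<in> T" "fst (f i) \<in> t" "snd (f i) \<in> t" "fst (f i) \<in> \<Omega>" "snd (f i) \<notin> \<Omega>"
      unfolding R_def crossing_step_def by auto
    then show ?thesis using tri[OF t(1-3)] by blast
  qed
  have "\<exists>q\<in>frontier \<Omega>. dist (fst (f i)) q \<le> \<delta>" if "i \<le> l" for i
    using good[OF that] segment_meets_frontier[of "fst (f i)" \<Omega> "snd (f i)"] by (metis order_trans)
  then obtain u where u: "\<And>i. i \<le> l \<Longrightarrow> u i \<in> frontier \<Omega> \<and> dist (fst (f i)) (u i) \<le> \<delta>" by metis
  show ?thesis
  proof (rule that[of l u])
    show "l \<le> 162 * card {(i, k). i < M \<and> k \<le> m \<and> infdist (P i k) (frontier \<Omega>) \<le> \<delta>}"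
      using l(1) cardR(2) by (simp add: B_def)
    show "u i \<in> frontier \<Omega> \<and> (\<exists>j\<le>M. \<exists>k\<le>m. dist (u i) (P j k) \<le> \<delta>)" if "i \<le> l" for i
      using u[OF that] good[OF that] by (metis dist_commute)
    show "dist (u i) (u (Suc i)) \<le> 3 * \<delta>" if "i < l" for i
    proof -
      obtain t where t: "t \<in> T" "fst (f i) \<in> t" "fst (f (Suc i)) \<in> t"
        using f(3)[OF \<open>i < l\<close>] unfolding R_def crossing_step_def by auto
      have "dist (u i) (u (Suc i)) \<le> dist (u i) (fst (f i)) + dist (fst (f i)) (fst (f (Suc i))) + dist (fst (f (Suc i))) (u (Suc i))"
        using dist_triangle[of "u i" "u (Suc i)" "fst (f i)"] dist_triangle[of "fst (f i)" "u (Suc i)" "fst (f (Suc i))"] by linarith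
      then show ?thesis using tri[OF t] u[of i] u[of "Suc i"] that by (simp add: dist_commute)
    qed
    show "dist (u 0) (P 0 0) \<le> \<delta>" using u[of 0] f(1) pM by (simp add: dist_commute)
    show "dist (u l) (P a 0) \<le> \<delta>" using u[of l] f(2) by (simp add: dist_commute)
  qed
qed

section \<open>Measure of the apexes to be avoided\<close>

lemma fmeasurable_ball: "ball x r \<in> fmeasurable lborel" for x :: "'a::euclidean_space"
  using emeasure_bounded_finite[OF bounded_ball, of x r] by (auto simp: fmeasurable_def)

lemma measure_finite_UN_balls_le:
  fixes c :: "'i \<Rightarrow> 'a::euclidean_space" and x :: 'a
  assumes I: "finite I" "real (card I) \<le> N" and r: "0 < r" "0 \<le> \<kappa>"
    and A: "A \<in> sets lborel" "A \<subseteq> (\<Union>i\<in>I. ball (c i) (\<kappa> * r))"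
  shows "measure lborel A \<le> N * \<kappa> ^ DIM('a) * measure lborel (ball x r)"
proof -
  have "measure lborel A \<le> measure lborel (\<Union>i\<in>I. ball (c i) (\<kappa> * r))"
    using A I by (intro measure_mono_fmeasurable fmeasurable.finite_UN) (auto intro: fmeasurable_ball)
  also have "\<dots> \<le> (\<Sum>i\<in>I. measure lborel (ball (c i) (\<kappa> * r)))"
    using I by (intro measure_UNION_le) auto
  also have "\<dots> = real (card I) * (\<kappa> ^ DIM('a) * measure lborel (ball x r))"
    using r by (simp add: content_ball power_mult_distrib)
  also have "\<dots> \<le> N * (\<kappa> ^ DIM('a) * measure lborel (ball x r))"
    using I r by (intro mult_right_mono) auto
  finally show ?thesis by (simp add: mult.assoc)
qed

text \<open>For fixed \<open>i\<close> and \<open>k\<close> the map from the apex to the cone point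
  is a homothety of ratio \<open>k / m\<close>, taking \<open>ball x r\<close> to a ball of radius
  \<open>k * e\<close>. There \<open>O(k ^ n)\<close> balls of radius \<open>e\<close> cover
  \<open>E\<close>. Enlarged by \<open>a * e\<close> and pulled back, each occupies a proportion
  \<open>O(k ^ -(n + 1))\<close> of the apexes, and the product is \<open>O(1 / k)\<close>.\<close>

lemma cone_slice_measure:
  fixes E :: "'a::euclidean_space set"
  assumes DIM: "DIM('a) = n + 1" and E: "closed E" "E \<noteq> {}" and C: "0 \<le> C"
    and cover: "\<And>q \<rho> e. 0 < e \<Longrightarrow> e \<le> \<rho> \<Longrightarrow>
      \<exists>F. finite F \<and> real (card F) \<le> C * (\<rho> / e) ^ n \<and> E \<inter> ball q \<rho> \<subseteq> (\<Union>f\<in>F. ball f e)"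
    and e: "0 < e" and er: "e = r / real m" and m: "0 < m" and k: "1 \<le> k" and a: "0 \<le> a"
  shows "measure lborel {p \<in> ball x r. infdist (cone_point v m p i k) E \<le> a * e}
    \<le> C * (a + 2) ^ (2 * n + 1) / real k * measure lborel (ball x r)"
proof -
  define s where "s = real k / real m"
  have s: "0 < s" "s * r = real k * e" using k m er by (auto simp: s_def)
  have r: "0 < r" using e er m by (simp add: zero_less_divide_iff)
  define q where "q = v i + s *\<^sub>R (x - v i)"
  let ?A = "{p \<in> ball x r. infdist (cone_point v m p i k) E \<le> a * e}"
  obtain F where F: "finite F" "real (card F) \<le> C * ((real k + a + 1) * e / e) ^ n"
    "E \<inter> ball q ((real k + a + 1) * e) \<subseteq> (\<Union>f\<in>F. ball f e)"
  proof -
    have "1 * e \<le> (real k + a + 1) * e" using e a by (intro mult_right_mono) auto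
    then show ?thesis using cover[of e "(real k + a + 1) * e" q] e that by auto
  qed
  have "?A \<subseteq> (\<Union>f\<in>F. ball (v i + (1 / s) *\<^sub>R (f - v i)) ((a + 1) / real k * r))"
  proof
    fix p assume "p \<in> ?A"
    then have p: "dist x p < r" "infdist (cone_point v m p i k) E \<le> a * e" by auto
    define P where "P = cone_point v m p i k"
    have P: "P = v i + s *\<^sub>R (p - v i)" by (simp add: P_def cone_point_def s_def)
    obtain z where z: "z \<in> E" "dist P z \<le> a * e"
      using infdist_attains_inf[OF E, of P] p(2) unfolding P_def by metis
    have "dist q P = s * dist x p"
    proof -
      have "q - P = s *\<^sub>R (x - p)" by (simp add: q_def P algebra_simps)
      then show ?thesis using s by (simp add: dist_norm)
    qed
    also have "\<dots> < s * r" by (rule mult_strict_left_mono[OF p(1) s(1)])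
    finally have "dist q P < real k * e" using s by simp
    then have "dist q z < (real k + a + 1) * e"
      using dist_triangle[of q z P] z e by (simp add: algebra_simps)
    then obtain f where f: "f \<in> F" "dist f z < e" using F(3) z by auto
    have "dist P f < (a + 1) * e" using dist_triangle2[of P f z] f z by (simp add: algebra_simps)
    moreover have "(v i + (1 / s) *\<^sub>R (f - v i)) - p = (1 / s) *\<^sub>R (f - P)"
      using s by (simp add: P algebra_simps)
    then have "dist (v i + (1 / s) *\<^sub>R (f - v i)) p = dist P f / s"
      using s by (simp add: dist_norm norm_minus_commute)
    ultimately have "dist (v i + (1 / s) *\<^sub>R (f - v i)) p < (a + 1) * e / s"
      using s by (simp add: divide_strict_right_mono)
    also have "(a + 1) * e / s = (a + 1) / real k * r" using s k m er by (simp add: s_def field_simps)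
    finally show "p \<in> (\<Union>f\<in>F. ball (v i + (1 / s) *\<^sub>R (f - v i)) ((a + 1) / real k * r))" using f by auto
  qed
  moreover have "?A \<in> sets lborel"
  proof -
    have "closed {p. infdist (cone_point v m p i k) E \<le> a * e}"
      unfolding cone_point_def by (intro closed_Collect_le continuous_intros)
    then have "ball x r \<inter> {p. infdist (cone_point v m p i k) E \<le> a * e} \<in> sets lborel" by auto
    then show ?thesis by (simp add: Int_def)
  qed
  ultimately have "measure lborel ?A \<le> C * (real k + a + 1) ^ n * ((a + 1) / real k) ^ DIM('a) * measure lborel (ball x r)"
    using F e r a k by (intro measure_finite_UN_balls_le) auto
  \<comment> \<open>As \<open>k\<close> is at least 1, \<open>k + a + 1\<close> may be replaced by
    \<open>k * (a + 2)\<close>, after which all powers of \<open>k\<close> but one cancel.\<close>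
  also have "\<dots> \<le> C * (real k * (a + 2)) ^ n * ((a + 2) / real k) ^ DIM('a) * measure lborel (ball x r)"
  proof (intro mult_right_mono mult_mono power_mono mult_left_mono divide_right_mono C)
    have "1 * (a + 1) \<le> real k * (a + 1)" using k a by (intro mult_right_mono) auto
    then show "real k + a + 1 \<le> real k * (a + 2)" by (simp add: algebra_simps)
  qed (use a C in auto)
  also have "C * (real k * (a + 2)) ^ n * ((a + 2) / real k) ^ DIM('a) = C * (a + 2) ^ (2 * n + 1) / real k"
  proof -
    have "(real k * (a + 2)) ^ n * ((a + 2) / real k) ^ n = (real k * (a + 2) * ((a + 2) / real k)) ^ n"
      by (rule power_mult_distrib[symmetric])
    also have "real k * (a + 2) * ((a + 2) / real k) = (a + 2)\<^sup>2"
      using k by (simp add: power2_eq_square)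
    finally have "(real k * (a + 2)) ^ n * ((a + 2) / real k) ^ n = (a + 2) ^ (2 * n)"
      by (simp add: power_mult)
    then show ?thesis by (simp add: DIM mult.assoc)
  qed
  finally show ?thesis .
qed

text \<open>
  The slice at height \<open>k\<close> above \<open>v i\<close> meets the \<open>a * e\<close>-neighbourhood of \<open>E\<close> for a proportion
  \<open>O(1 / k)\<close> of the apexes, and for none unless \<open>v i\<close> is within \<open>O(k * e)\<close> of \<open>E\<close>, which happens for only
  \<open>O(k)\<close> indices \<open>i\<close>.  Summing over \<open>i\<close> first therefore gives \<open>O(1)\<close> for each \<open>k\<close>.
\<close>

lemma cone_total_measure:
  fixes E :: "'a::euclidean_space set"
  assumes DIM: "DIM('a) = n + 1" and E: "closed E" "E \<noteq> {}" and C: "0 \<le> C"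
    and cover: "\<And>q \<rho> e. 0 < e \<Longrightarrow> e \<le> \<rho> \<Longrightarrow>
      \<exists>F. finite F \<and> real (card F) \<le> C * (\<rho> / e) ^ n \<and> E \<inter> ball q \<rho> \<subseteq> (\<Union>f\<in>F. ball f e)"
    and e: "0 < e" and er: "e = r / real m" and m: "0 < m" and a: "0 \<le> a" and K: "0 \<le> K"
    and count: "\<And>\<mu>. 0 \<le> \<mu> \<Longrightarrow> real (card {i. i < M \<and> infdist (v i) E \<le> \<mu>}) \<le> K * \<mu> / e"
    and near: "\<And>i. i < M \<Longrightarrow> dist x (v i) \<le> K * r"
  shows "(\<Sum>(i, k)\<in>{..<M} \<times> {..m}. measure lborel {p \<in> ball x r. infdist (cone_point v m p i k) E \<le> a * e})
    \<le> (K * a + K * (a + 1 + K) * (C * (a + 2) ^ (2 * n + 1))) * real m * measure lborel (ball x r)"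
proof -
  define V where "V = measure lborel (ball x r)"
  define A where "A i k = {p \<in> ball x r. infdist (cone_point v m p i k) E \<le> a * e}" for i k
  define C1 where "C1 = C * (a + 2) ^ (2 * n + 1)"
  have C1: "0 \<le> C1" using C a by (simp add: C1_def)
  have V: "0 \<le> V" by (simp add: V_def)
  have r: "0 < r" using e er m by (simp add: zero_less_divide_iff)
  have AV: "measure lborel (A i k) \<le> V" for i k
  proof -
    have "closed {p. infdist (cone_point v m p i k) E \<le> a * e}"
      unfolding cone_point_def by (intro closed_Collect_le continuous_intros)
    then have "ball x r \<inter> {p. infdist (cone_point v m p i k) E \<le> a * e} \<in> sets lborel" by auto
    then have "A i k \<in> sets lborel" by (simp add: Int_def A_def)
    then show ?thesis unfolding V_def by (intro measure_mono_fmeasurable fmeasurable_ball) (auto simp: A_def)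
  qed
  have sum_le: "(\<Sum>i<M. measure lborel (A i k)) \<le> real (card {i. i < M \<and> infdist (v i) E \<le> \<mu>}) * W"
    if W: "\<And>i. measure lborel (A i k) \<le> W" "0 \<le> W" and far: "\<And>i. i < M \<Longrightarrow> A i k \<noteq> {} \<Longrightarrow> infdist (v i) E \<le> \<mu>" for k W \<mu>
  proof -
    have "(\<Sum>i<M. measure lborel (A i k)) = (\<Sum>i\<in>{i. i < M \<and> infdist (v i) E \<le> \<mu>}. measure lborel (A i k))"
    proof (rule sum.mono_neutral_right)
      show "\<forall>i\<in>{..<M} - {i. i < M \<and> infdist (v i) E \<le> \<mu>}. measure lborel (A i k) = 0"
        using far by fastforce
    qed auto
    also have "\<dots> \<le> real (card {i. i < M \<and> infdist (v i) E \<le> \<mu>}) * W"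
      by (rule sum_bounded_above) (rule W(1))
    finally show ?thesis .
  qed
  \<comment> \<open>At \<open>k = 0\<close> the cone point is \<open>v i\<close> whatever the apex,
    so averaging gains nothing and the count of loop vertices is used directly.\<close>
  have zero: "(\<Sum>i<M. measure lborel (A i 0)) \<le> K * a * V"
  proof -
    have "(\<Sum>i<M. measure lborel (A i 0)) \<le> real (card {i. i < M \<and> infdist (v i) E \<le> a * e}) * V"
      by (rule sum_le[OF AV V]) (auto simp: A_def cone_point_def)
    also have "\<dots> \<le> K * (a * e) / e * V" using count[of "a * e"] a e V by (intro mult_right_mono) auto
    finally show ?thesis using e by simp
  qed
  have pos: "(\<Sum>i<M. measure lborel (A i k)) \<le> K * (a + 1 + K) * C1 * V" if k: "1 \<le> k" for k
  proof -
    have "(\<Sum>i<M. measure lborel (A i k)) \<le> real (card {i. i < M \<and> infdist (v i) E \<le> (a + 1 + K) * real k * e}) * (C1 / real k * V)"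
    proof (rule sum_le)
      show "measure lborel (A i k) \<le> C1 / real k * V" for i
        unfolding A_def C1_def V_def by (rule cone_slice_measure[OF DIM E C cover e er m k a])
      show "0 \<le> C1 / real k * V" using C1 V by simp
      fix i assume i: "i < M" and "A i k \<noteq> {}"
      then obtain p where p: "dist x p < r" "infdist (cone_point v m p i k) E \<le> a * e" by (auto simp: A_def)
      have "dist p (v i) \<le> (1 + K) * r"
        using dist_triangle[of p "v i" x] p near[OF i] by (simp add: dist_commute algebra_simps)
      then have "real k / real m * dist p (v i) \<le> real k / real m * ((1 + K) * r)"
        by (rule mult_left_mono) simp
      also have "real k / real m * ((1 + K) * r) = (1 + K) * real k * e" using er by simp
      finally have "dist (v i) (cone_point v m p i k) \<le> (1 + K) * real k * e"
        by (simp add: cone_point_def dist_norm)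
      moreover have "infdist (v i) E \<le> infdist (cone_point v m p i k) E + dist (v i) (cone_point v m p i k)"
        by (rule infdist_triangle)
      moreover have "a * e * 1 \<le> a * e * real k" using k a e by (intro mult_left_mono) auto
      moreover have "(a + 1 + K) * real k * e = a * e * real k + (1 + K) * real k * e"
        by (simp add: algebra_simps)
      ultimately show "infdist (v i) E \<le> (a + 1 + K) * real k * e" using p(2) by linarith
    qed
    also have "\<dots> \<le> K * ((a + 1 + K) * real k * e) / e * (C1 / real k * V)"
    proof (rule mult_right_mono[OF count])
      show "0 \<le> (a + 1 + K) * real k * e" using a K e by simp
      show "0 \<le> C1 / real k * V" using C1 V by simp
    qed
    also have "\<dots> = K * (a + 1 + K) * C1 * V" using e k by simp
    finally show ?thesis .
  qed
  have "(\<Sum>(i, k)\<in>{..<M} \<times> {..m}. measure lborel (A i k)) = (\<Sum>k\<le>m. \<Sum>i<M. measure lborel (A i k))"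
    by (subst sum.cartesian_product[symmetric]) (rule sum.swap)
  also have "\<dots> = (\<Sum>i<M. measure lborel (A i 0)) + (\<Sum>k\<in>{1..m}. \<Sum>i<M. measure lborel (A i k))"
    by (simp add: sum.atMost_shift sum.atLeast1_atMost_eq)
  also have "\<dots> \<le> K * a * V + real (card {1..m}) * (K * (a + 1 + K) * C1 * V)"
    using pos by (intro add_mono zero sum_bounded_above) auto
  also have "\<dots> \<le> K * a * V * real m + real m * (K * (a + 1 + K) * C1 * V)"
  proof -
    have "K * a * V * 1 \<le> K * a * V * real m" using K a V m by (intro mult_left_mono) auto
    then show ?thesis by simp
  qed
  finally show ?thesis by (simp add: A_def V_def C1_def algebra_simps)
qed

text \<open>Markov's inequality on \<open>ball x r - Z\<close>, which retains at least half of the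
  measure: were every multiplicity there above \<open>4 * T\<close>, the sum of the measures would
  be at least \<open>2 * T\<close> times that of the ball.\<close>

lemma exists_low_multiplicity_point:
  fixes A :: "'j \<Rightarrow> 'a::euclidean_space set"
  assumes J: "finite J" and A: "\<And>j. j \<in> J \<Longrightarrow> A j \<in> sets lborel" "\<And>j. j \<in> J \<Longrightarrow> A j \<subseteq> ball x r"
    and r: "0 < r" and T: "0 < T" and sum: "(\<Sum>j\<in>J. measure lborel (A j)) \<le> T * measure lborel (ball x r)"
    and Z: "Z \<in> fmeasurable lborel" "measure lborel Z \<le> measure lborel (ball x r) / 2"
  obtains p where "p \<in> ball x r - Z" "real (card {j \<in> J. p \<in> A j}) \<le> 4 * T"
proof -
  define B where "B = ball x r"
  have V: "0 < measure lborel B" using r by (simp add: B_def content_ball_pos)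
  have finA: "A j \<in> fmeasurable lborel" if "j \<in> J" for j
    using that A fmeasurable_ball by (meson fmeasurableI2)
  have BZ: "B - Z \<in> fmeasurable lborel" 
    using Z by (intro fmeasurableI2[OF fmeasurable_ball[of x r]]) (auto simp: B_def)
  have "measure lborel B \<le> measure lborel ((B - Z) \<union> Z)"
    using BZ Z by (intro measure_mono_fmeasurable fmeasurable.Un) (auto simp: B_def)
  also have "\<dots> \<le> measure lborel (B - Z) + measure lborel Z"
    using BZ Z by (intro measure_Un_le) auto
  finally have half: "measure lborel B / 2 \<le> measure lborel (B - Z)"
    using Z(2) by (simp add: B_def)
  have "\<exists>p\<in>B - Z. real (card {j \<in> J. p \<in> A j}) \<le> 4 * T"
  proof (rule ccontr)
    assume neg: "\<not> ?thesis"
    have int: "integrable lborel (indicat_real (A j))" if "j \<in> J" for j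
      using finA[OF that] by (auto simp: fmeasurable_def)
    have "4 * T * measure lborel (B - Z) = (\<integral>p. 4 * T * indicat_real (B - Z) p \<partial>lborel)"
      using BZ by (simp add: fmeasurable_def)
    also have "\<dots> \<le> (\<integral>p. (\<Sum>j\<in>J. indicat_real (A j) p) \<partial>lborel)"
    proof (rule integral_mono)
      show "integrable lborel (\<lambda>p. 4 * T * indicat_real (B - Z) p)" using BZ by (auto simp: fmeasurable_def)
      show "integrable lborel (\<lambda>p. \<Sum>j\<in>J. indicat_real (A j) p)" using int by auto
      fix p
      have "(\<Sum>j\<in>J. indicat_real (A j) p) = real (card {j \<in> J. p \<in> A j})"
        using J by (simp add: indicator_def sum.If_cases Int_def)
      then show "4 * T * indicat_real (B - Z) p \<le> (\<Sum>j\<in>J. indicat_real (A j) p)"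
        using neg by (cases "p \<in> B - Z") (auto simp: not_le intro: less_imp_le)
    qed
    also have "\<dots> = (\<Sum>j\<in>J. measure lborel (A j))"
      using int A by (subst Bochner_Integration.integral_sum) auto
    also have "\<dots> \<le> T * measure lborel B" using sum by (simp add: B_def)
    finally have "4 * T * measure lborel (B - Z) \<le> T * measure lborel B" .
    moreover have "4 * T * (measure lborel B / 2) \<le> 4 * T * measure lborel (B - Z)"
      using half T by (intro mult_left_mono) auto
    ultimately have "T * measure lborel B \<le> 0" by (simp add: algebra_simps)
    then show False using T V by (simp add: mult_le_0_iff)
  qed
  then show ?thesis using that by (auto simp: B_def)
qed

text \<open>
  The cone is two-dimensional, so a random one meets a ball of radius \<open>\<eta> * r\<close> with probability
  \<open>O(\<eta> ^ (DIM('a) - 2))\<close>.  The indices are thinned to multiples of \<open>b\<close>, about \<open>\<eta> * m\<close>, so that the union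
  bound runs over \<open>O(1 / \<eta>\<^sup>2)\<close> balls, whatever \<open>m\<close> is.
\<close>

lemma cone_avoids_ball:
  assumes DIM: "3 \<le> DIM('a::euclidean_space)" and K: "1 \<le> K" and c: "0 < c" "c \<le> 1"
  obtains \<eta> where "0 < \<eta>" "\<And>(v :: nat \<Rightarrow> 'a) M m x z r e. 0 < r \<Longrightarrow> e = r / real m \<Longrightarrow> 1 \<le> \<eta> * real m \<Longrightarrow> real M \<le> K * real m \<Longrightarrow>
    (\<And>i. i < M \<Longrightarrow> dist (v i) (v (Suc i)) \<le> 2 * e) \<Longrightarrow>
    (\<And>i. i \<le> M \<Longrightarrow> dist x (v i) \<le> K * r \<and> c * r \<le> dist z (v i)) \<Longrightarrow>
    \<exists>Z. Z \<in> fmeasurable lborel \<and> measure lborel Z \<le> measure lborel (ball x r) / 2 \<and>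
      (\<forall>p\<in>ball x r - Z. \<forall>i\<le>M. \<forall>k\<le>m. \<eta> * r \<le> dist z (cone_point v m p i k))"
proof -
  define D where "D = DIM('a)"
  \<comment> \<open>\<sigma> is a lower bound for the height \<open>k / m\<close> at which a cone
    point can come near \<open>z\<close>: below it the point is still close to \<open>v i\<close>,
    which is \<open>c * r\<close> away from \<open>z\<close>. Solving for the apex divides distances
    by the height, so the excluded balls have radius \<open>\<kappa> * \<eta> * r\<close>. The
    bounds on \<eta> serve, in order, the count of balls, a total error of at most
    \<open>c * r / 2\<close>, and a total measure of at most one half.\<close>
  define \<sigma> where "\<sigma> = c / (2 * (1 + K))"
  define \<kappa> where "\<kappa> = (4 + K) / \<sigma>"
  define \<eta> where "\<eta> = Min {1, c / (2 * (4 + K)), 1 / (18 * K * \<kappa> ^ D)}"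
  have \<sigma>: "0 < \<sigma>" using c K by (simp add: \<sigma>_def)
  have \<kappa>: "0 < \<kappa>" using \<sigma> K by (simp add: \<kappa>_def)
  have \<eta>: "0 < \<eta>" "\<eta> \<le> 1" "\<eta> \<le> c / (2 * (4 + K))" "\<eta> \<le> 1 / (18 * K * \<kappa> ^ D)"
    using c K \<kappa> by (auto simp: \<eta>_def)
  \<comment> \<open>Here dimension at least 3 enters: against \<open>O(1 / \<eta>\<^sup>2)\<close>
    balls, the relative volume \<open>O(\<eta> ^ 3)\<close> leaves one power of \<eta> to
    spare.\<close>
  have small: "9 * K / \<eta>\<^sup>2 * (\<kappa> * \<eta>) ^ D \<le> 1 / 2"
  proof -
    have "\<eta> ^ D \<le> \<eta> ^ 3" using \<eta> DIM by (intro power_decreasing) (auto simp: D_def)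
    then have "9 * K / \<eta>\<^sup>2 * (\<kappa> * \<eta>) ^ D \<le> 9 * K / \<eta>\<^sup>2 * (\<kappa> ^ D * \<eta> ^ 3)"
      using K \<kappa> \<eta> unfolding power_mult_distrib by (intro mult_left_mono) auto
    also have "\<dots> = 9 * K * \<kappa> ^ D * \<eta>" using \<eta> by (simp add: power3_eq_cube power2_eq_square)
    also have "\<dots> \<le> 9 * K * \<kappa> ^ D * (1 / (18 * K * \<kappa> ^ D))"
      using \<eta> K \<kappa> by (intro mult_left_mono) auto
    also have "\<dots> = 1 / 2" using K \<kappa> by simp
    finally show ?thesis .
  qed
  show ?thesis
  proof (rule that[OF \<eta>(1)])
    fix v :: "nat \<Rightarrow> 'a" and M m :: nat and x z :: 'a and r e :: real
    assume r: "0 < r" and e: "e = r / real m" and m: "1 \<le> \<eta> * real m" and M: "real M \<le> K * real m"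
      and step: "\<And>i. i < M \<Longrightarrow> dist (v i) (v (Suc i)) \<le> 2 * e"
      and v: "\<And>i. i \<le> M \<Longrightarrow> dist x (v i) \<le> K * r \<and> c * r \<le> dist z (v i)"
    have m0: "0 < m" using m by (cases "m = 0") auto
    have e0: "0 < e" using r m0 e by simp
    define b where "b = nat \<lfloor>\<eta> * real m\<rfloor>"
    have b: "1 \<le> b" "real b \<le> \<eta> * real m" "\<eta> * real m \<le> 2 * real b"
    proof -
      show "1 \<le> b" using m by (simp add: b_def le_nat_iff)
      show "real b \<le> \<eta> * real m" using m by (simp add: b_def)
      have "\<eta> * real m < real b + 1" unfolding b_def using m by linarith
      then show "\<eta> * real m \<le> 2 * real b" using \<open>1 \<le> b\<close> by linarith
    qed
    \<comment> \<open>The apex for which the cone point with indices \<open>b * j\<close> and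
      \<open>b * l\<close> is exactly \<open>z\<close>. At \<open>l = 0\<close> the quotient by 0 is
      0 and the value is \<open>v (b * j)\<close>; this height is ruled out below by
      \<open>\<sigma> < s\<close>.\<close>
    define ctr where "ctr = (\<lambda>(j, l). v (b * j) + (1 / (real (b * l) / real m)) *\<^sub>R (z - v (b * j)))"
    define I where "I = {..M div b} \<times> {..m div b}"
    define Z where "Z = (\<Union>q\<in>I. ball (ctr q) (\<kappa> * \<eta> * r))"
    have finI: "finite I" by (simp add: I_def)
    have "real (card I) \<le> 9 * K / \<eta>\<^sup>2"
    proof -
      have div: "real (n div b) + 1 \<le> 3 * L / \<eta>" if "real n \<le> L * real m" "1 \<le> L" for n L
      proof -
        have "real (n div b) \<le> real n / real b" by (rule of_nat_div_le_of_nat)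
        also have "\<dots> \<le> L * real m / (\<eta> * real m / 2)"
          using that b \<eta> m0 by (intro frac_le) auto
        also have "\<dots> = 2 * L / \<eta>" using m0 by simp
        finally have "real (n div b) \<le> 2 * L / \<eta>" .
        moreover have "1 \<le> L / \<eta>" using that \<eta> by (simp add: field_simps)
        moreover have "3 * L / \<eta> = 2 * L / \<eta> + L / \<eta>" by (simp flip: add_divide_distrib)
        ultimately show ?thesis by linarith
      qed
      have "real (card I) = (real (M div b) + 1) * (real (m div b) + 1)"
        by (simp add: I_def card_cartesian_product algebra_simps)
      also have "\<dots> \<le> (3 * K / \<eta>) * (3 * 1 / \<eta>)"
      proof (rule mult_mono)
        show "real (M div b) + 1 \<le> 3 * K / \<eta>" by (rule div[OF M K])
        show "real (m div b) + 1 \<le> 3 * 1 / \<eta>" by (rule div) auto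
        show "0 \<le> 3 * K / \<eta>" using K \<eta> by simp
      qed simp
      finally show ?thesis by (simp add: power2_eq_square)
    qed
    then have "measure lborel Z \<le> 9 * K / \<eta>\<^sup>2 * (\<kappa> * \<eta>) ^ D * measure lborel (ball x r)"
      unfolding D_def using r \<kappa> \<eta> finI
      by (intro measure_finite_UN_balls_le[where I = I and c = ctr]) (auto simp: Z_def)
    also have "\<dots> \<le> 1 / 2 * measure lborel (ball x r)"
      using small by (intro mult_right_mono) auto
    finally have measZ: "measure lborel Z \<le> measure lborel (ball x r) / 2" by simp
    have "Z \<in> fmeasurable lborel"
      unfolding Z_def using finI by (intro fmeasurable.finite_UN) (auto simp: fmeasurable_ball)
    moreover have "p \<in> Z" if p: "p \<in> ball x r" and i: "i \<le> M" and k: "k \<le> m"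
      and close: "dist z (cone_point v m p i k) < \<eta> * r" for p i k
    proof -
      \<comment> \<open>Rounding down to multiples of \<open>b\<close> moves the cone point by at
        most \<open>2 * \<eta> * r\<close> along the loop and \<open>(1 + K) * \<eta> * r\<close>
        along the ray. With the distance \<open>\<eta> * r\<close> to \<open>z\<close> this makes
        \<open>(4 + K) * \<eta> * r\<close>.\<close>
      define i' where "i' = b * (i div b)"
      define k' where "k' = b * (k div b)"
      have i': "i' \<le> i" "real (i - i') \<le> real b"
        and k': "k' \<le> k" "real (k - k') \<le> real b"
        using b(1) by (auto simp: i'_def k'_def minus_mult_div_eq_mod less_imp_le_nat)
      have pv: "dist p (v i') \<le> (1 + K) * r"
        using dist_triangle[of p "v i'" x] p v[of i'] i i' by (simp add: dist_commute algebra_simps)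
      have "dist (v i') (v i) \<le> real (i - i') * (2 * e)"
        using step i i' by (intro dist_chain_le[of M]) auto
      also have "\<dots> \<le> \<eta> * real m * (2 * e)"
        using i' b e0 by (intro mult_right_mono) auto
      also have "\<dots> = 2 * \<eta> * r" using e m0 by simp
      finally have vv: "dist (v i') (v i) \<le> 2 * \<eta> * r" .
      have "cone_point v m p i k - cone_point v m p i' k = (1 - real k / real m) *\<^sub>R (v i - v i')"
        by (simp add: cone_point_def algebra_simps)
      then have "dist (cone_point v m p i k) (cone_point v m p i' k) = (1 - real k / real m) * dist (v i') (v i)"
        using k m0 by (simp add: dist_norm norm_minus_commute)
      also have "\<dots> \<le> 1 * dist (v i') (v i)" by (intro mult_right_mono) auto
      finally have d1: "dist (cone_point v m p i k) (cone_point v m p i' k) \<le> 2 * \<eta> * r" using vv by simp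
      have "cone_point v m p i' k - cone_point v m p i' k' = (real (k - k') / real m) *\<^sub>R (p - v i')"
        using k' by (simp add: cone_point_def of_nat_diff diff_divide_distrib algebra_simps)
      then have "dist (cone_point v m p i' k) (cone_point v m p i' k') = real (k - k') / real m * dist p (v i')"
        by (simp add: dist_norm)
      also have "\<dots> \<le> (\<eta> * real m) / real m * ((1 + K) * r)"
        using k' b pv \<eta> by (intro mult_mono divide_right_mono) auto
      also have "\<dots> = (1 + K) * \<eta> * r" using m0 by simp
      finally have d2: "dist (cone_point v m p i' k) (cone_point v m p i' k') \<le> (1 + K) * \<eta> * r" .
      define P where "P = cone_point v m p i' k'"
      define s where "s = real k' / real m"
      have P: "P = v i' + s *\<^sub>R (p - v i')" by (simp add: P_def cone_point_def s_def)
      have zP: "dist z P < (4 + K) * \<eta> * r"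
        using close d1 d2 dist_triangle[of z P "cone_point v m p i k"]
          dist_triangle[of "cone_point v m p i k" P "cone_point v m p i' k"]
        by (simp add: P_def algebra_simps)
      have "(4 + K) * \<eta> * r \<le> (4 + K) * (c / (2 * (4 + K))) * r"
        using \<eta> K r by (intro mult_right_mono mult_left_mono) auto
      also have "\<dots> = c * r / 2" using K by (simp add: field_simps)
      finally have zP2: "dist z P < c * r / 2" using zP by linarith
      have s0: "0 \<le> s" by (simp add: s_def)
      have "dist P (v i') = s * dist p (v i')" using s0 by (simp add: P dist_norm)
      also have "\<dots> \<le> s * ((1 + K) * r)" using pv s0 by (rule mult_left_mono)
      finally have "c * r < c * r / 2 + s * ((1 + K) * r)"
        using v[of i'] i i' dist_triangle[of z "v i'" P] zP2 by linarith
      moreover have "s * ((1 + K) * r) = s * (1 + K) * r" "c * r = c / 2 * r + c * r / 2" by simp_all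
      ultimately have "c / 2 * r < (s * (1 + K)) * r" by linarith
      then have "c / 2 < s * (1 + K)" by (rule mult_right_less_imp_less) (use r in simp)
      then have s: "\<sigma> < s" using K by (simp add: \<sigma>_def field_simps)
      have "ctr (i div b, k div b) = v i' + (1 / s) *\<^sub>R (z - v i')"
        by (simp only: ctr_def prod.case i'_def k'_def s_def)
      then have "ctr (i div b, k div b) - p = (1 / s) *\<^sub>R (z - P)"
        using s \<sigma> by (simp add: P algebra_simps)
      then have "dist (ctr (i div b, k div b)) p = dist z P / s"
        using s \<sigma> by (simp add: dist_norm)
      also have "\<dots> \<le> (4 + K) * \<eta> * r / s" using zP s \<sigma> by (intro divide_right_mono) auto
      also have "\<dots> < (4 + K) * \<eta> * r / \<sigma>" using s \<sigma> K \<eta> r by (intro divide_strict_left_mono) auto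
      also have "\<dots> = \<kappa> * \<eta> * r" by (simp add: \<kappa>_def)
      finally have "p \<in> ball (ctr (i div b, k div b)) (\<kappa> * \<eta> * r)" by simp
      moreover have "(i div b, k div b) \<in> I" using i k by (simp add: I_def div_le_mono)
      ultimately show ?thesis by (auto simp: Z_def)
    qed
    ultimately show "\<exists>Z. Z \<in> fmeasurable lborel \<and> measure lborel Z \<le> measure lborel (ball x r) / 2 \<and>
      (\<forall>p\<in>ball x r - Z. \<forall>i\<le>M. \<forall>k\<le>m. \<eta> * r \<le> dist z (cone_point v m p i k))"
      using measZ by (intro exI[of _ Z]) (auto simp: not_less[symmetric])
  qed
qed

subsection \<open>Paths in the boundary\<close>

text \<open>The clause on cone points records where the chain lies; through it the clearance of the
  cone from a point passes to the chain.\<close>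

definition surface_chain ::
  "'a::real_normed_vector set \<Rightarrow> real \<Rightarrow> 'a \<Rightarrow> 'a \<Rightarrow> real \<Rightarrow> nat \<Rightarrow> (nat \<Rightarrow> 'a) \<Rightarrow> nat \<Rightarrow> 'a \<Rightarrow> bool" where
  "surface_chain E K x y e N v M p \<longleftrightarrow> (\<exists>l u. real l \<le> K * 2 ^ N \<and>
     (\<forall>i\<le>l. u i \<in> E \<and> (\<exists>j\<le>M. \<exists>k\<le>2 ^ N. dist (u i) (cone_point v (2 ^ N) p j k) \<le> K * e)) \<and>
     (\<forall>i<l. dist (u i) (u (Suc i)) \<le> K * e) \<and> dist x (u 0) \<le> K * e \<and> dist y (u l) \<le> K * e)"

text \<open>The loop is fixed before the exceptional set \<open>Z\<close>, which is to depend on it,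
  and the apex is chosen after both. For quasiconvexity \<open>Z\<close> is empty; for annular
  quasiconvexity it contains the apexes whose cone comes too near the centre.\<close>

lemma discrete_surface_chain:
  fixes \<Omega> :: "'a::euclidean_space set"
  assumes n: "1 \<le> n" and DIM: "DIM('a) = n + 1" and dom: "two_sided_chord_arc_domain n \<Omega>"
  obtains K where "1 \<le> K" "\<And>x y r e N. x \<in> frontier \<Omega> \<Longrightarrow> y \<in> frontier \<Omega> \<Longrightarrow> 0 < r \<Longrightarrow> dist x y = 2 * r \<Longrightarrow>
     e = r / 2 ^ N \<Longrightarrow>
     \<exists>v M. real M \<le> K * 2 ^ N \<and> (\<forall>i<M. dist (v i) (v (Suc i)) \<le> 2 * e) \<and>
       (\<forall>i\<le>M. dist x (v i) \<le> K * r \<and> min (dist x (v i)) (dist y (v i)) \<le> K * infdist (v i) (frontier \<Omega>)) \<and>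
       (\<forall>Z\<in>fmeasurable lborel. measure lborel Z \<le> measure lborel (ball x r) / 2 \<longrightarrow>
         (\<exists>p\<in>ball x r - Z. surface_chain (frontier \<Omega>) K x y e N v M p))"
proof -
  define E where "E = frontier \<Omega>"
  have E: "ADR n E" "closed E"
    using dom by (auto simp: E_def two_sided_chord_arc_domain_def chord_arc_domain_def)
  obtain K0 where K0: "1 \<le> K0" and loop: "\<And>x y r e N. x \<in> E \<Longrightarrow> y \<in> E \<Longrightarrow> 0 < r \<Longrightarrow> dist x y = 2 * r \<Longrightarrow>
     e = r / 2 ^ N \<Longrightarrow>
     \<exists>v M a. Suc a < M \<and> v M = v 0 \<and> (\<forall>i<M. dist (v i) (v (Suc i)) \<le> 2 * e) \<and>
       (\<forall>i\<le>a. v i \<in> \<Omega>) \<and> (\<forall>i. a < i \<longrightarrow> i < M \<longrightarrow> v i \<notin> \<Omega>) \<and> dist x (v 0) \<le> e \<and> dist y (v a) \<le> e \<and>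
       (\<forall>\<mu>\<ge>0. real (card {i. i < M \<and> infdist (v i) E \<le> \<mu>}) \<le> K0 * \<mu> / e) \<and>
       (\<forall>i<M. min (dist x (v i)) (dist y (v i)) \<le> K0 * infdist (v i) E \<and> dist x (v i) \<le> K0 * r)"
    using two_sided_loop[OF dom] unfolding E_def by blast
  obtain C where C: "1 \<le> C" and cover: "\<And>q \<rho> e. 0 < e \<Longrightarrow> e \<le> \<rho> \<Longrightarrow>
    \<exists>F. finite F \<and> real (card F) \<le> C * (\<rho> / e) ^ n \<and> E \<inter> ball q \<rho> \<subseteq> (\<Union>f\<in>F. ball f e)"
    using ADR_cover[OF n E(1)] by blast
  \<comment> \<open>The mesh in units of \<open>e\<close>: for a diagonal, a loop step of at most
    \<open>2 * e\<close> and a step of at most \<open>(1 + K0) * e\<close> towards the apex add up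
    to \<open>b * e\<close>.\<close>
  define b where "b = K0 + 3"
  have b: "0 \<le> b" using K0 by (simp add: b_def)
  define T where "T = K0 * b + K0 * (b + 1 + K0) * (C * (b + 2) ^ (2 * n + 1))"
  have T: "0 < T" using K0 b C by (auto simp: T_def intro!: add_pos_nonneg mult_pos_pos mult_nonneg_nonneg) (simp add: b_def)
  \<comment> \<open>\<open>648 = 162 * 4\<close>: the quadruples of a cell times the loss in
    choosing the apex. \<open>K0 * K0\<close> bounds the number of loop vertices, and the remaining
    terms cover distances.\<close>
  define K where "K = 648 * T + K0 * K0 + K0 + 3 * b + 1"
  have KK: "648 * T \<le> K" "K0 * K0 \<le> K" "K0 \<le> K" "3 * b \<le> K" "b \<le> K" "b + 1 \<le> K" "1 \<le> K"
    using T K0 b by (auto simp: K_def)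
  show ?thesis
  proof (rule that[OF KK(7)])
    fix x y :: 'a and r e :: real and N :: nat
    assume "x \<in> frontier \<Omega>" "y \<in> frontier \<Omega>" and r: "0 < r" and xy: "dist x y = 2 * r" and er: "e = r / 2 ^ N"
    then have x: "x \<in> E" and y: "y \<in> E" by (auto simp: E_def)
    define m :: nat where "m = 2 ^ N"
    have m: "0 < m" "e = r / real m" by (auto simp: m_def er)
    have e: "0 < e" using r m by simp
    obtain v M a where a: "Suc a < M" and per: "v M = v 0"
      and step: "\<And>i. i < M \<Longrightarrow> dist (v i) (v (Suc i)) \<le> 2 * e"
      and inside: "\<And>i. i \<le> a \<Longrightarrow> v i \<in> \<Omega>" and outside: "\<And>i. a < i \<Longrightarrow> i < M \<Longrightarrow> v i \<notin> \<Omega>"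
      and ends: "dist x (v 0) \<le> e" "dist y (v a) \<le> e"
      and count: "\<And>\<mu>. 0 \<le> \<mu> \<Longrightarrow> real (card {i. i < M \<and> infdist (v i) E \<le> \<mu>}) \<le> K0 * \<mu> / e"
      and near: "\<And>i. i < M \<Longrightarrow> min (dist x (v i)) (dist y (v i)) \<le> K0 * infdist (v i) E \<and> dist x (v i) \<le> K0 * r"
      using loop[OF x y r xy er] by blast
    have near': "min (dist x (v i)) (dist y (v i)) \<le> K0 * infdist (v i) E \<and> dist x (v i) \<le> K0 * r" if "i \<le> M" for i
      using near[of i] near[of 0] a per that by (cases "i = M") auto
    \<comment> \<open>At \<open>\<mu> = K0 * r\<close> the count covers the whole loop, since all
      its vertices lie within this distance of \<open>x\<close>, a point of
      \<open>E\<close>.\<close>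
    have M: "real M \<le> K0 * K0 * 2 ^ N"
    proof -
      have "infdist (v i) E \<le> K0 * r" if "i < M" for i
        using infdist_le[OF x, of "v i"] near[OF that] by (simp add: dist_commute)
      then have "{i. i < M \<and> infdist (v i) E \<le> K0 * r} = {..<M}" by auto
      then have "real M \<le> K0 * (K0 * r) / e" using count[of "K0 * r"] K0 r by simp
      also have "\<dots> = K0 * K0 * 2 ^ N" using r by (simp add: er)
      finally show ?thesis .
    qed
    have chain: "\<exists>p\<in>ball x r - Z. surface_chain E K x y e N v M p"
      if Z: "Z \<in> fmeasurable lborel" "measure lborel Z \<le> measure lborel (ball x r) / 2" for Z
    proof -
      define A where "A = (\<lambda>(i, k). {p \<in> ball x r. infdist (cone_point v m p i k) E \<le> b * e})"
      define J where "J = {..<M} \<times> {..m}"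
      have sumA: "(\<Sum>j\<in>J. measure lborel (A j)) \<le> T * real m * measure lborel (ball x r)"
      proof -
        have "(\<Sum>(i, k)\<in>{..<M} \<times> {..m}. measure lborel {p \<in> ball x r. infdist (cone_point v m p i k) E \<le> b * e})
            \<le> T * real m * measure lborel (ball x r)"
          unfolding T_def using x C K0 near
          by (intro cone_total_measure[OF DIM E(2) _ _ cover e m(2,1) b _ count]) auto
        moreover have "(\<Sum>j\<in>J. measure lborel (A j)) = (\<Sum>(i, k)\<in>{..<M} \<times> {..m}. measure lborel {p \<in> ball x r. infdist (cone_point v m p i k) E \<le> b * e})"
          unfolding J_def A_def by (intro sum.cong) auto
        ultimately show ?thesis by simp
      qed
      have setsA: "A j \<in> sets lborel" for j
      proof -
        have "closed {p. infdist (cone_point v m p i k) E \<le> b * e}" for i k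
          unfolding cone_point_def by (intro closed_Collect_le continuous_intros)
        then have "ball x r \<inter> {p. infdist (cone_point v m p i k) E \<le> b * e} \<in> sets lborel" for i k by auto
        then show ?thesis by (cases j) (simp add: A_def Int_def)
      qed
      obtain p where p: "p \<in> ball x r - Z" "real (card {j \<in> J. p \<in> A j}) \<le> 4 * (T * real m)"
      proof (rule exists_low_multiplicity_point[of J A x r "T * real m" Z])
        show "finite J" by (simp add: J_def)
        show "A j \<subseteq> ball x r" for j by (cases j) (auto simp: A_def)
      qed (use r T m Z sumA setsA in auto)
      let ?P = "cone_point v m p"
      have h: "dist (?P i k) (?P (Suc i) k) \<le> 2 * e" if "i < M" "k \<le> m" for i k
      proof -
        have "?P i k - ?P (Suc i) k = (1 - real k / real m) *\<^sub>R (v i - v (Suc i))"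
          by (simp add: cone_point_def algebra_simps)
        then have "dist (?P i k) (?P (Suc i) k) = (1 - real k / real m) * dist (v i) (v (Suc i))"
          using that m by (simp add: dist_norm)
        also have "\<dots> \<le> 1 * dist (v i) (v (Suc i))" by (intro mult_right_mono) auto
        finally show ?thesis using step[OF that(1)] by simp
      qed
      have vert: "dist (?P i k) (?P i (Suc k)) \<le> (1 + K0) * e" if "i \<le> M" "k < m" for i k
      proof -
        have "?P i (Suc k) - ?P i k = (real (Suc k) / real m - real k / real m) *\<^sub>R (p - v i)"
          by (simp add: cone_point_def scaleR_left_diff_distrib)
        also have "real (Suc k) / real m - real k / real m = 1 / real m" by (simp add: add_divide_distrib)
        finally have "dist (?P i k) (?P i (Suc k)) = dist p (v i) / real m"
          by (simp add: dist_norm norm_minus_commute[of "?P i k"])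
        also have "\<dots> \<le> (1 + K0) * r / real m"
          using dist_triangle[of p "v i" x] p near'[OF that(1)] by (intro divide_right_mono) (auto simp: dist_commute algebra_simps)
        finally show ?thesis by (simp add: m)
      qed
      have be: "2 * e \<le> b * e" "(1 + K0) * e \<le> b * e" "2 * e + (1 + K0) * e = b * e"
        using e K0 by (auto simp: b_def algebra_simps)
      have diag: "dist (?P i k) (?P (Suc i) (Suc k)) \<le> b * e" if "i < M" "k < m" for i k
        using dist_triangle[of "?P i k" "?P (Suc i) (Suc k)" "?P (Suc i) k"] h[of i k] vert[of "Suc i" k] that be(3)
        by simp
      have base: "?P i 0 = v i" and top: "?P i m = p" for i using m by (auto simp: cone_point_def)
      obtain l u where lu:
        "l \<le> 162 * card {(i, k). i < M \<and> k \<le> m \<and> infdist (?P i k) (frontier \<Omega>) \<le> b * e}"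
        "\<And>i. i \<le> l \<Longrightarrow> u i \<in> frontier \<Omega> \<and> (\<exists>j\<le>M. \<exists>k\<le>m. dist (u i) (?P j k) \<le> b * e)"
        "\<And>i. i < l \<Longrightarrow> dist (u i) (u (Suc i)) \<le> 3 * (b * e)"
        "dist (u 0) (?P 0 0) \<le> b * e" "dist (u l) (?P a 0) \<le> b * e"
      proof (rule grid_frontier_chain[of m ?P M p "b * e" a \<Omega>])
        show "?P M k = ?P 0 k" for k using per by (simp add: cone_point_def)
        show "dist (?P i k) (?P (Suc i) k) \<le> b * e" if "i < M" "k \<le> m" for i k using h[OF that] be by linarith
        show "dist (?P i k) (?P i (Suc k)) \<le> b * e" if "i \<le> M" "k < m" for i k using vert[OF that] be by linarith
      qed (use m top base a inside outside diag in auto)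
      have "{(i, k). i < M \<and> k \<le> m \<and> infdist (?P i k) (frontier \<Omega>) \<le> b * e} = {j \<in> J. p \<in> A j}"
        using p(1) by (auto simp: J_def A_def E_def)
      then have "l \<le> 162 * card {j \<in> J. p \<in> A j}" using lu(1) by (simp only:)
      then have "real l \<le> 162 * real (card {j \<in> J. p \<in> A j})"
        using of_nat_mono[of l "162 * card {j \<in> J. p \<in> A j}"] by simp
      also have "\<dots> \<le> 162 * (4 * (T * real m))" using p(2) by (rule mult_left_mono) simp
      also have "\<dots> = 648 * T * 2 ^ N" by (simp add: m_def)
      also have "\<dots> \<le> K * 2 ^ N" using KK by (intro mult_right_mono) auto
      finally have len: "real l \<le> K * 2 ^ N" .
      have Ke: "b * e \<le> K * e" "3 * b * e \<le> K * e" "(b + 1) * e \<le> K * e"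
        using KK e by (auto intro!: mult_right_mono)
      have "dist x (u 0) \<le> (b + 1) * e" "dist y (u l) \<le> (b + 1) * e"
        using lu(4,5) ends dist_triangle[of x "u 0" "v 0"] dist_triangle[of y "u l" "v a"]
        by (auto simp: base dist_commute algebra_simps)
      then have "dist x (u 0) \<le> K * e" "dist y (u l) \<le> K * e" using Ke by linarith+
      moreover have "dist (u i) (u (Suc i)) \<le> K * e" if "i < l" for i using lu(3)[OF that] Ke by linarith
      moreover have "u i \<in> E \<and> (\<exists>j\<le>M. \<exists>k\<le>2 ^ N. dist (u i) (cone_point v (2 ^ N) p j k) \<le> K * e)" if "i \<le> l" for i
        using lu(2)[OF that] Ke(1) unfolding m_def E_def by (meson order_trans)
      ultimately have "surface_chain E K x y e N v M p"
        unfolding surface_chain_def using len by blast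
      then show ?thesis using p(1) by blast
    qed
    have KM: "K0 * K0 * 2 ^ N \<le> K * 2 ^ N" "K0 * r \<le> K * r" "K0 * infdist (v i) E \<le> K * infdist (v i) E" for i
      using KK r by (auto intro!: mult_right_mono simp: infdist_nonneg)
    have "real M \<le> K * 2 ^ N" using M KM(1) by linarith
    moreover have "dist x (v i) \<le> K * r \<and> min (dist x (v i)) (dist y (v i)) \<le> K * infdist (v i) E" if "i \<le> M" for i
      using near'[OF that] KM(2) KM(3)[of i] by linarith
    ultimately show "\<exists>v M. real M \<le> K * 2 ^ N \<and> (\<forall>i<M. dist (v i) (v (Suc i)) \<le> 2 * e) \<and>
       (\<forall>i\<le>M. dist x (v i) \<le> K * r \<and> min (dist x (v i)) (dist y (v i)) \<le> K * infdist (v i) (frontier \<Omega>)) \<and>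
       (\<forall>Z\<in>fmeasurable lborel. measure lborel Z \<le> measure lborel (ball x r) / 2 \<longrightarrow>
         (\<exists>p\<in>ball x r - Z. surface_chain (frontier \<Omega>) K x y e N v M p))"
      using step chain unfolding E_def by (intro exI[of _ v] exI[of _ M] conjI allI impI ballI) auto
  qed
qed

section \<open>Limit paths in the boundary, without and with a forbidden ball\<close>

lemma dist_pathstart_le_path_length:
  assumes "t \<in> {0..1}"
  shows "ennreal (dist (g 0) (g t)) \<le> path_length g"
proof -
  define s where "s i = (if i = 0 then 0 else t)" for i :: nat
  have "mono s" "range s \<subseteq> {0..1}" using assms by (auto simp: s_def mono_def)
  then show ?thesis
    unfolding path_length_def by (intro SUP_upper2[of "(1, s)"]) (auto simp: s_def)
qed

text \<open>At most \<open>K * 2 ^ N\<close> steps of size \<open>K * (r / 2 ^ N)\<close> have total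
  length at most \<open>K * K * r\<close>, a bound independent of \<open>N\<close> as the passage to
  the limit demands.\<close>

lemma two_sided_path:
  fixes \<Omega> :: "'a::euclidean_space set"
  assumes n: "1 \<le> n" and DIM: "DIM('a) = n + 1" and dom: "two_sided_chord_arc_domain n \<Omega>"
  obtains K where "1 \<le> K" "\<And>x y. x \<in> frontier \<Omega> \<Longrightarrow> y \<in> frontier \<Omega> \<Longrightarrow>
     \<exists>g. path g \<and> path_image g \<subseteq> frontier \<Omega> \<and> pathstart g = x \<and> pathfinish g = y \<and>
       path_length g \<le> ennreal (K * dist x y)"
proof -
  obtain K where K: "1 \<le> K" and chain: "\<And>x y r e N. x \<in> frontier \<Omega> \<Longrightarrow> y \<in> frontier \<Omega> \<Longrightarrow> 0 < r \<Longrightarrow> dist x y = 2 * r \<Longrightarrow>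
     e = r / 2 ^ N \<Longrightarrow>
     \<exists>v M. real M \<le> K * 2 ^ N \<and> (\<forall>i<M. dist (v i) (v (Suc i)) \<le> 2 * e) \<and>
       (\<forall>i\<le>M. dist x (v i) \<le> K * r \<and> min (dist x (v i)) (dist y (v i)) \<le> K * infdist (v i) (frontier \<Omega>)) \<and>
       (\<forall>Z\<in>fmeasurable lborel. measure lborel Z \<le> measure lborel (ball x r) / 2 \<longrightarrow>
         (\<exists>p\<in>ball x r - Z. surface_chain (frontier \<Omega>) K x y e N v M p))"
    using discrete_surface_chain[OF assms] by blast
  show ?thesis
  proof (rule that[of "K * K"])
    show "1 \<le> K * K" using mult_mono[OF K K] K by simp
    fix x y assume x: "x \<in> frontier \<Omega>" and y: "y \<in> frontier \<Omega>"
    show "\<exists>g. path g \<and> path_image g \<subseteq> frontier \<Omega> \<and> pathstart g = x \<and> pathfinish g = y \<and>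
       path_length g \<le> ennreal (K * K * dist x y)"
    proof (cases "x = y")
      case True
      then show ?thesis
        using x path_length_le_Lipschitz[of 0 "\<lambda>_. x"]
        by (intro exI[of _ "\<lambda>_. x"]) (auto simp: path_def path_image_def pathstart_def pathfinish_def)
    next
      case False
      define r where "r = dist x y / 2"
      have r: "0 < r" "dist x y = 2 * r" using False by (auto simp: r_def)
      have "\<exists>l u. real l \<le> K * 2 ^ N \<and> (\<forall>i\<le>l. u i \<in> frontier \<Omega>) \<and>
          (\<forall>i<l. dist (u i) (u (Suc i)) \<le> K * (r / 2 ^ N)) \<and> dist x (u 0) \<le> K * (r / 2 ^ N) \<and> dist y (u l) \<le> K * (r / 2 ^ N)" for N
      proof -
        obtain v :: "nat \<Rightarrow> 'a" and M where "\<forall>Z\<in>fmeasurable lborel. measure lborel Z \<le> measure lborel (ball x r) / 2 \<longrightarrow>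
            (\<exists>p\<in>ball x r - Z. surface_chain (frontier \<Omega>) K x y (r / 2 ^ N) N v M p)"
          using chain[OF x y r refl, of N] by (elim exE conjE) (rule that)
        from bspec[OF this, of "{}"] obtain p where "surface_chain (frontier \<Omega>) K x y (r / 2 ^ N) N v M p" by auto
        then show ?thesis unfolding surface_chain_def by blast
      qed
      then obtain l u where lu: "\<And>N. real (l N) \<le> K * 2 ^ N" "\<And>N i. i \<le> l N \<Longrightarrow> u N i \<in> frontier \<Omega>"
          "\<And>N i. i < l N \<Longrightarrow> dist (u N i) (u N (Suc i)) \<le> K * (r / 2 ^ N)"
          "\<And>N. dist x (u N 0) \<le> K * (r / 2 ^ N)" "\<And>N. dist y (u N (l N)) \<le> K * (r / 2 ^ N)"
        by metis
      have e0: "(\<lambda>N. K * (r / 2 ^ N)) \<longlonglongrightarrow> 0"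
        by (auto intro!: tendsto_eq_intros LIMSEQ_divide_realpow_zero)
      have len: "real (l N) * (K * (r / 2 ^ N)) \<le> K * K * r" for N
      proof -
        have "real (l N) * (K * (r / 2 ^ N)) \<le> K * 2 ^ N * (K * (r / 2 ^ N))"
          using lu(1) K r by (intro mult_right_mono) auto
        then show ?thesis by (simp add: algebra_simps)
      qed
      have Kr: "\<bar>K * r\<bar> = K * r" using K r by simp
      have ends: "(\<lambda>N. u N 0) \<longlonglongrightarrow> x" "(\<lambda>N. u N (l N)) \<longlonglongrightarrow> y"
        using lu(4,5) by (auto intro!: metric_tendsto_imp_tendsto[OF e0] eventuallyI simp: dist_commute Kr)
      obtain g where g: "path g" "path_image g \<subseteq> frontier \<Omega>" "pathstart g = x" "pathfinish g = y"
        "path_length g \<le> ennreal (K * K * r)"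
        by (rule chains_to_path[where S = "frontier \<Omega>" and e = "\<lambda>N. K * (r / 2 ^ N)" and L = "K * K * r"
              and l = l and u = u and x = x and y = y, OF frontier_closed e0 _ _ lu(3) len lu(2) ends])
          (use K r in auto)
      moreover have "ennreal (K * K * r) \<le> ennreal (K * K * dist x y)"
        using r K by (intro ennreal_leI mult_left_mono) auto
      ultimately show ?thesis by (blast intro: order_trans)
    qed
  qed
qed

text \<open>The forbidden radius is proportional to \<open>dist x y\<close>, the size of the cone,
  and not to \<open>R\<close>. The distance of \<open>x\<close> and \<open>y\<close> from
  \<open>z\<close> enters through the loop: as \<open>z\<close> is a boundary point, a loop vertex
  near \<open>z\<close> would by the cigar bound be near \<open>x\<close> or
  \<open>y\<close>.\<close>

lemma two_sided_annular_path:
  fixes \<Omega> :: "'a::euclidean_space set"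
  assumes n: "2 \<le> n" and DIM: "DIM('a) = n + 1" and dom: "two_sided_chord_arc_domain n \<Omega>"
  obtains K \<eta> where "1 \<le> K" "0 < \<eta>" "\<And>x y z R. x \<in> frontier \<Omega> \<Longrightarrow> y \<in> frontier \<Omega> \<Longrightarrow> z \<in> frontier \<Omega> \<Longrightarrow>
     x \<noteq> y \<Longrightarrow> 0 < R \<Longrightarrow> R \<le> dist z x \<Longrightarrow> R \<le> dist z y \<Longrightarrow> dist x y \<le> 4 * R \<Longrightarrow>
     \<exists>g. path g \<and> path_image g \<subseteq> frontier \<Omega> - ball z (\<eta> * dist x y) \<and> pathstart g = x \<and> pathfinish g = y \<and>
       path_length g \<le> ennreal (K * dist x y)"
proof -
  have n1: "1 \<le> n" using n by simp
  obtain K where K: "1 \<le> K" and chain: "\<And>x y r e N. x \<in> frontier \<Omega> \<Longrightarrow> y \<in> frontier \<Omega> \<Longrightarrow> 0 < r \<Longrightarrow> dist x y = 2 * r \<Longrightarrow>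
     e = r / 2 ^ N \<Longrightarrow>
     \<exists>v M. real M \<le> K * 2 ^ N \<and> (\<forall>i<M. dist (v i) (v (Suc i)) \<le> 2 * e) \<and>
       (\<forall>i\<le>M. dist x (v i) \<le> K * r \<and> min (dist x (v i)) (dist y (v i)) \<le> K * infdist (v i) (frontier \<Omega>)) \<and>
       (\<forall>Z\<in>fmeasurable lborel. measure lborel Z \<le> measure lborel (ball x r) / 2 \<longrightarrow>
         (\<exists>p\<in>ball x r - Z. surface_chain (frontier \<Omega>) K x y e N v M p))"
    using discrete_surface_chain[OF n1 DIM dom] by blast
  \<comment> \<open>The value comes from \<open>R \<le> (1 + K) * dist z (v i)\<close> and
    \<open>r \<le> 2 * R\<close>.\<close>
  define c where "c = 1 / (2 * (1 + K))"
  have c: "0 < c" "c \<le> 1" using K by (auto simp: c_def)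
  have "3 \<le> DIM('a)" using n DIM by simp
  then obtain \<eta> where \<eta>: "0 < \<eta>" and avoid: "\<And>v M m x z r e. 0 < r \<Longrightarrow> e = r / real m \<Longrightarrow> 1 \<le> \<eta> * real m \<Longrightarrow> real M \<le> K * real m \<Longrightarrow>
    (\<And>i. i < M \<Longrightarrow> dist (v i) (v (Suc i)) \<le> 2 * e) \<Longrightarrow>
    (\<And>i. i \<le> M \<Longrightarrow> dist x (v i) \<le> K * r \<and> c * r \<le> dist z (v i)) \<Longrightarrow>
    \<exists>Z. Z \<in> fmeasurable lborel \<and> measure lborel Z \<le> measure lborel (ball x r) / 2 \<and>
      (\<forall>p\<in>ball x r - Z. \<forall>i\<le>M. \<forall>k\<le>m. \<eta> * r \<le> dist (z :: 'a) (cone_point v m p i k))"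
    using cone_avoids_ball[OF _ K c] by blast
  \<comment> \<open>Scales start at \<open>N0\<close>, so that the error \<open>K * e\<close>
    between chain and cone is at most half of the clearance \<open>\<eta> * r\<close> and
    \<open>1 \<le> \<eta> * real m\<close> holds.\<close>
  obtain N0 :: nat where N0: "2 * K / \<eta> < 2 ^ N0"
    using real_arch_pow[of 2 "2 * K / \<eta>"] by auto
  show ?thesis
  proof (rule that[of "K * K" "\<eta> / 4"])
    show "1 \<le> K * K" using mult_mono[OF K K] K by simp
    show "0 < \<eta> / 4" using \<eta> by simp
    fix x y z R
    assume x: "x \<in> frontier \<Omega>" and y: "y \<in> frontier \<Omega>" and z: "z \<in> frontier \<Omega>" and ne: "x \<noteq> y"
      and R: "0 < R" "R \<le> dist z x" "R \<le> dist z y" "dist x y \<le> 4 * R"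
    define r where "r = dist x y / 2"
    have r: "0 < r" "dist x y = 2 * r" "r \<le> 2 * R" using ne R by (auto simp: r_def)
    have "\<exists>l u. real l \<le> K * 2 ^ (N + N0) \<and> (\<forall>i\<le>l. u i \<in> frontier \<Omega> - ball z (\<eta> * r / 2)) \<and>
        (\<forall>i<l. dist (u i) (u (Suc i)) \<le> K * (r / 2 ^ (N + N0))) \<and> dist x (u 0) \<le> K * (r / 2 ^ (N + N0)) \<and>
        dist y (u l) \<le> K * (r / 2 ^ (N + N0))" for N
    proof -
      define m :: nat where "m = 2 ^ (N + N0)"
      define e where "e = r / 2 ^ (N + N0)"
      have "(2::real) ^ N0 \<le> 2 ^ (N + N0)" by (intro power_increasing) auto
      then have big: "2 * K / \<eta> < 2 ^ (N + N0)" using N0 by linarith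
      then have m2: "2 * K < \<eta> * real m" using \<eta> by (simp add: m_def field_simps)
      have m: "e = r / real m" "1 \<le> \<eta> * real m" using m2 K by (auto simp: m_def e_def)
      obtain v M where vM: "real M \<le> K * 2 ^ (N + N0)" "\<forall>i<M. dist (v i) (v (Suc i)) \<le> 2 * e"
         "\<forall>i\<le>M. dist x (v i) \<le> K * r \<and> min (dist x (v i)) (dist y (v i)) \<le> K * infdist (v i) (frontier \<Omega>)"
         "\<forall>Z\<in>fmeasurable lborel. measure lborel Z \<le> measure lborel (ball x r) / 2 \<longrightarrow>
           (\<exists>p\<in>ball x r - Z. surface_chain (frontier \<Omega>) K x y e (N + N0) v M p)"
        using chain[OF x y r(1,2) e_def] by (elim exE conjE) (rule that)
      have v: "real M \<le> K * 2 ^ (N + N0)" "\<And>i. i < M \<Longrightarrow> dist (v i) (v (Suc i)) \<le> 2 * e"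
         "\<And>i. i \<le> M \<Longrightarrow> dist x (v i) \<le> K * r \<and> min (dist x (v i)) (dist y (v i)) \<le> K * infdist (v i) (frontier \<Omega>)"
        using vM(1-3) by auto
      have far: "c * r \<le> dist z (v i)" if "i \<le> M" for i
      proof -
        have "infdist (v i) (frontier \<Omega>) \<le> dist z (v i)" using infdist_le[OF z, of "v i"] by (simp add: dist_commute)
        then have "K * infdist (v i) (frontier \<Omega>) \<le> K * dist z (v i)" using K by (intro mult_left_mono) auto
        then have near: "min (dist x (v i)) (dist y (v i)) \<le> K * dist z (v i)" using v(3)[OF that] by linarith
        have "R \<le> dist z (v i) + min (dist x (v i)) (dist y (v i))"
          using R dist_triangle[of z x "v i"] dist_triangle[of z y "v i"] by (auto simp: min_def dist_commute)
        also have "\<dots> \<le> dist z (v i) + K * dist z (v i)" using near by (rule add_left_mono)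
        finally have "2 * R \<le> 2 * (dist z (v i) + K * dist z (v i))" by (rule mult_left_mono) simp
        with r(3) have "r \<le> 2 * (dist z (v i) + K * dist z (v i))" by (rule order_trans)
        then show ?thesis using K by (simp add: c_def field_simps)
      qed
      obtain Z where Z: "Z \<in> fmeasurable lborel" "measure lborel Z \<le> measure lborel (ball x r) / 2"
        and Zfar: "\<And>p i k. p \<in> ball x r - Z \<Longrightarrow> i \<le> M \<Longrightarrow> k \<le> m \<Longrightarrow> \<eta> * r \<le> dist z (cone_point v m p i k)"
        using avoid[OF r(1) m(1,2), of M v x z] v far by (auto simp: m_def)
      obtain p l u where p: "p \<in> ball x r - Z" and l: "real l \<le> K * 2 ^ (N + N0)"
        and u: "\<And>i. i \<le> l \<Longrightarrow> u i \<in> frontier \<Omega> \<and> (\<exists>j\<le>M. \<exists>k\<le>2 ^ (N + N0). dist (u i) (cone_point v (2 ^ (N + N0)) p j k) \<le> K * e)"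
         "\<And>i. i < l \<Longrightarrow> dist (u i) (u (Suc i)) \<le> K * e" "dist x (u 0) \<le> K * e" "dist y (u l) \<le> K * e"
      proof -
        obtain p where "p \<in> ball x r - Z" "surface_chain (frontier \<Omega>) K x y e (N + N0) v M p"
          using vM(4) Z by blast
        then show ?thesis using that unfolding surface_chain_def by blast
      qed
      have Ke: "K * e \<le> \<eta> * r / 2"
      proof -
        have "K * e = 2 * K * r / (2 * real m)" using m by simp
        also have "\<dots> \<le> \<eta> * real m * r / (2 * real m)"
          using m2 r by (intro divide_right_mono mult_right_mono) auto
        also have "\<dots> = \<eta> * r / 2" using m by (cases "m = 0") auto
        finally show ?thesis .
      qed
      have "u i \<in> frontier \<Omega> - ball z (\<eta> * r / 2)" if "i \<le> l" for i
      proof -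
        obtain j k where jk: "j \<le> M" "k \<le> m" "dist (u i) (cone_point v m p j k) \<le> K * e" 
          using u(1)[OF \<open>i \<le> l\<close>] unfolding m_def by blast
        have "\<eta> * r \<le> dist z (cone_point v m p j k)" by (rule Zfar[OF p jk(1,2)])
        then show ?thesis
          using jk(3) Ke u(1)[OF that] dist_triangle[of z "cone_point v m p j k" "u i"] by auto
      qed
      then show ?thesis using l u(2-4) unfolding e_def by blast
    qed
    then obtain l u where lu: "\<And>N. real (l N) \<le> K * 2 ^ (N + N0)" "\<And>N i. i \<le> l N \<Longrightarrow> u N i \<in> frontier \<Omega> - ball z (\<eta> * r / 2)"
        "\<And>N i. i < l N \<Longrightarrow> dist (u N i) (u N (Suc i)) \<le> K * (r / 2 ^ (N + N0))"
        "\<And>N. dist x (u N 0) \<le> K * (r / 2 ^ (N + N0))" "\<And>N. dist y (u N (l N)) \<le> K * (r / 2 ^ (N + N0))"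
      by metis
    have "(\<lambda>N. K * (r / 2 ^ N)) \<longlonglongrightarrow> 0"
      by (auto intro!: tendsto_eq_intros LIMSEQ_divide_realpow_zero)
    then have e0: "(\<lambda>N. K * (r / 2 ^ (N + N0))) \<longlonglongrightarrow> 0" by (rule LIMSEQ_ignore_initial_segment)
    have len: "real (l N) * (K * (r / 2 ^ (N + N0))) \<le> K * K * r" for N
    proof -
      have "real (l N) * (K * (r / 2 ^ (N + N0))) \<le> K * 2 ^ (N + N0) * (K * (r / 2 ^ (N + N0)))"
        using lu(1) K r by (intro mult_right_mono) auto
      then show ?thesis by (simp add: algebra_simps)
    qed
    have Kr: "\<bar>K * r\<bar> = K * r" using K r by simp
    have cl: "closed (frontier \<Omega> - ball z (\<eta> * r / 2))" by (intro closed_Diff) auto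
    have ends: "(\<lambda>N. u N 0) \<longlonglongrightarrow> x" "(\<lambda>N. u N (l N)) \<longlonglongrightarrow> y"
      using lu(4,5) by (auto intro!: metric_tendsto_imp_tendsto[OF e0] eventuallyI simp: dist_commute Kr)
    obtain g where g: "path g" "path_image g \<subseteq> frontier \<Omega> - ball z (\<eta> * r / 2)" "pathstart g = x" "pathfinish g = y"
      "path_length g \<le> ennreal (K * K * r)"
      by (rule chains_to_path[where S = "frontier \<Omega> - ball z (\<eta> * r / 2)" and e = "\<lambda>N. K * (r / 2 ^ (N + N0))"
            and L = "K * K * r" and l = l and u = u and x = x and y = y, OF cl e0 _ _ lu(3) len lu(2) ends])
        (use K r in auto)
    moreover have "ennreal (K * K * r) \<le> ennreal (K * K * dist x y)"
      using r K by (intro ennreal_leI mult_left_mono) auto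
    moreover have "\<eta> * r / 2 = \<eta> / 4 * dist x y" by (simp add: r_def)
    ultimately show "\<exists>g. path g \<and> path_image g \<subseteq> frontier \<Omega> - ball z (\<eta> / 4 * dist x y) \<and> pathstart g = x \<and> pathfinish g = y \<and>
       path_length g \<le> ennreal (K * K * dist x y)"
      by (metis order_trans)
  qed
qed

theorem corollary1p9:
  fixes \<Omega> :: "(real ^ 'm) set" and n :: nat
  assumes "1 \<le> n" and "CARD('m) = n + 1"
    and "two_sided_chord_arc_domain n \<Omega>"
  shows "(n = 1 \<longrightarrow> quasiconvex (frontier \<Omega>)) \<and>
         (n > 1 \<longrightarrow> annularly_quasiconvex (frontier \<Omega>))"
proof -
  have DIM: "DIM(real ^ 'm) = n + 1" using assms(2) by simp
  obtain Q where Q: "1 \<le> Q" and quasi: "\<And>x y. x \<in> frontier \<Omega> \<Longrightarrow> y \<in> frontier \<Omega> \<Longrightarrow>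
     \<exists>g. path g \<and> path_image g \<subseteq> frontier \<Omega> \<and> pathstart g = x \<and> pathfinish g = y \<and>
       path_length g \<le> ennreal (Q * dist x y)"
    using two_sided_path[OF assms(1) DIM assms(3)] by blast
  have inball: "dist x q \<le> L"
    if g: "path_length g \<le> ennreal L" "pathstart g = x" "q \<in> path_image g" "0 \<le> L" for g x q and L :: real
  proof -
    obtain t where t: "t \<in> {0..1}" "q = g t" using g(3) by (auto simp: path_image_def)
    have "ennreal (dist (g 0) (g t)) \<le> ennreal L"
      using dist_pathstart_le_path_length[OF t(1)] g(1) by (rule order_trans)
    then show ?thesis using g(2,4) t(2) by (simp add: ennreal_le_iff pathstart_def)
  qed
  have "quasiconvex (frontier \<Omega>)" unfolding quasiconvex_def using Q quasi by blast
  moreover have "annularly_quasiconvex (frontier \<Omega>)" if "1 < n"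
  proof -
    have "2 \<le> n" using that by simp
    then obtain K \<eta> where K: "1 \<le> K" and \<eta>: "0 < \<eta>" and ann: "\<And>x y z R. x \<in> frontier \<Omega> \<Longrightarrow> y \<in> frontier \<Omega> \<Longrightarrow> z \<in> frontier \<Omega> \<Longrightarrow>
     x \<noteq> y \<Longrightarrow> 0 < R \<Longrightarrow> R \<le> dist z x \<Longrightarrow> R \<le> dist z y \<Longrightarrow> dist x y \<le> 4 * R \<Longrightarrow>
     \<exists>g. path g \<and> path_image g \<subseteq> frontier \<Omega> - ball z (\<eta> * dist x y) \<and> pathstart g = x \<and> pathfinish g = y \<and>
       path_length g \<le> ennreal (K * dist x y)"
      using two_sided_annular_path[OF _ DIM assms(3)] by blast
    \<comment> \<open>\<open>2 + 4 * K\<close> is for the outer radius;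
      \<open>2 * Q / \<eta>\<close> is for the inner radius when \<open>dist x y\<close> exceeds
      \<open>R / (2 * Q)\<close>.\<close>
    define C where "C = Q + 3 + 4 * K + 2 * Q / \<eta>"
    have C: "1 \<le> C" "Q \<le> C" "K \<le> C" "3 \<le> C" "2 + 4 * K < C" "2 * Q / \<eta> \<le> C"
    proof -
      have "0 \<le> 2 * Q / \<eta>" using Q \<eta> by simp
      then show "1 \<le> C" "Q \<le> C" "K \<le> C" "3 \<le> C" "2 + 4 * K < C" "2 * Q / \<eta> \<le> C"
        using Q K unfolding C_def by linarith+
    qed
    have "\<exists>\<gamma>. path \<gamma> \<and> path_image \<gamma> \<subseteq> frontier \<Omega> \<inter> (ball z (C * R) - ball z (R / C)) \<and>
               pathstart \<gamma> = x \<and> pathfinish \<gamma> = y \<and> path_length \<gamma> \<le> ennreal (C * dist x y)"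
      if z: "z \<in> frontier \<Omega>" and R: "0 < R" and x: "x \<in> frontier \<Omega> \<inter> (ball z (2 * R) - ball z R)"
        and y: "y \<in> frontier \<Omega> \<inter> (ball z (2 * R) - ball z R)" for x y z R
    \<comment> \<open>If \<open>x\<close> and \<open>y\<close> are close, the path from
      quasiconvexity stays within \<open>R / 2\<close> of \<open>x\<close> and cannot reach the
      inner ball. Otherwise \<open>dist x y\<close> is comparable with \<open>R\<close>, and so is
      the forbidden radius \<open>\<eta> * dist x y\<close>.\<close>
    proof (cases "Q * dist x y \<le> R / 2")
      case True
      obtain g where g: "path g" "path_image g \<subseteq> frontier \<Omega>" "pathstart g = x" "pathfinish g = y"
        "path_length g \<le> ennreal (Q * dist x y)" using quasi x y by blast
      have "q \<in> ball z (C * R) - ball z (R / C)" if "q \<in> path_image g" for q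
      proof -
        have "dist x q \<le> Q * dist x y" using inball[OF g(5,3) that] Q by simp
        then have xq: "dist x q \<le> R / 2" using True by linarith
        have "dist z q < 3 * R" using xq x R dist_triangle[of z q x] by auto
        also have "3 * R \<le> C * R" using C R by (intro mult_right_mono) auto
        finally have "dist z q < C * R" .
        moreover have "R / C \<le> R / 2" using C R by (intro divide_left_mono) auto
        moreover have "R / 2 \<le> dist z q" using xq x dist_triangle[of z x q] by (auto simp: dist_commute)
        ultimately have "dist z q < C * R" "R / C \<le> dist z q" by linarith+
        then show ?thesis by simp
      qed
      moreover have "ennreal (Q * dist x y) \<le> ennreal (C * dist x y)"
        using C by (intro ennreal_leI mult_right_mono) auto
      ultimately show ?thesis using g by (intro exI[of _ g]) auto
    next
      case False
      then have ne: "x \<noteq> y" using R by auto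
      have d4: "dist x y \<le> 4 * R" using x y dist_triangle3[of x y z] by auto
      obtain g where g: "path g" "path_image g \<subseteq> frontier \<Omega> - ball z (\<eta> * dist x y)" "pathstart g = x" "pathfinish g = y"
        "path_length g \<le> ennreal (K * dist x y)" using ann[of x y z R] x y z ne R d4 by auto
      have "q \<in> ball z (C * R) - ball z (R / C)" if "q \<in> path_image g" for q
      proof -
        have "dist x q \<le> K * dist x y" using inball[OF g(5,3) that] K by simp
        also have "\<dots> \<le> K * (4 * R)" using d4 K by (intro mult_left_mono) auto
        finally have "dist z q < (2 + 4 * K) * R" using x dist_triangle[of z q x] by (auto simp: algebra_simps)
        also have "\<dots> \<le> C * R" using C R by (intro mult_right_mono) auto
        finally have "dist z q < C * R" .
        moreover have "R / C \<le> R / (2 * Q / \<eta>)" using C R Q \<eta> by (intro divide_left_mono) auto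
        moreover have "R / (2 * Q / \<eta>) \<le> \<eta> * dist x y" using False Q \<eta> by (simp add: field_simps)
        moreover have "\<eta> * dist x y \<le> dist z q" using g(2) that by auto
        ultimately have "dist z q < C * R" "R / C \<le> dist z q" by linarith+
        then show ?thesis by simp
      qed
      moreover have "ennreal (K * dist x y) \<le> ennreal (C * dist x y)"
        using C by (intro ennreal_leI mult_right_mono) auto
      ultimately show ?thesis using g by (intro exI[of _ g]) auto
    qed
    then show ?thesis unfolding annularly_quasiconvex_def using C(1) by blast
  qed
  ultimately show ?thesis by blast
qed

end
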